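(* Let $p>1$ (finite). Then there exist constants $c,C>0$ such that for every $f\in W^{1,p}(K)$, $x_0\in K$ and $r>0$, \[ \int_{B(x_0,r)}\big|f(x)-f_{B(x_0,r)}\big|^p\,d\mu(x)\le C\,r^{p-1+d_h}\,\|f\|^p_{W^{1,p}(B(x_0,cr))}, \] where $f_{B(x_0,r)}=\frac1{\mu(B(x_0,r))}\int_{B(x_0,r)}f\,d\mu$.
   Context: Vicsek set. In $\mathbb R^2$ let $q_1=(-\sqrt2/2,\sqrt2/2)$, $q_2=(\sqrt2/2,\sqrt2/2)$, $q_3=(\sqrt2/2,-\sqrt2/2)$, $q_4=(-\sqrt2/2,-\sqrt2/2)$, $q_5=(0,0)$ and $\psi_i(z)=\frac13(z-q_i)+q_i$, $1\le i\le5$. $K$ is the unique non-empty compact set with $K=\bigcup_{i=1}^5\psi_i(K)$. Geodesic distance. Let $\bar V_0$ be the union of the four segments $[q_5,q_i]$, $1\le i\le4$, and $\bar V_{n+1}=\bigcup_i\psi_i(\bar V_n)$; each $\bar V_n\subset K$ is a tree and $\bigcup_n\bar V_n$ is dense in $K$. For $x,y\in\bar V_n$, $d(x,y)$ is the length of the path in $\bar V_n$ from $x$ to $y$, and $d$ is extended by continuity to $K\times K$; $B(x,r)=\{y\in K:d(x,y)\le r\}$. $\mu$ is the Borel probability measure on $K$ with $\mu(\psi_{i_1}\circ\cdots\circ\psi_{i_n}(K))=5^{-n}$; $d_h=\log5/\log3$ and $\alpha_p=1-\frac1p+\frac{d_h}p$. For a Borel set $A\subset K$, \[\|f\|^p_{W^{1,p}(A)}=\limsup_{r\to0^+}\frac1{r^{p\alpha_p}}\int_A\int_{B(x,r)\cap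 A}\frac{|f(y)-f(x)|^p}{\mu(B(x,r))}d\mu(y)d\mu(x),\] and $W^{1,p}(K)=\{f\in L^p(K,\mu):\|f\|_{W^{1,p}(K)}<\infty\}$. *)

theory Defs
  imports "HOL-Analysis.Analysis"
begin

section \<open>The Vicsek set\<close>

text \<open>Only the indices 1 to 5 are used.\<close>

definition vq :: "nat \<Rightarrow> real ^ 2" where
  "vq i = (if i = 1 then vector [- (sqrt 2 / 2), sqrt 2 / 2]
      else if i = 2 then vector [sqrt 2 / 2, sqrt 2 / 2]
      else if i = 3 then vector [sqrt 2 / 2, - (sqrt 2 / 2)]
      else if i = 4 then vector [- (sqrt 2 / 2), - (sqrt 2 / 2)]
      else 0)"

definition vpsi :: "nat \<Rightarrow> real ^ 2 \<Rightarrow> real ^ 2" where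
  "vpsi i z = (1 / 3) *\<^sub>R (z - vq i) + vq i"

definition vicsek :: "(real ^ 2) set" where
  "vicsek = (THE K. compact K \<and> K \<noteq> {} \<and> K = (\<Union>i\<in>{1..5}. vpsi i ` K))"

text \<open>A word is read as a composition with the first letter outermost.\<close>

definition vpsi_word :: "nat list \<Rightarrow> real ^ 2 \<Rightarrow> real ^ 2" where
  "vpsi_word w = foldr vpsi w"


section \<open>The geodesic distance\<close>

primrec vtree :: "nat \<Rightarrow> (real ^ 2) set" where
  "vtree 0 = (\<Union>i\<in>{1..4}. closed_segment (vq 5) (vq i))"
| "vtree (Suc n) = (\<Union>i\<in>{1..5}. vpsi i ` vtree n)"

text \<open>Length of a curve parametrised on the unit interval: the supremum of the lengths of
  the inscribed polygons.\<close>

definition curve_length :: "(real \<Rightarrow> real ^ 2) \<Rightarrow> ennreal" where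
  "curve_length g =
     (SUP ts \<in> {ts. sorted ts \<and> set ts \<subseteq> {0..1}}.
        ennreal (\<Sum>i<length ts - 1. dist (g (ts ! i)) (g (ts ! Suc i))))"

text \<open>Since \<^term>\<open>vtree n\<close> is a tree, the arcs in it joining two given distinct points all
  have the same image, hence the same (finite) length. The diagonal is separate
  because \<^const>\<open>arc\<close> demands injectivity, so that constant paths are not arcs.\<close>

definition vtree_dist :: "nat \<Rightarrow> real ^ 2 \<Rightarrow> real ^ 2 \<Rightarrow> real" where
  "vtree_dist n x y = (if x = y then 0 else
     (THE l. \<exists>g. arc g \<and> path_image g \<subseteq> vtree n \<and> pathstart g = x \<and> pathfinish g = y \<and>
                 l = enn2real (curve_length g)))"

text \<open>The continuous extension to the whole set. It is unique because the union of the
  \<^term>\<open>vtree n\<close> is dense; \<^const>\<open>extensional\<close> only fixes the irrelevant values outside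
  \<^term>\<open>vicsek \<times> vicsek\<close>.\<close>

definition vdist :: "real ^ 2 \<Rightarrow> real ^ 2 \<Rightarrow> real" where
  "vdist x y =
     (THE D. D \<in> extensional (vicsek \<times> vicsek) \<and> continuous_on (vicsek \<times> vicsek) D \<and>
             (\<forall>n. \<forall>u\<in>vtree n. \<forall>v\<in>vtree n. D (u, v) = vtree_dist n u v)) (x, y)"

definition vball :: "real ^ 2 \<Rightarrow> real \<Rightarrow> (real ^ 2) set" where
  "vball x r = {y \<in> vicsek. vdist x y \<le> r}"


section \<open>The self-similar measure\<close>

definition vmeasure :: "(real ^ 2) measure" where
  "vmeasure = (THE M. sets M = sets (restrict_space borel vicsek) \<and>
     emeasure M (space M) = 1 \<and>
     (\<forall>w. set w \<subseteq> {1..5} \<longrightarrow>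
        emeasure M (vpsi_word w ` vicsek) = ennreal (1 / 5 ^ length w)))"


section \<open>Korevaar--Schoen--Sobolev spaces\<close>

definition dh :: real where
  "dh = ln 5 / ln 3"

definition ks_alpha :: "real \<Rightarrow> real" where
  "ks_alpha p = 1 - 1 / p + dh / p"

text \<open>\<^term>\<open>ks_pow p A f\<close> is the \<open>p\<close>-th power of the seminorm of \<open>f\<close> on \<open>A\<close>, with values
  in \<open>[0, \<infinity>]\<close>.\<close>

definition ks_pow :: "real \<Rightarrow> (real ^ 2) set \<Rightarrow> (real ^ 2 \<Rightarrow> real) \<Rightarrow> ennreal" where
  "ks_pow p A f = Limsup (at_right 0) (\<lambda>r.
     ennreal (1 / r powr (p * ks_alpha p)) *
     (\<integral>\<^sup>+x\<in>A. (\<integral>\<^sup>+y\<in>vball x r \<inter> A.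
        ennreal (\<bar>f y - f x\<bar> powr p / measure vmeasure (vball x r)) \<partial>vmeasure) \<partial>vmeasure))"

definition lp_space :: "real \<Rightarrow> (real ^ 2 \<Rightarrow> real) set" where
  "lp_space p = {f. f \<in> borel_measurable vmeasure \<and>
                    integrable vmeasure (\<lambda>x. \<bar>f x\<bar> powr p)}"

definition ks_space :: "real \<Rightarrow> (real ^ 2 \<Rightarrow> real) set" where
  "ks_space p = {f \<in> lp_space p. ks_pow p vicsek f < \<infinity>}"

definition vmean :: "(real ^ 2 \<Rightarrow> real) \<Rightarrow> (real ^ 2) set \<Rightarrow> real" where
  "vmean f B = (1 / measure vmeasure B) * (LINT x:B|vmeasure. f x)"

end

theory Submission
  imports Defs "HOL-Probability.Probability"
begin

text \<open>
  The inequality is proved at each scale \<open>3\<^sup>-\<^sup>n\<close> separately, with the averages of \<open>f\<close> over the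
  level-\<open>n\<close> cells in place of \<open>f\<close>. By Jensen, the difference of the averages over two touching
  cells, and the oscillation of \<open>f\<close> inside a cell, are controlled by the double integral that
  defines the energy at scale \<open>48 / 3 ^ n\<close>. Two level-\<open>n\<close> cells in a level-\<open>m\<close> cell (or in touching
  level-\<open>m\<close> cells) are joined by a chain of at most \<open>2 * 3 ^ (n - m)\<close> pairwise distinct cells, so
  Hoelder's inequality along the chain costs the factor \<open>(2 * 3 ^ (n - m)) powr (p - 1)\<close>, which is
  exactly compensated by the normalisation of the energy. All bounds are uniform in \<open>n\<close>, hence
  they survive the limit superior.

  The geometry enters through one fact: the centres of the level-\<open>n\<close> cells are
  \<open>(sqrt 2 / 3 ^ n) * (a, b)\<close> with integers \<open>a\<close> and \<open>b\<close> of equal parity, so two cells closer than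
  \<open>sqrt 2 / 3 ^ n\<close> coincide or share a corner. Consequently the geodesic distance is
  comparable to the Euclidean one.
\<close>

text \<open>The set, the tree distance, its extension and the measure are definite descriptions, so
  existence and uniqueness of each come before any estimate; this is the larger part of the work.
  The trees are treated through a notion of geodesic set that survives gluing at a point, the
  measure through random streams of letters.

  Distinctness of the cells in a chain matters because every point lies in boundedly many level-n
  cells: the double integrals along a whole chain then cost a single energy, not one energy per
  link.

  With \<open>r\<close> comparable to \<open>1 / 3 ^ m\<close> and \<open>n = m + k\<close>, a ball
  meets at most a constant times \<open>5 ^ k\<close> level-n cells, and each pays the chain factor,
  a constant times \<open>(3 ^ k) powr (p - 1)\<close>. As \<open>3 powr dh = 5\<close>, the product
  is of order \<open>(3 ^ k) powr (p - 1 + dh)\<close>, which the normalising power of the radius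
  \<open>48 / 3 ^ n\<close> turns into \<open>r powr (p - 1 + dh)\<close>.

  Constants: 12 bounds geodesic by Euclidean distance; 48 = 12 * 4 covers two touching cells of
  diameter at most \<open>2 / 3 ^ n\<close>; 84 = 12 * (1 + 2 * 3) covers all level-m cells that
  meet the ball.\<close>

definition vqx :: "nat \<Rightarrow> int" where
  "vqx i = (if i = 1 \<or> i = 4 then -1 else if i = 2 \<or> i = 3 then 1 else 0)"

definition vqy :: "nat \<Rightarrow> int" where
  "vqy i = (if i = 1 \<or> i = 2 then 1 else if i = 3 \<or> i = 4 then -1 else 0)"

lemma vq_nth: "vq i $ 1 = sqrt 2 / 2 * of_int (vqx i)" "vq i $ 2 = sqrt 2 / 2 * of_int (vqy i)"
  by (auto simp: vq_def vqx_def vqy_def)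

lemma vq_5 [simp]: "vq 5 = 0"
  by (simp add: vq_def)

lemma vec2_eqI:
  fixes x y :: "real ^ 2"
  assumes "x $ 1 = y $ 1" "x $ 2 = y $ 2"
  shows "x = y"
  using assms by (simp add: vec_eq_iff forall_2)

lemma norm_vec2: "norm (z :: real ^ 2) = sqrt ((z $ 1)\<^sup>2 + (z $ 2)\<^sup>2)"
  by (simp add: norm_vec_def L2_set_def UNIV_2)

lemma norm_vq: "i \<in> {1..4} \<Longrightarrow> norm (vq i) = 1"
proof -
  assume "i \<in> {1..4}"
  hence "i = 1 \<or> i = 2 \<or> i = 3 \<or> i = 4" by auto
  thus ?thesis by (auto simp: norm_vec2 vq_def power_divide)
qed

lemma norm_vq_le: "norm (vq i) \<le> 1"
proof (cases "i \<in> {1..4}")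
  case False
  hence "vq i = 0" by (auto simp: vq_def)
  thus ?thesis by simp
qed (simp add: norm_vq)

lemma vqx_cases: "vqx i \<in> {-1, 0, 1}" "vqy i \<in> {-1, 0, 1}"
  by (auto simp: vqx_def vqy_def)

lemma even_vqx_vqy: "even (vqx i + vqy i)"
  by (auto simp: vqx_def vqy_def)

lemma vq_index_inj:
  assumes "i \<in> {1..5}" "j \<in> {1..5}" "vqx i = vqx j" "vqy i = vqy j"
  shows "i = j"
proof -
  have "i = 1 \<or> i = 2 \<or> i = 3 \<or> i = 4 \<or> i = 5" "j = 1 \<or> j = 2 \<or> j = 3 \<or> j = 4 \<or> j = 5"
    using assms by auto
  thus ?thesis using assms by (auto simp: vqx_def vqy_def)
qed

lemma vq_corner_ex:
  assumes "\<bar>a\<bar> = 1" "\<bar>b\<bar> = 1"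
  shows "\<exists>i\<in>{1..4}. vqx i = a \<and> vqy i = b"
proof -
  have "a = 1 \<or> a = -1" "b = 1 \<or> b = -1" using assms by arith+
  moreover have "vqx 1 = -1 \<and> vqy 1 = 1" "vqx 2 = 1 \<and> vqy 2 = 1"
    "vqx 3 = 1 \<and> vqy 3 = -1" "vqx 4 = -1 \<and> vqy 4 = -1"
    by (auto simp: vqx_def vqy_def)
  ultimately show ?thesis
    by (elim disjE) (simp_all, rule_tac[1] bexI[of _ 2], rule_tac[3] bexI[of _ 3],
      rule_tac[5] bexI[of _ 1], rule_tac[7] bexI[of _ 4], auto)
qed

text \<open>The opposite corner. Each arm of the figure touches the central cell at the corner
  opposite to the one that its own map fixes.\<close>

definition vopp :: "nat \<Rightarrow> nat" where
  "vopp i = (if i = 1 then 3 else if i = 2 then 4 else if i = 3 then 1 else if i = 4 then 2 else i)"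

lemma vq_vopp: "vq (vopp i) = - vq i"
  by (rule vec2_eqI) (auto simp: vopp_def vq_def)

lemma vopp_mem: "i \<in> {1..4} \<Longrightarrow> vopp i \<in> {1..4}"
  by (auto simp: vopp_def)

lemma vpsi_eq: "vpsi i z = (1/3) *\<^sub>R z + (2/3) *\<^sub>R vq i"
proof -
  have "vq i = (1/3) *\<^sub>R vq i + (2/3) *\<^sub>R vq i" by (simp flip: scaleR_left_distrib)
  thus ?thesis unfolding vpsi_def by (simp add: algebra_simps)
qed

lemma vpsi_fixed [simp]: "vpsi i (vq i) = vq i"
  by (simp add: vpsi_def)

text \<open>Both sides are one third of \<open>vq i\<close>: this is the point where arm
  \<open>i\<close> is attached to the central cell.\<close>

lemma vpsi_vopp: "vpsi i (vq (vopp i)) = vpsi 5 (vq i)"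
  unfolding vpsi_eq vq_vopp by (simp add: algebra_simps flip: scaleR_left_distrib)

lemma dist_vpsi: "dist (vpsi i x) (vpsi i y) = dist x y / 3"
proof -
  have "vpsi i x - vpsi i y = (1/3) *\<^sub>R (x - y)" by (simp add: vpsi_def algebra_simps)
  thus ?thesis by (simp add: dist_norm)
qed

lemma inj_vpsi: "inj (vpsi i)"
  by (rule injI) (metis dist_vpsi dist_eq_0_iff divide_eq_0_iff zero_neq_numeral)

lemma continuous_vpsi [continuous_intros]: "continuous_on A (vpsi i)"
  unfolding vpsi_def by (intro continuous_intros)

lemma norm_vpsi: "norm z \<le> 1 \<Longrightarrow> norm (vpsi i z) \<le> 1"
proof -
  assume z: "norm z \<le> 1"
  have "norm (vpsi i z) \<le> (1/3) * norm z + (2/3) * norm (vq i)"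
    unfolding vpsi_eq by (rule norm_triangle_le) simp
  thus ?thesis using z norm_vq_le[of i] by simp
qed

section \<open>Words and cells\<close>

definition vwords :: "nat \<Rightarrow> nat list set" where
  "vwords n = {w. set w \<subseteq> {1..5} \<and> length w = n}"

lemma finite_vwords [simp]: "finite (vwords n)"
  unfolding vwords_def by (rule finite_lists_length_eq) simp

lemma card_vwords: "card (vwords n) = 5 ^ n"
  unfolding vwords_def by (subst card_lists_length_eq) simp_all

lemma vwords_0 [simp]: "vwords 0 = {[]}"
  by (auto simp: vwords_def)

lemma vwords_append: "u \<in> vwords m \<Longrightarrow> v \<in> vwords n \<Longrightarrow> u @ v \<in> vwords (m + n)"
  by (auto simp: vwords_def)

lemma vwords_Cons: "i # w \<in> vwords (Suc n) \<longleftrightarrow> i \<in> {1..5} \<and> w \<in> vwords n"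
  by (auto simp: vwords_def)

lemma vwords_Suc: "vwords (Suc n) = (\<Union>i\<in>{1..5}. Cons i ` vwords n)"
proof (intro set_eqI iffI)
  fix w assume "w \<in> vwords (Suc n)"
  thus "w \<in> (\<Union>i\<in>{1..5}. Cons i ` vwords n)" by (cases w) (auto simp: vwords_def)
qed (auto simp: vwords_def)

lemma vwords_split: "w \<in> vwords (m + n) \<Longrightarrow> take m w \<in> vwords m \<and> drop m w \<in> vwords n"
  by (auto simp: vwords_def dest: in_set_takeD in_set_dropD)

lemma length_vwords: "w \<in> vwords n \<Longrightarrow> length w = n"
  by (simp add: vwords_def)

lemma vpsi_word_Nil [simp]: "vpsi_word [] z = z"
  and vpsi_word_Cons [simp]: "vpsi_word (i # w) z = vpsi i (vpsi_word w z)"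
  and vpsi_word_append: "vpsi_word (u @ v) z = vpsi_word u (vpsi_word v z)"
  by (simp_all add: vpsi_word_def)

text \<open>Balanced ternary: the word is a numeral with digits -1, 0, 1, leading digit first.
  Together \<open>wx\<close> and \<open>wy\<close> give the centre of a cell in units of
  \<open>sqrt 2 / 3 ^ length w\<close>.\<close>

primrec wx :: "nat list \<Rightarrow> int" where
  "wx [] = 0" | "wx (i # w) = 3 ^ length w * vqx i + wx w"

primrec wy :: "nat list \<Rightarrow> int" where
  "wy [] = 0" | "wy (i # w) = 3 ^ length w * vqy i + wy w"

lemma vpsi_word_nth:
  "vpsi_word w z $ 1 = (z $ 1 + sqrt 2 * of_int (wx w)) / 3 ^ length w"
  "vpsi_word w z $ 2 = (z $ 2 + sqrt 2 * of_int (wy w)) / 3 ^ length w"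
  by (induction w) (simp_all add: vpsi_eq vq_nth field_simps)

lemma dist_vpsi_word: "dist (vpsi_word w x) (vpsi_word w y) = dist x y / 3 ^ length w"
  by (induction w) (simp_all add: dist_vpsi)

lemma continuous_vpsi_word [continuous_intros]: "continuous_on A (vpsi_word w)"
proof -
  have "(1 / 3 ^ length w)-lipschitz_on A (vpsi_word w)"
    by (auto simp: lipschitz_on_def dist_vpsi_word)
  thus ?thesis by (rule lipschitz_on_continuous_on)
qed

lemma even_wx_wy: "even (wx w + wy w)"
proof (induction w)
  case (Cons i w)
  have "wx (i # w) + wy (i # w) = 3 ^ length w * (vqx i + vqy i) + (wx w + wy w)"
    by (simp add: algebra_simps)
  thus ?case using Cons even_vqx_vqy[of i] by (metis dvd_add dvd_mult)
qed simp

lemma wx_snoc: "wx (w @ [i]) = 3 * wx w + vqx i" "wy (w @ [i]) = 3 * wy w + vqy i"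
  by (induction w) (simp_all add: algebra_simps)

text \<open>Both digits of the last letter can be read off modulo 3, and the five letters have
  distinct digit pairs; hence the induction peels letters from the right.\<close>

lemma wx_wy_inj:
  assumes "u \<in> vwords n" "v \<in> vwords n" "wx u = wx v" "wy u = wy v"
  shows "u = v"
  using assms
proof (induction n arbitrary: u v)
  case (Suc n)
  from Suc.prems obtain u' i where u: "u = u' @ [i]"
    by (cases u rule: rev_cases) (auto simp: vwords_def)
  from Suc.prems obtain v' j where v: "v = v' @ [j]"
    by (cases v rule: rev_cases) (auto simp: vwords_def)
  have i: "i \<in> {1..5}" and j: "j \<in> {1..5}" and u': "u' \<in> vwords n" and v': "v' \<in> vwords n"
    using Suc.prems unfolding u v vwords_def by auto
  have x: "3 * wx u' + vqx i = 3 * wx v' + vqx j" and y: "3 * wy u' + vqy i = 3 * wy v' + vqy j"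
    using Suc.prems unfolding u v wx_snoc by auto
  have "vqx i = vqx j" "wx u' = wx v'" using x vqx_cases(1)[of i] vqx_cases(1)[of j] by auto presburger+
  moreover have "vqy i = vqy j" "wy u' = wy v'" using y vqx_cases(2)[of i] vqx_cases(2)[of j] by auto presburger+
  ultimately show ?case using Suc.IH[OF u' v'] vq_index_inj[OF i j] u v by simp
qed simp

text \<open>The convex hull of the four corners. The incidence arguments use the set and the trees
  only through their inclusion in this square, so one lemma serves both.\<close>

definition vsquare :: "(real ^ 2) set" where
  "vsquare = {z. \<bar>z $ 1\<bar> \<le> sqrt 2 / 2 \<and> \<bar>z $ 2\<bar> \<le> sqrt 2 / 2}"

text \<open>Two points of the square differ by at most \<open>sqrt 2\<close> in each coordinate, so
  closeness forces the integer coordinates of the cells to differ by less than 2. Injectivity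
  excludes the difference (0, 0) and parity excludes a difference in just one coordinate; what
  remains is a diagonal neighbour, which shares a corner. A genuine common point needs extreme
  values in both coordinates, hence is that corner.\<close>

lemma cells_close:
  assumes u: "u \<in> vwords n" and v: "v \<in> vwords n" and "u \<noteq> v" and x: "x \<in> vsquare" and y: "y \<in> vsquare"
    and d: "dist (vpsi_word u x) (vpsi_word v y) < sqrt 2 / 3 ^ n"
  obtains i where "i \<in> {1..4}" "wx v - wx u = vqx i" "wy v - wy u = vqy i"
    "vpsi_word u (vq i) = vpsi_word v (vq (vopp i))"
    "vpsi_word u x = vpsi_word v y \<Longrightarrow> x = vq i"
proof -
  have len: "length u = n" "length v = n" using u v by (auto simp: vwords_def)
  have c: "\<bar>a - b\<bar> \<le> 1" if "\<bar>s\<bar> \<le> sqrt 2 / 2" "\<bar>t\<bar> \<le> sqrt 2 / 2"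
     and "\<bar>(s + sqrt 2 * of_int a) / 3 ^ n - (t + sqrt 2 * of_int b) / 3 ^ n\<bar> < sqrt 2 / 3 ^ n"
    for a b :: int and s t :: real
  proof -
    have "\<bar>(s + sqrt 2 * of_int a) / 3 ^ n - (t + sqrt 2 * of_int b) / 3 ^ n\<bar>
      = \<bar>(s - t) + sqrt 2 * of_int (a - b)\<bar> / 3 ^ n"
      by (simp add: diff_divide_distrib[symmetric] algebra_simps)
    hence "\<bar>(s - t) + sqrt 2 * of_int (a - b)\<bar> < sqrt 2"
      using that(3) by (simp add: divide_less_cancel)
    hence "\<bar>sqrt 2 * of_int (a - b)\<bar> < sqrt 2 * 2" using that by linarith
    hence "\<bar>of_int (a - b)\<bar> < (2 :: real)" by (simp add: abs_mult)
    thus ?thesis by linarith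
  qed
  have k: "\<bar>vpsi_word u x $ k - vpsi_word v y $ k\<bar> < sqrt 2 / 3 ^ n" for k
    using component_le_norm_cart[of "vpsi_word u x - vpsi_word v y" k] d by (simp add: dist_norm)
  have 1: "\<bar>wx u - wx v\<bar> \<le> 1"
    using c[of "x $ 1" "y $ 1"] x y k[of 1] unfolding vpsi_word_nth len vsquare_def by auto
  have 2: "\<bar>wy u - wy v\<bar> \<le> 1"
    using c[of "x $ 2" "y $ 2"] x y k[of 2] unfolding vpsi_word_nth len vsquare_def by auto
  have "\<not> (wx u = wx v \<and> wy u = wy v)" using wx_wy_inj[OF u v] \<open>u \<noteq> v\<close> by auto
  hence "\<bar>wx v - wx u\<bar> = 1" "\<bar>wy v - wy u\<bar> = 1"
    using 1 2 even_wx_wy[of u] even_wx_wy[of v] by presburger+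
  then obtain i where i: "i \<in> {1..4}" "vqx i = wx v - wx u" "vqy i = wy v - wy u"
    using vq_corner_ex by metis
  have n1: "\<bar>vqx i\<bar> = 1" "\<bar>vqy i\<bar> = 1"
    using i \<open>\<bar>wx v - wx u\<bar> = 1\<close> \<open>\<bar>wy v - wy u\<bar> = 1\<close> by auto
  have A: "real_of_int (wx v) = of_int (wx u) + of_int (vqx i)" "real_of_int (wy v) = of_int (wy u) + of_int (vqy i)"
    using i by simp_all
  show ?thesis
  proof (rule that[OF i(1) i(2)[symmetric] i(3)[symmetric]])
    show "vpsi_word u (vq i) = vpsi_word v (vq (vopp i))"
      by (rule vec2_eqI) (simp_all add: vpsi_word_nth vq_vopp vq_nth len A algebra_simps)
  next
    have e: "s = sqrt 2 / 2 * of_int a"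
      if "(s + sqrt 2 * of_int b) / 3 ^ n = (t + sqrt 2 * (of_int b + of_int a)) / 3 ^ n"
        "\<bar>s\<bar> \<le> sqrt 2 / 2" "\<bar>t\<bar> \<le> sqrt 2 / 2" "\<bar>a\<bar> = 1" for a b :: int and s t :: real
    proof -
      have "s = t + sqrt 2 * of_int a" using that(1) by (simp add: algebra_simps)
      moreover have "a = 1 \<or> a = -1" using that by arith
      ultimately show ?thesis using that by auto
    qed
    assume eq: "vpsi_word u x = vpsi_word v y"
    have "vpsi_word u x $ 1 = vpsi_word v y $ 1" "vpsi_word u x $ 2 = vpsi_word v y $ 2" using eq by simp_all
    hence "x $ 1 = sqrt 2 / 2 * of_int (vqx i)" "x $ 2 = sqrt 2 / 2 * of_int (vqy i)"
      unfolding vpsi_word_nth len A using x y n1 unfolding vsquare_def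
      by (blast intro: e)+
    thus "x = vq i" by (intro vec2_eqI) (simp_all add: vq_nth)
  qed
qed

section \<open>The approximating trees and the attractor\<close>

lemma vtree_subset_Suc: "vtree n \<subseteq> vtree (Suc n)"
proof (induction n)
  case 0
  show ?case
  proof
    fix z assume "z \<in> vtree 0"
    then obtain i t where i: "i \<in> {1..4}" and t: "0 \<le> t" "t \<le> 1" and z: "z = t *\<^sub>R vq i"
      by (auto simp: closed_segment_def)
    show "z \<in> vtree (Suc 0)"
    proof (cases "t \<le> 1/3")
      case True
      have "vpsi 5 ((3 * t) *\<^sub>R vq i) = z" by (simp add: vpsi_eq z)
      moreover have "(3 * t) *\<^sub>R vq i \<in> vtree 0"
        using i t True by (auto simp: closed_segment_def intro!: bexI[of _ i] exI[of _ "3 * t"])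
      ultimately show ?thesis by (auto intro!: bexI[of _ 5])
    next
      case False
      \<comment> \<open>\<open>s\<close> solves \<open>(s + 2) / 3 = t\<close>. It is negative on
        the inner half of the i-th cell, where the preimage lies on the segment towards the opposite
        corner.\<close>
      define s where "s = 3 * t - 2"
      have zs: "vpsi i (s *\<^sub>R vq i) = z"
        by (simp add: vpsi_eq z s_def algebra_simps flip: scaleR_left_distrib)
      have "s *\<^sub>R vq i \<in> vtree 0"
      proof (cases "s \<ge> 0")
        case True
        thus ?thesis using i t False
          by (auto simp: closed_segment_def s_def intro!: bexI[of _ i] exI[of _ s])
      next
        case neg: False
        have "s *\<^sub>R vq i = (- s) *\<^sub>R vq (vopp i)" by (simp add: vq_vopp)
        thus ?thesis using neg False vopp_mem[OF i] t
          by (auto simp: closed_segment_def s_def intro!: bexI[of _ "vopp i"] exI[of _ "- s"])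
      qed
      thus ?thesis using zs i by (auto intro!: bexI[of _ i])
    qed
  qed
next
  case (Suc n)
  thus ?case by (simp only: vtree.simps(2)) (intro UN_mono image_mono; simp)
qed

lemma vtree_mono: "m \<le> n \<Longrightarrow> vtree m \<subseteq> vtree n"
  using lift_Suc_mono_le[of vtree] vtree_subset_Suc by blast

lemma vtree_0_mem: "0 \<in> vtree n" "i \<in> {1..5} \<Longrightarrow> vq i \<in> vtree n"
proof -
  have "0 \<in> vtree 0" by auto
  thus 0: "0 \<in> vtree n" using vtree_mono[of 0 n] by blast
  assume i: "i \<in> {1..5}"
  show "vq i \<in> vtree n"
  proof (cases "i = 5")
    case False
    hence "vq i \<in> vtree 0" using i by (auto intro!: bexI[of _ i])
    thus ?thesis using vtree_mono[of 0 n] by blast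
  qed (simp add: 0)
qed

lemma vtree_norm: "vtree n \<subseteq> cball 0 1"
proof (induction n)
  case 0
  have "closed_segment 0 (vq i) \<subseteq> cball 0 1" for i
    using norm_vq_le[of i] by (intro closed_segment_subset) auto
  thus ?case by auto
next
  case (Suc n)
  thus ?case using norm_vpsi by (fastforce simp: mem_cball)
qed

lemma vpsi_vsquare: "z \<in> vsquare \<Longrightarrow> vpsi i z \<in> vsquare"
proof -
  assume z: "z \<in> vsquare"
  have "\<bar>of_int (vqx i)\<bar> \<le> (1::real)" "\<bar>of_int (vqy i)\<bar> \<le> (1::real)"
    using vqx_cases[of i] by auto
  hence "\<bar>vq i $ 1\<bar> \<le> sqrt 2 / 2" "\<bar>vq i $ 2\<bar> \<le> sqrt 2 / 2"
    unfolding vq_nth abs_mult by (auto simp: mult_left_le)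
  hence "\<bar>(1/3) * z $ 1 + (2/3) * vq i $ 1\<bar> \<le> sqrt 2 / 2" "\<bar>(1/3) * z $ 2 + (2/3) * vq i $ 2\<bar> \<le> sqrt 2 / 2"
    using z unfolding vsquare_def mem_Collect_eq by linarith+
  moreover have "vpsi i z $ 1 = (1/3) * z $ 1 + (2/3) * vq i $ 1" "vpsi i z $ 2 = (1/3) * z $ 2 + (2/3) * vq i $ 2"
    by (simp_all add: vpsi_eq)
  ultimately show ?thesis unfolding vsquare_def by simp
qed

lemma convex_vsquare: "convex vsquare"
proof (rule convexI)
  fix x y :: "real ^ 2" and u v :: real
  assume a: "x \<in> vsquare" "y \<in> vsquare" "0 \<le> u" "0 \<le> v" "u + v = 1"
  have c: "\<bar>u * s + v * t\<bar> \<le> sqrt 2 / 2" if "\<bar>s\<bar> \<le> sqrt 2 / 2" "\<bar>t\<bar> \<le> sqrt 2 / 2" for s t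
  proof -
    have "u * s + v * t \<le> sqrt 2 / 2" using that a by (intro convex_bound_le) auto
    moreover have "u * (- s) + v * (- t) \<le> sqrt 2 / 2" using that a by (intro convex_bound_le) auto
    ultimately show ?thesis by (intro abs_leI) (simp_all only: mult_minus_right minus_add_distrib)
  qed
  have h: "\<bar>x $ 1\<bar> \<le> sqrt 2 / 2" "\<bar>x $ 2\<bar> \<le> sqrt 2 / 2" "\<bar>y $ 1\<bar> \<le> sqrt 2 / 2" "\<bar>y $ 2\<bar> \<le> sqrt 2 / 2"
    using a(1,2) unfolding vsquare_def by simp_all
  show "u *\<^sub>R x + v *\<^sub>R y \<in> vsquare"
    unfolding vsquare_def using c[OF h(1,3)] c[OF h(2,4)] by simp
qed

lemma vtree_vsquare: "vtree n \<subseteq> vsquare"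
proof (induction n)
  case 0
  have "vq i \<in> vsquare" "0 \<in> vsquare" for i
    by (auto simp: vsquare_def vq_def)
  hence "closed_segment 0 (vq i) \<subseteq> vsquare" for i
    using convex_vsquare by (intro closed_segment_subset)
  thus ?case by (simp add: UN_least)
next
  case (Suc n)
  have "vpsi i ` vtree n \<subseteq> vsquare" for i using Suc vpsi_vsquare by blast
  thus ?case by (simp add: UN_least)
qed

lemma vtree_words: "vtree (m + n) = (\<Union>w\<in>vwords m. vpsi_word w ` vtree n)"
proof (induction m)
  case (Suc m)
  show ?case by (auto simp: vwords_Suc Suc image_image)
qed simp

text \<open>A point of \<open>K\<close> farthest from \<open>L\<close> is the image of a point of
  \<open>K\<close> under one of the maps, and the maps shrink distances by 3. So the maximal
  distance is at most a third of itself and vanishes.\<close>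

lemma contraction_fixed_unique:
  assumes K: "compact K" "K \<noteq> {}" "K = (\<Union>i\<in>{1..5}. vpsi i ` K)"
    and L: "compact L" "L \<noteq> {}" "L = (\<Union>i\<in>{1..5}. vpsi i ` L)"
  shows "K \<subseteq> L"
proof -
  have "continuous_on K (\<lambda>x. infdist x L)" by (intro continuous_intros)
  then obtain x where x: "x \<in> K" "\<And>y. y \<in> K \<Longrightarrow> infdist y L \<le> infdist x L"
    using continuous_attains_sup[OF K(1,2)] by metis
  obtain i z where iz: "i \<in> {1..5}" "z \<in> K" "x = vpsi i z" using x(1) K(3) by blast
  obtain y where y: "y \<in> L" "infdist z L = dist z y"
    using infdist_attains_inf[of L z] L compact_imp_closed by metis
  have "vpsi i y \<in> L" using y L(3) iz(1) by blast
  hence "infdist x L \<le> dist x (vpsi i y)" by (rule infdist_le)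
  also have "\<dots> = infdist z L / 3" using iz y by (simp add: dist_vpsi)
  also have "\<dots> \<le> infdist x L / 3" using x(2)[OF iz(2)] by simp
  finally have "infdist x L = 0" using infdist_nonneg[of x L] by linarith
  hence "infdist y L = 0" if "y \<in> K" for y using x(2)[OF that] infdist_nonneg[of y L] by simp
  thus ?thesis using in_closed_iff_infdist_zero[OF compact_imp_closed[OF L(1)] L(2)] by blast
qed

lemma closure_vpsi: "vpsi i ` closure S = closure (vpsi i ` S)"
proof -
  have "vpsi i ` T = (+) ((2/3) *\<^sub>R vq i) ` ((*\<^sub>R) (1/3) ` T)" for T
    by (auto simp: vpsi_eq image_image add.commute)
  thus ?thesis by (simp add: closure_translation closure_scaleR)
qed

text \<open>The increasing union of the trees is bounded and invariant, and the maps commute with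
  closure; so its closure is an admissible compact set, and the only one.\<close>

lemma vicsek_eq_closure: "vicsek = closure (\<Union>n. vtree n)"
  and vicsek_fixed: "vicsek = (\<Union>i\<in>{1..5}. vpsi i ` vicsek)"
proof -
  define U where "U = (\<Union>n. vtree n)"
  have "(\<Union>i\<in>{1..5}. vpsi i ` U) = (\<Union>n. vtree (Suc n))" unfolding U_def by auto
  also have "\<dots> = U" unfolding U_def using vtree_subset_Suc by blast
  finally have U: "(\<Union>i\<in>{1..5}. vpsi i ` U) = U" .
  have fx: "closure U = (\<Union>i\<in>{1..5}. vpsi i ` closure U)"
    unfolding closure_vpsi by (subst (1) U[symmetric]) (simp add: atLeastAtMost_upt upt_rec)
  have "bounded U" using vtree_norm by (auto simp: U_def intro: bounded_subset[OF bounded_cball])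
  hence cpt: "compact (closure U)" by simp
  have "0 \<in> U" using vtree_0_mem by (auto simp: U_def)
  hence ne: "closure U \<noteq> {}" by auto
  have eq: "vicsek = closure U"
    unfolding vicsek_def
  proof (rule the_equality)
    show "compact (closure U) \<and> closure U \<noteq> {} \<and> closure U = (\<Union>i\<in>{1..5}. vpsi i ` closure U)"
      using fx cpt ne by blast
  next
    fix K assume "compact K \<and> K \<noteq> {} \<and> K = (\<Union>i\<in>{1..5}. vpsi i ` K)"
    hence K: "compact K" "K \<noteq> {}" "K = (\<Union>i\<in>{1..5}. vpsi i ` K)" by blast+
    show "K = closure U"
      using contraction_fixed_unique[OF K cpt ne fx] contraction_fixed_unique[OF cpt ne fx K] by blast
  qed
  thus "vicsek = closure (\<Union>n. vtree n)" by (simp add: U_def)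
  show "vicsek = (\<Union>i\<in>{1..5}. vpsi i ` vicsek)" unfolding eq by (rule fx)
qed

lemma compact_vicsek: "compact vicsek"
proof -
  have "bounded (\<Union>n. vtree n)" using vtree_norm by (auto intro: bounded_subset[OF bounded_cball])
  thus ?thesis unfolding vicsek_eq_closure by simp
qed

lemma closed_vicsek: "closed vicsek"
  by (rule compact_imp_closed[OF compact_vicsek])

lemma vtree_subset_vicsek: "vtree n \<subseteq> vicsek"
  unfolding vicsek_eq_closure using closure_subset[of "\<Union>n. vtree n"] by blast

lemma zero_in_vicsek: "0 \<in> vicsek"
  using vtree_subset_vicsek vtree_0_mem(1) by blast

lemma vq_in_vicsek: "i \<in> {1..5} \<Longrightarrow> vq i \<in> vicsek"
  using vtree_subset_vicsek vtree_0_mem(2) by blast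

lemma vicsek_norm: "vicsek \<subseteq> cball 0 1"
  unfolding vicsek_eq_closure by (rule closure_minimal) (use vtree_norm in auto)

lemma vicsek_vsquare: "vicsek \<subseteq> vsquare"
  unfolding vicsek_eq_closure
proof (rule closure_minimal)
  show "closed vsquare" unfolding vsquare_def
    by (intro closed_Collect_conj closed_Collect_le continuous_intros)
qed (use vtree_vsquare in auto)

lemma vicsek_words: "vicsek = (\<Union>w\<in>vwords m. vpsi_word w ` vicsek)"
proof (induction m)
  case (Suc m)
  have "vicsek = (\<Union>i\<in>{1..5}. vpsi i ` (\<Union>w\<in>vwords m. vpsi_word w ` vicsek))"
    using vicsek_fixed Suc by simp
  also have "\<dots> = (\<Union>w\<in>vwords (Suc m). vpsi_word w ` vicsek)"
    by (auto simp: vwords_Suc image_image)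
  finally show ?case .
qed simp

lemma cell_subset_vicsek: "w \<in> vwords m \<Longrightarrow> vpsi_word w ` vicsek \<subseteq> vicsek"
  using vicsek_words[of m] by blast

lemma compact_cell: "compact (vpsi_word w ` vicsek)"
  by (intro compact_continuous_image continuous_intros compact_vicsek)

lemma dist_vicsek: "x \<in> vicsek \<Longrightarrow> y \<in> vicsek \<Longrightarrow> dist x y \<le> 2"
proof -
  assume "x \<in> vicsek" "y \<in> vicsek"
  hence "dist x 0 \<le> 1" "dist y 0 \<le> 1" using vicsek_norm by auto
  thus ?thesis using dist_triangle2[of x y 0] by linarith
qed

lemma dist_cell:
  assumes "w \<in> vwords m" "x \<in> vpsi_word w ` vicsek" "y \<in> vpsi_word w ` vicsek"
  shows "dist x y \<le> 2 / 3 ^ m"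
  using assms dist_vicsek length_vwords[OF assms(1)] by (auto simp: dist_vpsi_word divide_right_mono)


section \<open>Lengths of curves\<close>

text \<open>The inscribed polygon length from \<open>curve_length\<close>, as a real number and for
  a single list, so that list induction applies.\<close>

definition poly_len :: "(real \<Rightarrow> real ^ 2) \<Rightarrow> real list \<Rightarrow> real" where
  "poly_len g ts = (\<Sum>i<length ts - 1. dist (g (ts ! i)) (g (ts ! Suc i)))"

lemma poly_len_simps [simp]:
  "poly_len g [] = 0" "poly_len g [t] = 0"
  "poly_len g (s # t # ts) = dist (g s) (g t) + poly_len g (t # ts)"
  by (simp_all add: poly_len_def sum.lessThan_Suc_shift del: sum.lessThan_Suc)

lemma poly_len_nonneg: "0 \<le> poly_len g ts"
  by (simp add: poly_len_def sum_nonneg)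

lemma poly_len_split: "poly_len g (xs @ t # ys) = poly_len g (xs @ [t]) + poly_len g (t # ys)"
  by (induction xs rule: induct_list012) auto

lemma poly_len_Cons: "poly_len g ys \<le> poly_len g (t # ys)"
  by (cases ys) auto

lemma poly_len_insert: "poly_len g (xs @ ys) \<le> poly_len g (xs @ t # ys)"
proof (induction xs rule: induct_list012)
  case 1
  show ?case by (simp add: poly_len_Cons)
next
  case (2 x)
  show ?case
    by (cases ys) (simp_all add: dist_triangle)
qed simp

lemma poly_len_append: "poly_len g xs + poly_len g ys \<le> poly_len g (xs @ ys)"
  by (induction xs rule: induct_list012) (auto simp: poly_len_Cons)

lemma poly_len_map: "poly_len g (map f ts) = poly_len (\<lambda>t. g (f t)) ts"
  by (induction ts rule: induct_list012) auto

text \<open>The variation of \<open>g\<close> on an arbitrary parameter interval;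
  \<open>curve_length\<close> fixes the unit interval, which is too rigid for cutting a curve in
  two.\<close>

definition clen :: "(real \<Rightarrow> real ^ 2) \<Rightarrow> real \<Rightarrow> real \<Rightarrow> ennreal" where
  "clen g a b = (SUP ts \<in> {ts. sorted ts \<and> set ts \<subseteq> {a..b}}. ennreal (poly_len g ts))"

lemma curve_length_eq_clen: "curve_length g = clen g 0 1"
  by (simp add: curve_length_def clen_def poly_len_def)

lemma clen_upper: "sorted ts \<Longrightarrow> set ts \<subseteq> {a..b} \<Longrightarrow> ennreal (poly_len g ts) \<le> clen g a b"
  unfolding clen_def by (rule SUP_upper) simp

text \<open>Inserting the cut \<open>t\<close> into a list never shortens the polygon, which gives
  one inequality; lists on the two sides of \<open>t\<close> can be concatenated, which gives the
  other.\<close>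

lemma clen_add:
  assumes "a \<le> t" "t \<le> b"
  shows "clen g a b = clen g a t + clen g t b"
proof (rule antisym)
  show "clen g a b \<le> clen g a t + clen g t b"
    unfolding clen_def[of g a b]
  proof (rule SUP_least, clarify)
    fix ts assume ts: "sorted ts" "set ts \<subseteq> {a..b}"
    define xs where "xs = filter (\<lambda>s. s < t) ts"
    define ys where "ys = filter (\<lambda>s. \<not> s < t) ts"
    have "ts = xs @ ys" using ts(1) unfolding xs_def ys_def
    proof (induction ts)
      case (Cons s ts)
      thus ?case
      proof (cases "s < t")
        case False
        hence "filter (\<lambda>s. s < t) (s # ts) = []" using Cons.prems by (auto simp: filter_empty_conv)
        moreover have "filter (\<lambda>s. \<not> s < t) (s # ts) = s # ts" using Cons.prems False by (auto simp: filter_id_conv)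
        ultimately show ?thesis by simp
      qed simp
    qed simp
    hence "poly_len g ts \<le> poly_len g (xs @ [t]) + poly_len g (t # ys)"
      using poly_len_insert[of g xs ys t] poly_len_split[of g xs t ys] by simp
    hence "ennreal (poly_len g ts) \<le> ennreal (poly_len g (xs @ [t])) + ennreal (poly_len g (t # ys))"
      by (simp add: poly_len_nonneg flip: ennreal_plus)
    also have "\<dots> \<le> clen g a t + clen g t b"
    proof (intro add_mono clen_upper)
      show "sorted (xs @ [t])" "sorted (t # ys)" using ts(1) by (auto simp: xs_def ys_def sorted_append sorted_wrt_filter)
      show "set (xs @ [t]) \<subseteq> {a..t}" "set (t # ys) \<subseteq> {t..b}" using ts(2) assms by (auto simp: xs_def ys_def)
    qed
    finally show "ennreal (poly_len g ts) \<le> clen g a t + clen g t b" .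
  qed
next
  have le: "ennreal (poly_len g xs) + ennreal (poly_len g ys) \<le> clen g a b"
    if "sorted xs" "set xs \<subseteq> {a..t}" "sorted ys" "set ys \<subseteq> {t..b}" for xs ys
  proof -
    have "ennreal (poly_len g xs) + ennreal (poly_len g ys) \<le> ennreal (poly_len g (xs @ ys))"
      using poly_len_append[of g xs ys] by (simp add: poly_len_nonneg flip: ennreal_plus)
    also have "\<dots> \<le> clen g a b" using that assms
      by (intro clen_upper) (fastforce simp: sorted_append)+
    finally show ?thesis .
  qed
  have ne: "{ts. sorted ts \<and> set ts \<subseteq> {a'..b'}} \<noteq> {}" for a' b' :: real
    by (auto intro: exI[of _ "[]"])
  have le': "ennreal (poly_len g xs) + clen g t b \<le> clen g a b" if "sorted xs" "set xs \<subseteq> {a..t}" for xs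
    unfolding clen_def[of g t b]
    by (subst ennreal_SUP_add_right[OF ne]) (use that le in \<open>auto intro!: SUP_least\<close>)
  show "clen g a t + clen g t b \<le> clen g a b"
    unfolding clen_def[of g a t]
    by (subst ennreal_SUP_add_left[OF ne, symmetric]) (use le' in \<open>auto intro!: SUP_least\<close>)
qed

lemma curve_length_subpath:
  assumes "u < v"
  shows "curve_length (subpath u v g) = clen g u v"
  unfolding curve_length_eq_clen
proof (rule antisym)
  let ?f = "\<lambda>x. (v - u) * x + u"
  show "clen (subpath u v g) 0 1 \<le> clen g u v"
    unfolding clen_def[of "subpath u v g"]
  proof (rule SUP_least, clarify)
    fix ts :: "real list" assume ts: "sorted ts" "set ts \<subseteq> {0..1}"
    have "sorted (map ?f ts)"
      using ts(1) assms by (auto simp: sorted_map mult_left_mono elim!: sorted_wrt_mono_rel[rotated])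
    moreover have "set (map ?f ts) \<subseteq> {u..v}"
    proof clarsimp
      fix x assume "x \<in> set ts"
      hence x: "0 \<le> x" "x \<le> 1" using ts(2) by auto
      show "0 \<le> (v - u) * x \<and> (v - u) * x + u \<le> v"
        using assms x mult_left_le[of x "v - u"] by (simp add: add_le_imp_le_diff le_diff_eq[symmetric])
    qed
    ultimately show "ennreal (poly_len (subpath u v g) ts) \<le> clen g u v"
      using clen_upper[of "map ?f ts" u v g] by (simp add: poly_len_map subpath_def)
  qed
  let ?h = "\<lambda>x. (x - u) / (v - u)"
  show "clen g u v \<le> clen (subpath u v g) 0 1"
    unfolding clen_def[of g]
  proof (rule SUP_least, clarify)
    fix ts :: "real list" assume ts: "sorted ts" "set ts \<subseteq> {u..v}"
    have "sorted (map ?h ts)"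
      using ts(1) assms by (auto simp: sorted_map divide_right_mono elim!: sorted_wrt_mono_rel[rotated])
    moreover have "set (map ?h ts) \<subseteq> {0..1}"
      using ts(2) assms by auto
    moreover have "poly_len (subpath u v g) (map ?h ts) = poly_len g ts"
      using assms by (simp add: poly_len_map subpath_def)
    ultimately show "ennreal (poly_len g ts) \<le> clen (subpath u v g) 0 1"
      using clen_upper[of "map ?h ts" 0 1 "subpath u v g"] by simp
  qed
qed

lemma curve_length_split:
  assumes "0 < t" "t < 1"
  shows "curve_length g = curve_length (subpath 0 t g) + curve_length (subpath t 1 g)"
  using assms by (simp add: curve_length_subpath clen_add[of 0 t 1] curve_length_eq_clen[of g])

lemma curve_length_ge_dist: "ennreal (dist (pathstart g) (pathfinish g)) \<le> curve_length g"
  using clen_upper[of "[0, 1]" 0 1 g]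
  by (simp add: curve_length_eq_clen pathstart_def pathfinish_def)

lemma curve_length_vpsi: "curve_length (vpsi i \<circ> g) = ennreal (1 / 3) * curve_length g"
proof -
  have "poly_len (vpsi i \<circ> g) ts = 1 / 3 * poly_len g ts" for ts
    by (induction ts rule: induct_list012) (auto simp: dist_vpsi)
  hence "ennreal (poly_len (vpsi i \<circ> g) ts) = ennreal (1 / 3) * ennreal (poly_len g ts)" for ts
    by (metis ennreal_mult poly_len_nonneg zero_le_divide_1_iff zero_le_numeral)
  thus ?thesis
    unfolding curve_length_eq_clen clen_def by (simp only: SUP_mult_left_ennreal)
qed

section \<open>Geodesic trees\<close>

text \<open>The part of being a tree that the distance needs: any two points are joined by an arc,
  and all arcs between them have the same finite length \<open>d\<close>. The notion holds for
  segments and is inherited by images under \<open>vpsi\<close> and by unions of two sets with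
  exactly one common point, which is how the trees are built.\<close>

definition geo :: "(real ^ 2) set \<Rightarrow> (real ^ 2 \<Rightarrow> real ^ 2 \<Rightarrow> real) \<Rightarrow> bool" where
  "geo T d \<longleftrightarrow> closed T \<and>
     (\<forall>x\<in>T. \<forall>y\<in>T. x \<noteq> y \<longrightarrow>
        (\<exists>g. arc g \<and> path_image g \<subseteq> T \<and> pathstart g = x \<and> pathfinish g = y)) \<and>
     (\<forall>g. arc g \<longrightarrow> path_image g \<subseteq> T \<longrightarrow>
        curve_length g = ennreal (d (pathstart g) (pathfinish g))) \<and>
     (\<forall>x\<in>T. d x x = 0) \<and> (\<forall>x\<in>T. \<forall>y\<in>T. 0 \<le> d x y) \<and>
     (\<forall>x\<in>T. \<forall>y\<in>T. \<forall>z\<in>T. d x z \<le> d x y + d y z)"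

lemma geoD:
  assumes "geo T d"
  shows "closed T"
    and "x \<in> T \<Longrightarrow> y \<in> T \<Longrightarrow> x \<noteq> y \<Longrightarrow> \<exists>g. arc g \<and> path_image g \<subseteq> T \<and> pathstart g = x \<and> pathfinish g = y"
    and "arc g \<Longrightarrow> path_image g \<subseteq> T \<Longrightarrow> curve_length g = ennreal (d (pathstart g) (pathfinish g))"
    and "x \<in> T \<Longrightarrow> d x x = 0"
    and "x \<in> T \<Longrightarrow> y \<in> T \<Longrightarrow> 0 \<le> d x y"
    and "x \<in> T \<Longrightarrow> y \<in> T \<Longrightarrow> z \<in> T \<Longrightarrow> d x z \<le> d x y + d y z"
  using assms unfolding geo_def by blast+

text \<open>An arc in the smaller set is also an arc in the larger one, and its length does not
  depend on the ambient set.\<close>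

lemma geo_subset_eq:
  assumes T: "geo T d" and S: "geo S e" and "T \<subseteq> S" and xy: "x \<in> T" "y \<in> T"
  shows "e x y = d x y"
proof (cases "x = y")
  case True
  thus ?thesis using geoD(4)[OF T] geoD(4)[OF S] assms by auto
next
  case False
  obtain g where g: "arc g" "path_image g \<subseteq> T" "pathstart g = x" "pathfinish g = y"
    using geoD(2)[OF T xy False] by blast
  have "ennreal (d x y) = ennreal (e x y)"
    using geoD(3)[OF T g(1,2)] geoD(3)[OF S g(1)] g \<open>T \<subseteq> S\<close> by auto
  moreover have "0 \<le> d x y" "0 \<le> e x y" using geoD(5)[OF T xy] geoD(5)[OF S] xy \<open>T \<subseteq> S\<close> by blast+
  ultimately show ?thesis by simp
qed

lemma geo_ge_dist:
  assumes T: "geo T d" and xy: "x \<in> T" "y \<in> T"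
  shows "dist x y \<le> d x y"
proof (cases "x = y")
  case True
  thus ?thesis using geoD(4)[OF T] assms by auto
next
  case False
  obtain g where g: "arc g" "path_image g \<subseteq> T" "pathstart g = x" "pathfinish g = y"
    using geoD(2)[OF T xy False] by blast
  have "ennreal (dist x y) \<le> ennreal (d x y)"
    using curve_length_ge_dist[of g] geoD(3)[OF T g(1,2)] g(3,4) by simp
  thus ?thesis using geoD(5)[OF T xy] by simp
qed

text \<open>The scalar coordinate of an arc in a segment is continuous and injective, hence
  monotone, so the polygon lengths telescope.\<close>

lemma geo_segment:
  assumes "a \<noteq> b"
  shows "geo (closed_segment a b) dist"
  unfolding geo_def
proof (intro conjI ballI impI allI)
  fix x y assume "x \<in> closed_segment a b" "y \<in> closed_segment a b" "x \<noteq> y"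
  thus "\<exists>g. arc g \<and> path_image g \<subseteq> closed_segment a b \<and> pathstart g = x \<and> pathfinish g = y"
    by (intro exI[of _ "linepath x y"]) (simp add: subset_closed_segment)
next
  fix g :: "real \<Rightarrow> real ^ 2" assume g: "arc g" "path_image g \<subseteq> closed_segment a b"
  define f where "f = (\<lambda>t. ((g t - a) \<bullet> (b - a)) / ((b - a) \<bullet> (b - a)))"
  have gf: "g t = a + f t *\<^sub>R (b - a)" if "t \<in> {0..1}" for t
  proof -
    have "g t \<in> closed_segment a b" using g(2) that by (auto simp: path_image_def)
    then obtain s where "g t = a + s *\<^sub>R (b - a)" by (auto simp: closed_segment_def algebra_simps)
    moreover from this have "f t = s" using assms by (simp add: f_def)
    ultimately show ?thesis by simp
  qed
  have inj: "inj_on f {0..1}"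
  proof (rule inj_onI)
    fix s t assume "s \<in> {0..1}" "t \<in> {0..1}" "f s = f t"
    moreover from this have "g s = g t" using gf by metis
    ultimately show "s = t" using g(1) by (auto simp: arc_def inj_on_def)
  qed
  have cont: "continuous_on {0..1} f"
    unfolding f_def using g(1) by (intro continuous_intros) (use assms in \<open>auto simp: arc_def path_def\<close>)
  have df: "dist (g s) (g t) = \<bar>f s - f t\<bar> * dist a b" if "s \<in> {0..1}" "t \<in> {0..1}" for s t
  proof -
    have "g s - g t = (f s - f t) *\<^sub>R (b - a)"
      by (subst gf[OF that(1)], subst gf[OF that(2)]) (simp add: scaleR_left_diff_distrib)
    thus ?thesis by (simp add: dist_norm norm_minus_commute)
  qed
  \<comment> \<open>\<open>h\<close> is plus or minus \<open>f\<close> times the length of the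
    segment, with the sign that makes it increasing; distances along the arc become differences of
    \<open>h\<close>.\<close>
  obtain h where h: "\<And>s t. s \<in> {0..1} \<Longrightarrow> t \<in> {0..1} \<Longrightarrow> s \<le> t \<Longrightarrow> dist (g s) (g t) = h t - h s"
  proof -
    have "strict_mono_on {0..1} f \<or> strict_antimono_on {0..1} f"
      using injective_eq_monotone_map[of "{0..1}" f] inj cont by auto
    thus ?thesis
    proof
      assume m: "strict_mono_on {0..1} f"
      show ?thesis
      proof (rule that[of "\<lambda>t. f t * dist a b"])
        fix s t :: real assume st: "s \<in> {0..1}" "t \<in> {0..1}" "s \<le> t"
        hence "f s \<le> f t" using m by (cases "s = t") (auto dest!: monotone_onD[of _ _ _ f s t])
        thus "dist (g s) (g t) = f t * dist a b - f s * dist a b" using df st by (simp add: algebra_simps)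
      qed
    next
      assume m: "strict_antimono_on {0..1} f"
      show ?thesis
      proof (rule that[of "\<lambda>t. - f t * dist a b"])
        fix s t :: real assume st: "s \<in> {0..1}" "t \<in> {0..1}" "s \<le> t"
        hence "f t \<le> f s" using m by (cases "s = t") (auto dest!: monotone_onD[of _ _ _ f s t])
        thus "dist (g s) (g t) = - f t * dist a b - - f s * dist a b" using df st by (simp add: algebra_simps)
      qed
    qed
  qed
  have le: "poly_len g (t # ts) \<le> h 1 - h t" if "sorted (t # ts)" "set (t # ts) \<subseteq> {0..1}" for t ts
    using that
  proof (induction ts arbitrary: t)
    case Nil
    thus ?case using h[of t 1] zero_le_dist[of "g t" "g 1"] by simp
  next
    case (Cons s ts)
    have "poly_len g (s # ts) \<le> h 1 - h s" using Cons.prems by (intro Cons.IH) auto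
    moreover have "dist (g t) (g s) = h s - h t" using Cons.prems by (intro h) auto
    ultimately show ?case by simp
  qed
  have "clen g 0 1 \<le> ennreal (dist (g 0) (g 1))"
    unfolding clen_def
  proof (rule SUP_least, clarify)
    fix ts :: "real list" assume ts: "sorted ts" "set ts \<subseteq> {0..1}"
    have "poly_len g ts \<le> dist (g 0) (g 1)"
    proof (cases ts)
      case (Cons t us)
      have "t \<in> {0..1}" using ts Cons by auto
      thus ?thesis using le[of t us] ts h[of 0 1] h[of 0 t] zero_le_dist[of "g 0" "g t"] unfolding Cons by simp
    qed simp
    thus "ennreal (poly_len g ts) \<le> ennreal (dist (g 0) (g 1))" by (simp add: ennreal_leI)
  qed
  thus "curve_length g = ennreal (dist (pathstart g) (pathfinish g))"
    using curve_length_ge_dist[of g] by (simp add: curve_length_eq_clen pathstart_def pathfinish_def)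
qed (auto simp: dist_triangle)

section \<open>Gluing geodesic sets at a single point\<close>

lemma arc_hits_separator:
  assumes g: "path g" "path_image g \<subseteq> A \<union> B" and cl: "closed A" "closed B" and AB: "A \<inter> B \<subseteq> {p}"
    and uv: "0 \<le> u" "u \<le> v" "v \<le> 1" and "g u \<in> A \<and> g v \<in> B \<or> g u \<in> B \<and> g v \<in> A"
  obtains t where "u \<le> t" "t \<le> v" "g t = p"
proof -
  have sub: "{u..v} \<subseteq> {0..1}" using uv by auto
  \<comment> \<open>A connected image covered by two closed sets and meeting both must meet their
    intersection, which contains at most \<open>p\<close>.\<close>
  have "connected (g ` {u..v})"
    using g(1) uv by (intro connected_continuous_image) (auto simp: path_def intro: continuous_on_subset)
  moreover have "g ` {u..v} \<subseteq> A \<union> B" using g(2) image_mono[OF sub, of g] by (simp add: path_image_def)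
  moreover have "g u \<in> g ` {u..v}" "g v \<in> g ` {u..v}" using uv by auto
  ultimately have "A \<inter> B \<inter> g ` {u..v} \<noteq> {}"
    using cl assms(9) unfolding connected_closed by (metis IntI emptyE)
  thus ?thesis using AB that by force
qed

text \<open>An excursion out of \<open>A\<close> would pass through \<open>p\<close> once when
  leaving and once when returning, against injectivity.\<close>

lemma arc_stays:
  assumes g: "arc g" "path_image g \<subseteq> A \<union> B" and cl: "closed A" "closed B" and AB: "A \<inter> B = {p}"
    and xy: "pathstart g \<in> A" "pathfinish g \<in> A"
  shows "path_image g \<subseteq> A"
proof
  fix z assume "z \<in> path_image g"
  then obtain s where s: "s \<in> {0..1}" "z = g s" by (auto simp: path_image_def)
  show "z \<in> A"
  proof (rule ccontr)
    assume "z \<notin> A"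
    hence B: "g s \<in> B" using s g(2) unfolding path_image_def by blast
    have p: "path g" "A \<inter> B \<subseteq> {p}" using g(1) AB by (auto simp: arc_def)
    obtain t1 where t1: "0 \<le> t1" "t1 \<le> s" "g t1 = p"
      using arc_hits_separator[OF p(1) g(2) cl p(2), of 0 s] B s xy by (auto simp: pathstart_def)
    obtain t2 where t2: "s \<le> t2" "t2 \<le> 1" "g t2 = p"
      using arc_hits_separator[OF p(1) g(2) cl p(2), of s 1] B s xy by (auto simp: pathfinish_def)
    have "t1 = t2" using g(1) t1 t2 s by (auto simp: arc_def dest!: inj_onD[of g _ t1 t2])
    hence "g s = p" using t1 t2 by auto
    thus False using AB \<open>z \<notin> A\<close> s by auto
  qed
qed

text \<open>Cut at the time of passing \<open>p\<close>: by \<open>arc_stays\<close> each half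
  remains in one piece, where its length is known.\<close>

lemma arc_across:
  assumes A: "geo A dA" and B: "geo B dB" and AB: "A \<inter> B = {p}"
    and g: "arc g" "path_image g \<subseteq> A \<union> B" "pathstart g \<in> A" "pathstart g \<notin> B" "pathfinish g \<in> B" "pathfinish g \<notin> A"
  shows "curve_length g = ennreal (dA (pathstart g) p + dB p (pathfinish g))"
proof -
  have p: "path g" "A \<inter> B \<subseteq> {p}" using g(1) AB by (auto simp: arc_def)
  obtain t where t: "0 \<le> t" "t \<le> 1" "g t = p"
    using arc_hits_separator[OF p(1) g(2) geoD(1)[OF A] geoD(1)[OF B] p(2), of 0 1] g
    by (auto simp: pathstart_def pathfinish_def)
  have "t \<noteq> 0" "t \<noteq> 1" using t g AB by (auto simp: pathstart_def pathfinish_def)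
  hence t01: "0 < t" "t < 1" using t by auto
  have 1: "arc (subpath 0 t g)" "arc (subpath t 1 g)" using t01 g(1) by (auto intro: arc_subpath_arc)
  have 2: "path_image (subpath 0 t g) \<subseteq> A \<union> B" "path_image (subpath t 1 g) \<subseteq> A \<union> B"
    using g(2) path_image_subpath_subset[of 0 t g] path_image_subpath_subset[of t 1 g] t01 by auto
  have pA: "p \<in> A" "p \<in> B" using AB by auto
  have 3: "path_image (subpath 0 t g) \<subseteq> A"
    using arc_stays[OF 1(1) 2(1) geoD(1)[OF A] geoD(1)[OF B] AB] g t pA by (simp add: pathstart_def pathfinish_def subpath_def)
  have 4: "path_image (subpath t 1 g) \<subseteq> B"
    using arc_stays[OF 1(2) _ geoD(1)[OF B] geoD(1)[OF A]] 2(2) AB g t pA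
    by (simp add: pathstart_def pathfinish_def subpath_def Un_commute Int_commute)
  have "curve_length g = ennreal (dA (pathstart g) p) + ennreal (dB p (pathfinish g))"
    using curve_length_split[OF t01, of g] geoD(3)[OF A 1(1) 3] geoD(3)[OF B 1(2) 4] t
    by (simp add: pathstart_def pathfinish_def subpath_def)
  thus ?thesis using geoD(5)[OF A g(3) pA(1)] geoD(5)[OF B pA(2) g(5)] by simp
qed

lemma arc_exists_across:
  assumes A: "geo A dA" and B: "geo B dB" and AB: "A \<inter> B = {p}" and "x \<in> A" "y \<in> B" "x \<noteq> y"
  shows "\<exists>g. arc g \<and> path_image g \<subseteq> A \<union> B \<and> pathstart g = x \<and> pathfinish g = y"
proof -
  have p: "p \<in> A" "p \<in> B" using AB by auto
  consider "x = p" | "y = p" | "x \<noteq> p" "y \<noteq> p" by blast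
  thus ?thesis
  proof cases
    case 1
    thus ?thesis using geoD(2)[OF B p(2) \<open>y \<in> B\<close>] assms(6) by blast
  next
    case 2
    thus ?thesis using geoD(2)[OF A \<open>x \<in> A\<close> p(1)] assms(6) by blast
  next
    case 3
    obtain g where g: "arc g" "path_image g \<subseteq> A" "pathstart g = x" "pathfinish g = p"
      using geoD(2)[OF A \<open>x \<in> A\<close> p(1) 3(1)] by blast
    obtain h where h: "arc h" "path_image h \<subseteq> B" "pathstart h = p" "pathfinish h = y"
      using geoD(2)[OF B p(2) \<open>y \<in> B\<close>] 3 by blast
    have "arc (g +++ h)" using g h AB by (intro arc_join) auto
    moreover have "path_image (g +++ h) \<subseteq> A \<union> B" using g h by (subst path_image_join) auto
    ultimately show ?thesis using g h by (intro exI[of _ "g +++ h"]) simp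
  qed
qed

lemma geo_glue:
  assumes A: "geo A dA" and B: "geo B dB" and AB: "A \<inter> B = {p}"
  shows "\<exists>d. geo (A \<union> B) d"
proof -
  \<comment> \<open>Points of different pieces are joined through \<open>p\<close>. The cases are
    consistent at \<open>p\<close> because \<open>dA p p\<close> and \<open>dB p p\<close> both
    vanish.\<close>
  define d where "d = (\<lambda>x y. if x \<in> A \<and> y \<in> A then dA x y else if x \<in> B \<and> y \<in> B then dB x y
    else if x \<in> A then dA x p + dB p y else dB x p + dA p y)"
  have BA: "B \<inter> A = {p}" using AB by auto
  have p: "p \<in> A" "p \<in> B" using AB by auto
  have both: "x = p" if "x \<in> A" "x \<in> B" for x using AB that by auto
  note cl = geoD(1)[OF A] geoD(1)[OF B]
  have "geo (A \<union> B) d"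
    unfolding geo_def
  proof (intro conjI ballI impI allI)
    fix x y assume xy: "x \<in> A \<union> B" "y \<in> A \<union> B" "x \<noteq> y"
    consider "x \<in> A" "y \<in> A" | "x \<in> B" "y \<in> B" | "x \<in> A" "y \<in> B" | "x \<in> B" "y \<in> A" using xy by blast
    thus "\<exists>g. arc g \<and> path_image g \<subseteq> A \<union> B \<and> pathstart g = x \<and> pathfinish g = y"
    proof cases
      case 1 thus ?thesis using geoD(2)[OF A _ _ xy(3)] by blast
    next
      case 2 thus ?thesis using geoD(2)[OF B _ _ xy(3)] by blast
    next
      case 3 thus ?thesis using arc_exists_across[OF A B AB _ _ xy(3)] by blast
    next
      case 4 thus ?thesis using arc_exists_across[OF B A BA _ _ xy(3)] by blast
    qed
  next
    fix g assume g: "arc g" "path_image g \<subseteq> A \<union> B"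
    have g': "path_image g \<subseteq> B \<union> A" using g by auto
    have ends: "pathstart g \<in> A \<union> B" "pathfinish g \<in> A \<union> B"
      using g(2) pathstart_in_path_image pathfinish_in_path_image by blast+
    consider "pathstart g \<in> A" "pathfinish g \<in> A" | "pathstart g \<in> B" "pathfinish g \<in> B"
        "\<not> (pathstart g \<in> A \<and> pathfinish g \<in> A)"
      | "pathstart g \<in> A" "pathstart g \<notin> B" "pathfinish g \<in> B" "pathfinish g \<notin> A"
      | "pathstart g \<in> B" "pathstart g \<notin> A" "pathfinish g \<in> A" "pathfinish g \<notin> B" using ends by blast
    thus "curve_length g = ennreal (d (pathstart g) (pathfinish g))"
    proof cases
      case 1
      thus ?thesis using geoD(3)[OF A g(1) arc_stays[OF g cl AB]] by (simp add: d_def)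
    next
      case 2
      thus ?thesis using geoD(3)[OF B g(1) arc_stays[OF g(1) g' cl(2,1) BA]] by (auto simp: d_def)
    next
      case 3
      thus ?thesis using arc_across[OF A B AB g] by (simp add: d_def)
    next
      case 4
      thus ?thesis using arc_across[OF B A BA g(1) g'] by (simp add: d_def)
    qed
  next
    fix x y z assume "x \<in> A \<union> B" "y \<in> A \<union> B" "z \<in> A \<union> B"
    moreover note pp = geoD(4)[OF A p(1)] geoD(4)[OF B p(2)]
    note nn = geoD(5)[OF A] geoD(5)[OF B]
    note tA = geoD(6)[OF A] and tB = geoD(6)[OF B]
    have d: "d u v = dA u p + dB p v" if "u \<in> A" "v \<in> B" for u v
      using that both pp by (auto simp: d_def)
    have d': "d u v = dB u p + dA p v" if "u \<in> B" "v \<in> A" for u v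
      using that both pp by (auto simp: d_def)
    have dA: "d u v = dA u v" if "u \<in> A" "v \<in> A" for u v using that by (auto simp: d_def)
    have dB: "d u v = dB u v" if "u \<in> B" "v \<in> B" for u v
      using that both[of u] both[of v] pp by (cases "u \<in> A \<and> v \<in> A") (auto simp: d_def)
    ultimately consider "x \<in> A" "y \<in> A" "z \<in> A" | "x \<in> A" "y \<in> A" "z \<in> B" | "x \<in> A" "y \<in> B" "z \<in> A"
      | "x \<in> A" "y \<in> B" "z \<in> B" | "x \<in> B" "y \<in> A" "z \<in> A" | "x \<in> B" "y \<in> A" "z \<in> B"
      | "x \<in> B" "y \<in> B" "z \<in> A" | "x \<in> B" "y \<in> B" "z \<in> B" by blast
    thus "d x z \<le> d x y + d y z"
    proof cases
      case 1 thus ?thesis using tA by (simp add: dA)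
    next
      case 2 thus ?thesis using tA[of x y p] p by (simp add: dA d)
    next
      case 3 thus ?thesis using tA[of x p z] nn(2)[of p y] nn(2)[of y p] p by (simp add: dA d d')
    next
      case 4 thus ?thesis using tB[of p y z] p by (simp add: dB d)
    next
      case 5 thus ?thesis using tA[of p y z] p by (simp add: dA d')
    next
      case 6 thus ?thesis using tB[of x p z] nn(1)[of p y] nn(1)[of y p] p by (simp add: dB d d')
    next
      case 7 thus ?thesis using tB[of x y p] p by (simp add: dB d')
    next
      case 8 thus ?thesis using tB by (simp add: dB)
    qed
  qed (use cl geoD(4)[OF A] geoD(4)[OF B] geoD(5)[OF A] geoD(5)[OF B] p in \<open>auto simp: d_def\<close>)
  thus ?thesis by blast
qed

lemma arc_vpsi: "arc g \<Longrightarrow> arc (vpsi i \<circ> g)"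
  unfolding arc_def path_def
  by (blast intro: continuous_on_compose continuous_vpsi comp_inj_on inj_on_subset[OF inj_vpsi])

definition vpsi_inv :: "nat \<Rightarrow> real ^ 2 \<Rightarrow> real ^ 2" where
  "vpsi_inv i z = 3 *\<^sub>R (z - vq i) + vq i"

lemma vpsi_inv [simp]: "vpsi_inv i (vpsi i z) = z" "vpsi i (vpsi_inv i z) = z"
  by (simp_all add: vpsi_def vpsi_inv_def)

lemma geo_vpsi:
  assumes T: "geo T d"
  shows "geo (vpsi i ` T) (\<lambda>x y. d (vpsi_inv i x) (vpsi_inv i y) / 3)"
  unfolding geo_def
proof (intro conjI ballI impI allI)
  show "closed (vpsi i ` T)"
    using geoD(1)[OF T] closure_vpsi[of i T] by (metis closure_closed closed_closure)
next
  fix x y assume "x \<in> vpsi i ` T" "y \<in> vpsi i ` T" "x \<noteq> y"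
  then obtain u v where uv: "u \<in> T" "v \<in> T" "x = vpsi i u" "y = vpsi i v" "u \<noteq> v" by auto
  obtain g where g: "arc g" "path_image g \<subseteq> T" "pathstart g = u" "pathfinish g = v"
    using geoD(2)[OF T uv(1,2,5)] by blast
  show "\<exists>g. arc g \<and> path_image g \<subseteq> vpsi i ` T \<and> pathstart g = x \<and> pathfinish g = y"
    using g uv by (intro exI[of _ "vpsi i \<circ> g"])
      (auto simp: arc_vpsi path_image_compose pathstart_compose pathfinish_compose)
next
  fix g assume g: "arc g" "path_image g \<subseteq> vpsi i ` T"
  define h where "h = vpsi_inv i \<circ> g"
  have gh: "g = vpsi i \<circ> h" by (auto simp: h_def)
  have "inj (vpsi_inv i)" by (metis injI vpsi_inv(2))
  moreover have "continuous_on A (vpsi_inv i)" for A unfolding vpsi_inv_def by (intro continuous_intros)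
  ultimately have "arc h" using g(1) unfolding arc_def path_def h_def
    by (blast intro: continuous_on_compose comp_inj_on inj_on_subset)
  moreover have "path_image h \<subseteq> T"
    using g(2) by (auto simp: h_def path_image_def)
  ultimately have "curve_length h = ennreal (d (pathstart h) (pathfinish h))" "0 \<le> d (pathstart h) (pathfinish h)"
    using geoD(3,5)[OF T] pathstart_in_path_image pathfinish_in_path_image by blast+
  thus "curve_length g = ennreal (d (vpsi_inv i (pathstart g)) (vpsi_inv i (pathfinish g)) / 3)"
    unfolding gh curve_length_vpsi
    by (simp add: pathstart_compose pathfinish_compose flip: ennreal_mult)
qed (auto simp: geoD[OF T] intro!: order_trans[OF divide_right_mono[OF geoD(6)[OF T]] eq_refl[OF add_divide_distrib]])


section \<open>The trees are geodesic\<close>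

lemma geo_point: "geo {a} (\<lambda>_ _. 0)"
proof -
  have "\<not> (arc g \<and> path_image g \<subseteq> {a})" for g
  proof
    assume "arc g \<and> path_image g \<subseteq> {a}"
    hence g: "inj_on g {0..1}" "g ` {0..1} \<subseteq> {a}" by (auto simp: arc_def path_image_def)
    have "g 0 \<in> {a}" "g 1 \<in> {a}" using g(2) by (meson atLeastAtMost_iff image_subset_iff order_refl zero_le_one)+
    hence "g 0 = g 1" by simp
    thus False using inj_onD[OF g(1), of 0 1] by simp
  qed
  thus ?thesis unfolding geo_def by auto
qed

text \<open>The pieces are attached to the core \<open>C\<close> one after another. Since distinct
  pieces meet only inside \<open>C\<close>, a new piece meets everything built so far in its own
  attaching point alone.\<close>

lemma geo_star:
  assumes C: "geo C d" and "finite I" and T: "\<And>i. i \<in> I \<Longrightarrow> geo (T i) (e i)"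
    and p: "\<And>i. i \<in> I \<Longrightarrow> C \<inter> T i = {p i}"
    and dis: "\<And>i j. i \<in> I \<Longrightarrow> j \<in> I \<Longrightarrow> i \<noteq> j \<Longrightarrow> T i \<inter> T j \<subseteq> C"
  shows "\<exists>d. geo (C \<union> (\<Union>i\<in>I. T i)) d"
  using \<open>finite I\<close> T p dis
proof (induction I)
  case empty
  thus ?case using C by auto
next
  case (insert i I)
  obtain d' where d': "geo (C \<union> (\<Union>i\<in>I. T i)) d'" using insert.IH insert.prems by blast
  have "T i \<inter> T j \<subseteq> C" if "j \<in> I" for j using insert.prems(3)[of i j] insert.hyps(2) that by blast
  hence "(C \<union> (\<Union>i\<in>I. T i)) \<inter> T i = C \<inter> T i" by blast
  hence "(C \<union> (\<Union>i\<in>I. T i)) \<inter> T i = {p i}" using insert.prems(2)[of i] by simp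
  from geo_glue[OF d' insert.prems(1)[of i] this]
  show ?case by (simp add: Un_ac)
qed

lemma vqx_odd: "i \<in> {1..4} \<Longrightarrow> \<bar>vqx i\<bar> = 1 \<and> \<bar>vqy i\<bar> = 1"
proof -
  assume "i \<in> {1..4}"
  hence "i = 1 \<or> i = 2 \<or> i = 3 \<or> i = 4" by auto
  thus ?thesis by (auto simp: vqx_def vqy_def)
qed

text \<open>The central cell has integer coordinates (0, 0), so the corner delivered by
  \<open>cells_close\<close> has the digits of \<open>i\<close> and must be corner
  \<open>i\<close>.\<close>

lemma center_inter_arm:
  assumes "i \<in> {1..4}"
  shows "vpsi 5 ` vtree n \<inter> vpsi i ` vtree n = {vpsi 5 (vq i)}"
proof (intro equalityI subsetI)
  fix z assume "z \<in> vpsi 5 ` vtree n \<inter> vpsi i ` vtree n"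
  then obtain x y where xy: "x \<in> vtree n" "y \<in> vtree n" "z = vpsi 5 x" "z = vpsi i y" by auto
  have eq: "vpsi_word [5] x = vpsi_word [i] y" using xy by simp
  have u: "[5] \<in> vwords 1" "[i] \<in> vwords 1" using assms by (auto simp: vwords_def)
  obtain k where k: "k \<in> {1..4}" "wx [i] - wx [5] = vqx k" "wy [i] - wy [5] = vqy k"
     "vpsi_word [5] x = vpsi_word [i] y \<Longrightarrow> x = vq k"
    using cells_close[OF u, of x y] xy vtree_vsquare eq assms by auto
  have "k = i" using k assms by (intro vq_index_inj) (auto simp: vqx_def[of 5] vqy_def[of 5])
  thus "z \<in> {vpsi 5 (vq i)}" using k(4)[OF eq] xy by simp
next
  fix z assume "z \<in> {vpsi 5 (vq i)}"
  then show "z \<in> vpsi 5 ` vtree n \<inter> vpsi i ` vtree n"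
  proof -
    have "vq i \<in> vtree n" "vq (vopp i) \<in> vtree n"
      using vtree_0_mem(2)[of i n] vtree_0_mem(2)[of "vopp i" n] vopp_mem[OF assms] assms by auto
    hence "vpsi 5 (vq i) \<in> vpsi 5 ` vtree n" "vpsi i (vq (vopp i)) \<in> vpsi i ` vtree n" by blast+
    thus ?thesis using \<open>z \<in> _\<close> vpsi_vopp[of i] by simp
  qed
qed

text \<open>The digits of an arm are odd, so the coordinates of two arms differ by even numbers,
  whereas touching cells differ by exactly 1.\<close>

lemma arms_disjoint:
  assumes "i \<in> {1..4}" "j \<in> {1..4}" "i \<noteq> j"
  shows "vpsi i ` vtree n \<inter> vpsi j ` vtree n = {}"
proof (rule ccontr)
  assume "vpsi i ` vtree n \<inter> vpsi j ` vtree n \<noteq> {}"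
  then obtain x y where xy: "x \<in> vtree n" "y \<in> vtree n" "vpsi i x = vpsi j y" by auto
  have u: "[i] \<in> vwords 1" "[j] \<in> vwords 1" "[i] \<noteq> [j]" using assms by (auto simp: vwords_def)
  have sq: "x \<in> vsquare" "y \<in> vsquare" using xy vtree_vsquare by blast+
  have d: "dist (vpsi_word [i] x) (vpsi_word [j] y) < sqrt 2 / 3 ^ 1" using xy by simp
  obtain k where k: "k \<in> {1..4}" "wx [j] - wx [i] = vqx k"
    using cells_close[OF u sq d] by blast
  thus False using vqx_odd[OF assms(1)] vqx_odd[OF assms(2)] vqx_odd[OF k(1)] by auto
qed

lemma segments_meet:
  assumes "i \<in> {1..4}" "j \<in> {1..4}" "i \<noteq> j"
  shows "closed_segment 0 (vq i) \<inter> closed_segment 0 (vq j) \<subseteq> {0}"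
proof clarify
  fix z assume "z \<in> closed_segment 0 (vq i)" "z \<in> closed_segment 0 (vq j)"
  then obtain s t where st: "0 \<le> s" "0 \<le> t" "z = s *\<^sub>R vq i" "z = t *\<^sub>R vq j"
    by (auto simp: closed_segment_def)
  have "norm (s *\<^sub>R vq i) = s" "norm (t *\<^sub>R vq j) = t"
    using st(1,2) norm_vq assms by simp_all
  hence "s = t" using st(3,4) by metis
  show "z = 0"
  proof (rule ccontr)
    assume "z \<noteq> 0"
    hence "vq i = vq j" using st \<open>s = t\<close> by auto
    hence "vq i $ 1 = vq j $ 1" "vq i $ 2 = vq j $ 2" by simp_all
    hence "vqx i = vqx j" "vqy i = vqy j" unfolding vq_nth by simp_all
    thus False using vq_index_inj[of i j] assms by auto
  qed
qed

lemma vq_nonzero: "i \<in> {1..4} \<Longrightarrow> 0 \<noteq> vq i"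
  using norm_vq[of i] by auto

lemma UN_5: "(\<Union>i\<in>{1..5}. F i) = F 5 \<union> (\<Union>i\<in>{1..4::nat}. F i)"
proof -
  have "{1..5::nat} = insert 5 {1..4}" by auto
  thus ?thesis by simp
qed

text \<open>Level 0 is a star of four segments around the origin; the next level is a star of four
  arms around a central copy of the previous tree.\<close>

lemma geo_vtree_ex: "\<exists>d. geo (vtree n) d"
proof (induction n)
  case 0
  have "\<exists>d. geo ({0} \<union> (\<Union>i\<in>{1..4}. closed_segment 0 (vq i))) d"
    by (rule geo_star[OF geo_point, where e = "\<lambda>_. dist" and p = "\<lambda>_. 0"])
      (use geo_segment vq_nonzero segments_meet in auto)
  moreover have "0 \<in> (\<Union>i\<in>{1..4}. closed_segment 0 (vq i))" by (rule UN_I[of 1]) auto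
  hence "{0} \<union> (\<Union>i\<in>{1..4}. closed_segment 0 (vq i)) = vtree 0" by (simp add: insert_absorb)
  ultimately show ?case by simp
next
  case (Suc n)
  then obtain d where d: "geo (vtree n) d" by blast
  have "\<exists>d. geo (vpsi 5 ` vtree n \<union> (\<Union>i\<in>{1..4}. vpsi i ` vtree n)) d"
    by (rule geo_star[OF geo_vpsi[OF d] _ geo_vpsi[OF d] center_inter_arm])
      (use arms_disjoint in auto)
  thus ?case unfolding vtree.simps UN_5 .
qed

lemma vtree_dist_eq:
  assumes "geo (vtree n) d" "x \<in> vtree n" "y \<in> vtree n"
  shows "vtree_dist n x y = d x y"
proof (cases "x = y")
  case True
  thus ?thesis using geoD(4)[OF assms(1)] assms by (simp add: vtree_dist_def)
next
  case False
  have "(THE l. \<exists>g. arc g \<and> path_image g \<subseteq> vtree n \<and> pathstart g = x \<and> pathfinish g = y \<and>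
                 l = enn2real (curve_length g)) = d x y"
  proof (rule the_equality)
    show "\<exists>g. arc g \<and> path_image g \<subseteq> vtree n \<and> pathstart g = x \<and> pathfinish g = y \<and>
                 d x y = enn2real (curve_length g)"
      using geoD(2)[OF assms False] geoD(3)[OF assms(1)] geoD(5)[OF assms] by (metis enn2real_ennreal)
  qed (use geoD(3)[OF assms(1)] geoD(5)[OF assms] enn2real_ennreal in metis)
  thus ?thesis using False by (simp add: vtree_dist_def)
qed

lemma geo_vtree: "geo (vtree n) (vtree_dist n)"
proof -
  obtain d where d: "geo (vtree n) d" using geo_vtree_ex by blast
  have *: "vtree_dist n x y = d x y" if "x \<in> vtree n" "y \<in> vtree n" for x y
    using vtree_dist_eq[OF d that] .
  show ?thesis unfolding geo_def
  proof (intro conjI allI impI)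
    fix g assume g: "arc g" "path_image g \<subseteq> vtree n"
    thus "curve_length g = ennreal (vtree_dist n (pathstart g) (pathfinish g))"
      using geoD(3)[OF d g] * pathstart_in_path_image pathfinish_in_path_image by (metis subsetD)
  qed (use geoD[OF d] in \<open>simp_all add: *\<close>)
qed

section \<open>Tree distances across levels and against the Euclidean distance\<close>

lemma vtree_dist_mono:
  assumes "m \<le> n" "x \<in> vtree m" "y \<in> vtree m"
  shows "vtree_dist n x y = vtree_dist m x y"
  by (rule geo_subset_eq[OF geo_vtree geo_vtree vtree_mono]) (use assms in auto)

lemma vtree_dist_vpsi:
  assumes "x \<in> vtree n" "y \<in> vtree n" "i \<in> {1..5}"
  shows "vtree_dist (Suc n) (vpsi i x) (vpsi i y) = vtree_dist n x y / 3"
proof -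
  have "vpsi i ` vtree n \<subseteq> vtree (Suc n)" using assms by auto
  from geo_subset_eq[OF geo_vpsi[OF geo_vtree] geo_vtree this, of "vpsi i x" "vpsi i y"]
  show ?thesis using assms by simp
qed

lemma vtree_dist_word:
  assumes "x \<in> vtree n" "y \<in> vtree n" "w \<in> vwords m"
  shows "vtree_dist (m + n) (vpsi_word w x) (vpsi_word w y) = vtree_dist n x y / 3 ^ m"
  using assms(3)
proof (induction m arbitrary: w)
  case (Suc m)
  then obtain i v where w: "w = i # v" "i \<in> {1..5}" "v \<in> vwords m" by (auto simp: vwords_Suc)
  have "vpsi_word v x \<in> vtree (m + n)" "vpsi_word v y \<in> vtree (m + n)"
    using assms w(3) unfolding vtree_words by auto
  thus ?case using Suc.IH[OF w(3)] w by (simp add: vtree_dist_vpsi)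
qed simp

lemma vtree_dist_triangle:
  "x \<in> vtree n \<Longrightarrow> y \<in> vtree n \<Longrightarrow> z \<in> vtree n \<Longrightarrow> vtree_dist n x z \<le> vtree_dist n x y + vtree_dist n y z"
  by (rule geoD(6)[OF geo_vtree])

text \<open>A point in an arm is reached through the inner corner of the arm: at most 1/3 across the
  central copy, and at most 2/3 inside the arm by the triangle inequality through its
  centre.\<close>

lemma vtree_dist_center: "x \<in> vtree n \<Longrightarrow> vtree_dist n 0 x \<le> 1 \<and> vtree_dist n x 0 \<le> 1"
proof (induction n arbitrary: x)
  case 0
  then obtain i where i: "i \<in> {1..4}" "x \<in> closed_segment 0 (vq i)" by auto
  have sub: "closed_segment 0 (vq i) \<subseteq> vtree 0" using i by auto
  have "vtree_dist 0 0 x = dist 0 x" "vtree_dist 0 x 0 = dist x 0"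
    using geo_subset_eq[OF geo_segment[OF vq_nonzero[OF i(1)]] geo_vtree sub] i(2) by simp_all
  moreover have "norm x \<le> 1" using vtree_norm[of 0] "0.prems" by auto
  ultimately show ?case by simp
next
  case (Suc n)
  then obtain i z where i: "i \<in> {1..5}" "z \<in> vtree n" "x = vpsi i z" by auto
  note z = Suc.IH[OF i(2)]
  have m: "0 \<in> vtree n" by (rule vtree_0_mem)
  have 0: "vpsi 5 0 = 0" by (simp add: vpsi_def)
  show ?case
  proof (cases "i = 5")
    case True
    thus ?thesis using vtree_dist_vpsi[OF m i(2), of 5] vtree_dist_vpsi[OF i(2) m, of 5] z i 0 by simp
  next
    case False
    hence i4: "i \<in> {1..4}" using i by auto
    define a b where "a = vq i" and "b = vq (vopp i)"
    have a: "a \<in> vtree n" "b \<in> vtree n" using vtree_0_mem(2)[of _ n] i4 vopp_mem[OF i4] by (auto simp: a_def b_def)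
    have ab: "vpsi i b = vpsi 5 a" by (simp add: a_def b_def vpsi_vopp)
    have in': "vpsi j y \<in> vtree (Suc n)" if "j \<in> {1..5}" "y \<in> vtree n" for j y using that by auto
    have "vtree_dist n b z \<le> 2" "vtree_dist n z b \<le> 2"
      using vtree_dist_triangle[OF a(2) m i(2)] vtree_dist_triangle[OF i(2) m a(2)] z Suc.IH[OF a(2)] by auto
    hence 1: "vtree_dist (Suc n) (vpsi i b) x \<le> 2/3" "vtree_dist (Suc n) x (vpsi i b) \<le> 2/3"
      using vtree_dist_vpsi[OF a(2) i(2,1)] vtree_dist_vpsi[OF i(2) a(2) i(1)] i by auto
    have 2: "vtree_dist (Suc n) 0 (vpsi i b) \<le> 1/3" "vtree_dist (Suc n) (vpsi i b) 0 \<le> 1/3"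
      using vtree_dist_vpsi[OF a(1) m, of 5] vtree_dist_vpsi[OF m a(1), of 5] Suc.IH[OF a(1)] ab 0 by auto
    have mem: "0 \<in> vtree (Suc n)" "vpsi i b \<in> vtree (Suc n)" "x \<in> vtree (Suc n)"
      using vtree_0_mem(1)[of "Suc n"] in'[OF i(1) a(2)] Suc.prems by simp_all
    show ?thesis using 1 2 vtree_dist_triangle[OF mem(1,2,3)] vtree_dist_triangle[OF mem(3,2,1)] by linarith
  qed
qed

lemma vtree_dist_le_2: "x \<in> vtree n \<Longrightarrow> y \<in> vtree n \<Longrightarrow> vtree_dist n x y \<le> 2"
  using vtree_dist_center[of x n] vtree_dist_center[of y n] vtree_dist_triangle[of x n 0 y] vtree_0_mem(1)[of n] by simp

lemma triadic_scale:
  fixes d :: real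
  assumes "0 < d" "d \<le> 1"
  obtains m where "1 / 3 ^ Suc m < d" "d \<le> 1 / 3 ^ m"
proof -
  define m where "m = (LEAST m. 1 / 3 ^ Suc m < d)"
  obtain k where "(1/3) ^ k < d" using real_arch_pow_inv[of d "1/3"] assms by auto
  moreover have "(1/3::real) ^ Suc k \<le> (1/3) ^ k" by simp
  ultimately have "1 / 3 ^ Suc k < d" unfolding power_one_over by linarith
  hence 1: "1 / 3 ^ Suc m < d" unfolding m_def by (rule LeastI)
  have "d \<le> 1 / 3 ^ m"
  proof (cases m)
    case 0
    thus ?thesis using assms by simp
  next
    case (Suc j)
    hence "\<not> 1 / 3 ^ Suc j < d" unfolding m_def by (intro not_less_Least) simp
    thus ?thesis using Suc by simp
  qed
  with 1 show ?thesis using that by blast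
qed

text \<open>At the level \<open>m\<close> with
  \<open>1 / 3 ^ Suc m < dist x y \<le> 1 / 3 ^ m\<close>, the points lie in the same cell or in
  cells with a common corner. Each cell costs at most \<open>2 / 3 ^ m\<close>, in total
  \<open>4 / 3 ^ m\<close>, which is 12 times \<open>1 / 3 ^ Suc m\<close>.\<close>

lemma vtree_dist_le:
  assumes "x \<in> vtree n" "y \<in> vtree n"
  shows "vtree_dist n x y \<le> 12 * dist x y"
proof -
  consider "x = y" | "dist x y > 1" | "x \<noteq> y" "dist x y \<le> 1" by linarith
  thus ?thesis
  proof cases
    case 1
    thus ?thesis by (simp add: vtree_dist_def)
  next
    case 2
    thus ?thesis using vtree_dist_le_2[OF assms] by linarith
  next
    case 3
    obtain m where m: "1 / 3 ^ Suc m < dist x y" "dist x y \<le> 1 / 3 ^ m"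
      using triadic_scale[of "dist x y"] 3 by auto
    \<comment> \<open>The level is raised to \<open>m + n\<close> so that both points are addressed
      by words of length \<open>m\<close>; \<open>vtree_dist_mono\<close> brings the bound back to
      level \<open>n\<close>.\<close>
    have "vtree_dist (m + n) x y \<le> 4 / 3 ^ m"
    proof -
      have "x \<in> vtree (m + n)" "y \<in> vtree (m + n)" using vtree_mono[of n "m + n"] assms by auto
      then obtain u v x' y' where u: "u \<in> vwords m" "x' \<in> vtree n" "x = vpsi_word u x'"
         and v: "v \<in> vwords m" "y' \<in> vtree n" "y = vpsi_word v y'" unfolding vtree_words by blast
      have step: "vtree_dist (m + n) (vpsi_word w a) (vpsi_word w b) \<le> 2 / 3 ^ m"
        if "w \<in> vwords m" "a \<in> vtree n" "b \<in> vtree n" for w a b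
        unfolding vtree_dist_word[OF that(2,3,1)] using vtree_dist_le_2[OF that(2,3)] by (simp add: divide_right_mono)
      show ?thesis
      proof (cases "u = v")
        case True
        thus ?thesis using step[OF u(1,2) v(2)] u v order_trans[of _ "2 / 3 ^ m" "4 / (3::real) ^ m"]
          by (simp add: divide_right_mono)
      next
        case False
        have "1 < sqrt 2" by simp
        hence "1 / 3 ^ m < sqrt 2 / 3 ^ m" by (simp add: divide_strict_right_mono)
        hence "dist (vpsi_word u x') (vpsi_word v y') < sqrt 2 / 3 ^ m" using m(2) u v by simp
        then obtain i where i: "i \<in> {1..4}" "vpsi_word u (vq i) = vpsi_word v (vq (vopp i))"
          using cells_close[OF u(1) v(1) False, of x' y'] u v vtree_vsquare by blast
        have c: "vq i \<in> vtree n" "vq (vopp i) \<in> vtree n"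
          using vtree_0_mem(2)[of _ n] i(1) vopp_mem[OF i(1)] by auto
        have "vtree_dist (m + n) x y \<le> vtree_dist (m + n) x (vpsi_word u (vq i)) + vtree_dist (m + n) (vpsi_word u (vq i)) y"
          by (rule vtree_dist_triangle) (use u v c in \<open>auto simp: vtree_words\<close>)
        also have "\<dots> \<le> 2 / 3 ^ m + 2 / 3 ^ m"
          using step[OF u(1,2) c(1)] step[OF v(1) c(2) v(2)] u v i(2) by (intro add_mono) auto
        finally show ?thesis by simp
      qed
    qed
    also have "\<dots> = 12 * (1 / 3 ^ Suc m)" by simp
    also have "\<dots> \<le> 12 * dist x y" using m(1) by linarith
    finally show ?thesis using vtree_dist_mono[of n "m + n" x y] assms by simp
  qed
qed

section \<open>The geodesic distance on the Vicsek set\<close>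

text \<open>The predicate under the description operator in \<open>vdist\<close>, named so that
  existence and uniqueness can be stated.\<close>

definition is_vdist :: "((real ^ 2) \<times> (real ^ 2) \<Rightarrow> real) \<Rightarrow> bool" where
  "is_vdist D \<longleftrightarrow> D \<in> extensional (vicsek \<times> vicsek) \<and> continuous_on (vicsek \<times> vicsek) D \<and>
             (\<forall>n. \<forall>u\<in>vtree n. \<forall>v\<in>vtree n. D (u, v) = vtree_dist n u v)"

lemma vicsek_times_closure: "vicsek \<times> vicsek = closure ((\<Union>n. vtree n) \<times> (\<Union>n. vtree n))"
  by (simp add: closure_Times vicsek_eq_closure)

lemma vtree_common:
  assumes "u \<in> (\<Union>n. vtree n)" "v \<in> (\<Union>n. vtree n)"
  obtains n where "u \<in> vtree n" "v \<in> vtree n"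
proof -
  obtain k l where "u \<in> vtree k" "v \<in> vtree l" using assms by auto
  hence "u \<in> vtree (max k l)" "v \<in> vtree (max k l)"
    using vtree_mono[of k "max k l"] vtree_mono[of l "max k l"] by auto
  thus ?thesis using that by blast
qed

lemma is_vdist_unique:
  assumes "is_vdist D" "is_vdist E"
  shows "D = E"
proof (rule extensionalityI)
  show "D \<in> extensional (vicsek \<times> vicsek)" "E \<in> extensional (vicsek \<times> vicsek)"
    using assms by (auto simp: is_vdist_def)
  fix z assume z: "z \<in> vicsek \<times> vicsek"
  have "D z - E z = 0"
  proof (rule continuous_constant_on_closure[where f = "\<lambda>z. D z - E z"])
    show "continuous_on (closure ((\<Union>n. vtree n) \<times> (\<Union>n. vtree n))) (\<lambda>z. D z - E z)"
      unfolding vicsek_times_closure[symmetric]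
      using assms by (intro continuous_intros) (auto simp: is_vdist_def)
    show "z \<in> closure ((\<Union>n. vtree n) \<times> (\<Union>n. vtree n))" using z vicsek_times_closure by simp
    fix w assume "w \<in> (\<Union>n. vtree n) \<times> (\<Union>n. vtree n)"
    then obtain u v where w: "w = (u, v)" "u \<in> (\<Union>n. vtree n)" "v \<in> (\<Union>n. vtree n)" by blast
    obtain n where "u \<in> vtree n" "v \<in> vtree n" using vtree_common w by blast
    thus "D w - E w = 0" using assms w(1) by (simp add: is_vdist_def)
  qed
  thus "D z = E z" by simp
qed

text \<open>Comparability with the Euclidean distance makes the tree distances Lipschitz on pairs of
  tree points, hence uniformly continuous, hence extendable to the closure.\<close>

lemma is_vdist_exists: "\<exists>D. is_vdist D"
proof -
  define U where "U = (\<Union>n. vtree n)"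
  \<comment> \<open>The least common level is an arbitrary choice: by consistency of the tree
    distances every common level gives the same value.\<close>
  define D0 where "D0 = (\<lambda>(u, v). vtree_dist (LEAST n. u \<in> vtree n \<and> v \<in> vtree n) u v)"
  have D0: "D0 (u, v) = vtree_dist n u v" if "u \<in> vtree n" "v \<in> vtree n" for n u v
  proof -
    let ?k = "LEAST n. u \<in> vtree n \<and> v \<in> vtree n"
    have "u \<in> vtree ?k \<and> v \<in> vtree ?k"
      using that by (rule_tac LeastI[where P = "\<lambda>n. u \<in> vtree n \<and> v \<in> vtree n" and k = n]) simp
    moreover have "?k \<le> n" using that by (rule_tac Least_le) simp
    ultimately show ?thesis using vtree_dist_mono[of ?k n u v] by (simp add: D0_def)
  qed
  \<comment> \<open>24 = 12 + 12: each component moves by at most the distance in the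
    product.\<close>
  have est: "D0 (u, v) - D0 (u', v') \<le> 24 * dist (u, v) (u', v')"
    if uv: "u \<in> U" "v \<in> U" "u' \<in> U" "v' \<in> U" for u v u' v'
  proof -
    obtain k where k: "u \<in> vtree k" "v \<in> vtree k" using vtree_common uv(1,2) unfolding U_def by blast
    obtain l where l: "u' \<in> vtree l" "v' \<in> vtree l" using vtree_common uv(3,4) unfolding U_def by blast
    define n where "n = max k l"
    have n: "u \<in> vtree n" "v \<in> vtree n" "u' \<in> vtree n" "v' \<in> vtree n"
      using k l vtree_mono[of k n] vtree_mono[of l n] by (auto simp: n_def)
    have "vtree_dist n u v \<le> vtree_dist n u u' + (vtree_dist n u' v' + vtree_dist n v' v)"
      using vtree_dist_triangle[OF n(1,3,2)] vtree_dist_triangle[OF n(3,4,2)] by linarith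
    hence "vtree_dist n u v - vtree_dist n u' v' \<le> 12 * dist u u' + 12 * dist v v'"
      using vtree_dist_le[OF n(1,3)] vtree_dist_le[OF n(4,2)] by (simp add: dist_commute)
    also have "\<dots> \<le> 24 * dist (u, v) (u', v')"
      using dist_fst_le[of "(u, v)" "(u', v')"] dist_snd_le[of "(u, v)" "(u', v')"] by simp
    finally show ?thesis using D0 n by simp
  qed
  have "24-lipschitz_on (U \<times> U) D0"
  proof (rule lipschitz_onI)
    fix z w assume "z \<in> U \<times> U" "w \<in> U \<times> U"
    thus "dist (D0 z) (D0 w) \<le> 24 * dist z w"
      using est[of "fst z" "snd z" "fst w" "snd w"] est[of "fst w" "snd w" "fst z" "snd z"]
      by (auto simp: dist_real_def dist_commute)
  qed simp
  hence "uniformly_continuous_on (U \<times> U) D0" by (rule lipschitz_on_uniformly_continuous)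
  then obtain g where g: "uniformly_continuous_on (closure (U \<times> U)) g"
     "\<And>x. x \<in> U \<times> U \<Longrightarrow> D0 x = g x"
    using uniformly_continuous_on_extension_on_closure by metis
  have clo: "closure (U \<times> U) = vicsek \<times> vicsek" unfolding U_def by (simp add: vicsek_times_closure)
  have "is_vdist (restrict g (vicsek \<times> vicsek))"
    unfolding is_vdist_def
  proof (intro conjI allI ballI)
    show "continuous_on (vicsek \<times> vicsek) (restrict g (vicsek \<times> vicsek))"
      using uniformly_continuous_imp_continuous[OF g(1)] unfolding clo
      by (simp cong: continuous_on_cong)
    fix n u v assume uv: "u \<in> vtree n" "v \<in> vtree n"
    hence "(u, v) \<in> U \<times> U" "(u, v) \<in> vicsek \<times> vicsek" using vtree_subset_vicsek by (auto simp: U_def)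
    thus "restrict g (vicsek \<times> vicsek) (u, v) = vtree_dist n u v" using g(2)[of "(u, v)"] D0[OF uv] by simp
  qed simp
  thus ?thesis by blast
qed

lemma is_vdist_vdist:
  obtains D where "is_vdist D" "\<And>x y. vdist x y = D (x, y)"
proof -
  obtain D where D: "is_vdist D" using is_vdist_exists by blast
  have "(THE D. is_vdist D) = D" using D is_vdist_unique by (intro the_equality) auto
  hence "vdist x y = D (x, y)" for x y unfolding vdist_def is_vdist_def by simp
  with D show ?thesis using that by blast
qed

lemma continuous_vdist: "continuous_on (vicsek \<times> vicsek) (\<lambda>z. vdist (fst z) (snd z))"
proof -
  obtain D where "is_vdist D" "\<And>x y. vdist x y = D (x, y)" using is_vdist_vdist by blast
  thus ?thesis by (simp add: is_vdist_def)
qed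

lemma vdist_bounds:
  assumes "x \<in> vicsek" "y \<in> vicsek"
  shows "dist x y \<le> vdist x y" "vdist x y \<le> 12 * dist x y"
proof -
  obtain D where D: "is_vdist D" "\<And>x y. vdist x y = D (x, y)" using is_vdist_vdist by blast
  let ?U = "(\<Union>n. vtree n) \<times> (\<Union>n. vtree n)"
  have c: "continuous_on (closure ?U) D"
    using D(1) unfolding is_vdist_def vicsek_times_closure by blast
  have z: "(x, y) \<in> closure ?U" using assms unfolding vicsek_times_closure[symmetric] by simp
  have U: "dist (fst w) (snd w) \<le> D w \<and> D w \<le> 12 * dist (fst w) (snd w)" if w: "w \<in> ?U" for w
  proof -
    obtain u v where uv: "w = (u, v)" "u \<in> (\<Union>n. vtree n)" "v \<in> (\<Union>n. vtree n)" using w by blast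
    obtain n where n: "u \<in> vtree n" "v \<in> vtree n" using vtree_common[OF uv(2,3)] .
    thus ?thesis using uv(1) D(1) geo_ge_dist[OF geo_vtree n] vtree_dist_le[OF n] by (simp add: is_vdist_def)
  qed
  have "(\<lambda>z. dist (fst z) (snd z) - D z) (x, y) \<le> 0"
    by (rule continuous_le_on_closure[OF _ z]) (intro continuous_intros c, simp add: U)
  thus "dist x y \<le> vdist x y" using D(2) by simp
  have "(\<lambda>z. D z - 12 * dist (fst z) (snd z)) (x, y) \<le> 0"
    by (rule continuous_le_on_closure[OF _ z]) (intro continuous_intros c, simp add: U)
  thus "vdist x y \<le> 12 * dist x y" using D(2) by simp
qed

lemma closed_vdist_le: "closed {z \<in> vicsek \<times> vicsek. vdist (fst z) (snd z) \<le> r}"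
proof -
  let ?A = "(vicsek \<times> vicsek) \<inter> (\<lambda>z. vdist (fst z) (snd z)) -` {..r}"
  have "closedin (top_of_set (vicsek \<times> vicsek)) ?A"
    by (rule continuous_closedin_preimage[OF continuous_vdist closed_atMost])
  hence "closed ?A" using closed_Times[OF closed_vicsek closed_vicsek] closedin_closed_trans by blast
  moreover have "?A = {z \<in> vicsek \<times> vicsek. vdist (fst z) (snd z) \<le> r}" by auto
  ultimately show ?thesis by simp
qed


section \<open>The self-similar measure\<close>

text \<open>Every index outside \<open>1..4\<close> acts as the central map, so \<open>vcode\<close> takes values in the
  Vicsek set on all streams, not only on those over \<open>1..5\<close>.\<close>

definition vcode :: "nat stream \<Rightarrow> real ^ 2" where
  "vcode \<omega> = (\<Sum>k. (2 / 3 ^ Suc k) *\<^sub>R vq (\<omega> !! k))"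

lemma summable_vcode: "summable (\<lambda>k. (2 / 3 ^ Suc k) *\<^sub>R vq (\<omega> !! k))"
proof (rule summable_comparison_test)
  show "\<exists>N. \<forall>n\<ge>N. norm ((2 / 3 ^ Suc n) *\<^sub>R vq (\<omega> !! n)) \<le> 2 / 3 * (1 / 3) ^ n"
    using norm_vq_le by (auto simp: power_one_over divide_simps)
  show "summable (\<lambda>n. 2 / 3 * (1 / 3 :: real) ^ n)"
    by (intro summable_mult summable_geometric) simp
qed

lemma vcode_Stream: "vcode (i ## \<omega>) = vpsi i (vcode \<omega>)"
proof -
  have "vcode (i ## \<omega>) = (\<Sum>k. (2 / 3 ^ Suc (Suc k)) *\<^sub>R vq (\<omega> !! k)) + (2 / 3) *\<^sub>R vq i"
    using suminf_split_head[OF summable_vcode[of "i ## \<omega>"]] unfolding vcode_def by simp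
  also have "(\<Sum>k. (2 / 3 ^ Suc (Suc k)) *\<^sub>R vq (\<omega> !! k)) = (\<Sum>k. (1 / 3) *\<^sub>R ((2 / 3 ^ Suc k) *\<^sub>R vq (\<omega> !! k)))"
    by simp
  also have "\<dots> = (1 / 3) *\<^sub>R vcode \<omega>"
    unfolding vcode_def by (rule suminf_scaleR_right[OF summable_vcode, symmetric])
  finally show ?thesis by (simp add: vpsi_eq)
qed

lemma vpsi_in_vicsek: "z \<in> vicsek \<Longrightarrow> vpsi i z \<in> vicsek"
proof -
  assume z: "z \<in> vicsek"
  have "vpsi i z = vpsi (if i \<in> {1..5} then i else 5) z" by (auto simp: vpsi_def vq_def)
  also have "\<dots> \<in> (\<Union>i\<in>{1..5}. vpsi i ` vicsek)" using z by auto
  finally show ?thesis unfolding vicsek_fixed[symmetric] .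
qed

text \<open>The partial sums are the images of the origin under the maps of the finite prefixes, all
  in the set, which is closed.\<close>

lemma vcode_in_vicsek: "vcode \<omega> \<in> vicsek"
proof -
  have eq: "(\<Sum>k<n. (2 / 3 ^ Suc k) *\<^sub>R vq (\<omega> !! k)) = vpsi_word (stake n \<omega>) 0" for n \<omega>
  proof (induction n arbitrary: \<omega>)
    case (Suc n)
    have "(\<Sum>k<Suc n. (2 / 3 ^ Suc k) *\<^sub>R vq (\<omega> !! k))
      = (2 / 3) *\<^sub>R vq (shd \<omega>) + (1 / 3) *\<^sub>R (\<Sum>k<n. (2 / 3 ^ Suc k) *\<^sub>R vq (stl \<omega> !! k))"
      by (simp add: sum.lessThan_Suc_shift scaleR_sum_right del: sum.lessThan_Suc)
    thus ?case unfolding Suc by (simp add: vpsi_eq)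
  qed simp
  have "vpsi_word w 0 \<in> vicsek" for w
    by (induction w) (auto simp: zero_in_vicsek vpsi_in_vicsek)
  moreover have "(\<lambda>n. vpsi_word (stake n \<omega>) 0) \<longlonglongrightarrow> vcode \<omega>"
    using summable_LIMSEQ[OF summable_vcode[of \<omega>]] unfolding eq vcode_def .
  ultimately show ?thesis
    using closed_sequentially[OF closed_vicsek, of "\<lambda>n. vpsi_word (stake n \<omega>) 0"] by simp
qed

lemma vcode_measurable [measurable]:
  "vcode \<in> borel_measurable (stream_space (measure_pmf (pmf_of_set {1..5})))" (is "_ \<in> borel_measurable ?S")
proof (rule borel_measurable_LIMSEQ_metric)
  fix \<omega> show "(\<lambda>n. \<Sum>k<n. (2 / 3 ^ Suc k) *\<^sub>R vq (\<omega> !! k)) \<longlonglongrightarrow> vcode \<omega>"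
    using summable_LIMSEQ[OF summable_vcode] unfolding vcode_def .
next
  fix n
  have "vq \<in> measurable (measure_pmf (pmf_of_set {1..5})) borel" by simp
  hence "(\<lambda>\<omega>. vq (\<omega> !! k)) \<in> borel_measurable ?S" for k
    by (rule measurable_compose[OF measurable_snth])
  thus "(\<lambda>\<omega>. \<Sum>k<n. (2 / 3 ^ Suc k) *\<^sub>R vq (\<omega> !! k)) \<in> borel_measurable ?S"
    by (intro borel_measurable_sum borel_measurable_scaleR) auto
qed

text \<open>The law of the point coded by independent, uniformly distributed letters. It lives on
  the whole plane, which keeps preimages measurable, and is restricted to the set
  afterwards.\<close>

definition vlaw :: "(real ^ 2) measure" where
  "vlaw = distr (stream_space (measure_pmf (pmf_of_set {1..5}))) borel vcode"

lemma sets_vlaw [simp, measurable_cong]: "sets vlaw = sets borel"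
  by (simp add: vlaw_def)

lemma prob_space_vlaw: "prob_space vlaw"
  unfolding vlaw_def
  by (intro prob_space.prob_space_distr prob_space.prob_space_stream_space measure_pmf.prob_space_axioms vcode_measurable)

lemma vlaw_vicsek: "A \<in> sets borel \<Longrightarrow> emeasure vlaw A = emeasure vlaw (A \<inter> vicsek)"
proof -
  assume [measurable]: "A \<in> sets borel"
  have [measurable]: "vicsek \<in> sets borel" by (rule borel_closed[OF closed_vicsek])
  have "vcode -` A = vcode -` (A \<inter> vicsek)" using vcode_in_vicsek by auto
  thus ?thesis unfolding vlaw_def by (simp add: emeasure_distr)
qed

lemma vpsi_measurable [measurable]: "vpsi i \<in> borel_measurable borel"
  by (intro borel_measurable_continuous_onI continuous_vpsi)

text \<open>Conditioning on the first letter, which is uniform on five values and independent of the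
  remaining stream.\<close>

lemma vlaw_self_similar:
  assumes [measurable]: "A \<in> sets borel"
  shows "emeasure vlaw A = (\<Sum>i\<in>{1..5}. emeasure vlaw (vpsi i -` A)) / 5"
proof -
  let ?P = "measure_pmf (pmf_of_set {1..5::nat})" and ?S = "stream_space (measure_pmf (pmf_of_set {1..5::nat}))"
  have sp: "space ?S = UNIV" by (simp add: space_stream_space)
  have pre: "vpsi i -` A \<in> sets borel" for i
    using measurable_sets[OF vpsi_measurable assms] by simp
  have "emeasure vlaw A = emeasure ?S (vcode -` A)"
    unfolding vlaw_def by (subst emeasure_distr) (simp_all only: sp Int_UNIV_right assms vcode_measurable)
  also have "\<dots> = (\<integral>\<^sup>+i. emeasure ?S {\<omega>\<in>space ?S. i ## \<omega> \<in> vcode -` A} \<partial>?P)"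
    using measurable_sets[OF vcode_measurable assms] unfolding sp Int_UNIV_right
    unfolding sp[symmetric] by (intro prob_space.emeasure_stream_space measure_pmf.prob_space_axioms)
  also have "\<dots> = (\<integral>\<^sup>+i. emeasure vlaw (vpsi i -` A) \<partial>?P)"
  proof (intro nn_integral_cong)
    fix i
    have "{\<omega>\<in>space ?S. i ## \<omega> \<in> vcode -` A} = vcode -` (vpsi i -` A) \<inter> space ?S"
      by (auto simp: vcode_Stream)
    thus "emeasure ?S {\<omega>\<in>space ?S. i ## \<omega> \<in> vcode -` A} = emeasure vlaw (vpsi i -` A)"
      unfolding vlaw_def using pre by (simp add: emeasure_distr)
  qed
  also have "\<dots> = (\<Sum>i\<in>{1..5}. emeasure vlaw (vpsi i -` A)) / 5"
    by (subst nn_integral_pmf_of_set) auto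
  finally show ?thesis .
qed

text \<open>Only the k-th cell contains the corner \<open>vq k\<close>, and its map fixes it. By
  self-similarity the mass of the corner is a fifth of itself, hence zero.\<close>

lemma vlaw_corner:
  assumes "k \<in> {1..4}"
  shows "emeasure vlaw {vq k} = 0"
proof -
  interpret prob_space vlaw by (rule prob_space_vlaw)
  have "emeasure vlaw (vpsi i -` {vq k}) = (if i = k then emeasure vlaw {vq k} else 0)" if i: "i \<in> {1..5}" for i
  proof (cases "i = k")
    case True
    have "vpsi k -` {vq k} = {vq k}" using inj_vpsi[of k] by (auto dest: injD[of _ _ "vq k"])
    thus ?thesis using True by simp
  next
    case False
    have "vpsi i -` {vq k} \<inter> vicsek = {}"
    proof (rule ccontr)
      assume "vpsi i -` {vq k} \<inter> vicsek \<noteq> {}"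
      then obtain y where y: "vpsi i y = vq k" "y \<in> vicsek" by auto
      have u: "[k] \<in> vwords 1" "[i] \<in> vwords 1" "[k] \<noteq> [i]" using assms i False by (auto simp: vwords_def)
      have sq: "vq k \<in> vsquare" "y \<in> vsquare" using vq_in_vicsek[of k] assms y vicsek_vsquare by auto
      have eq: "vpsi_word [k] (vq k) = vpsi_word [i] y" using y by simp
      have d: "dist (vpsi_word [k] (vq k)) (vpsi_word [i] y) < sqrt 2 / 3 ^ 1" unfolding eq by simp
      obtain j where j: "j \<in> {1..4}" "wx [i] - wx [k] = vqx j" "vq k = vq j"
        using cells_close[OF u sq d] eq by metis
      have "vq k $ 1 = vq j $ 1" using j by simp
      hence "vqx k = vqx j" unfolding vq_nth by simp
      \<comment> \<open>The two equations give \<open>vqx i = 2 * vqx k\<close>, impossible for a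
        digit \<open>vqx i\<close> when \<open>vqx k\<close> is 1 or -1.\<close>
      thus False using j(2) vqx_cases(1)[of i] vqx_odd[OF assms] by auto
    qed
    moreover have "vpsi i -` {vq k} \<in> sets borel"
      using measurable_sets[OF vpsi_measurable[of i], of "{vq k}"] by simp
    ultimately show ?thesis using vlaw_vicsek[of "vpsi i -` {vq k}"] False by simp
  qed
  hence "emeasure vlaw {vq k} = (\<Sum>i\<in>{1..5}. if i = k then emeasure vlaw {vq k} else 0) / 5"
    by (subst vlaw_self_similar) auto
  also have "\<dots> = emeasure vlaw {vq k} / 5" using assms by simp
  finally have "ennreal (prob {vq k}) = ennreal (prob {vq k}) / ennreal 5"
    by (simp add: emeasure_eq_measure)
  hence "prob {vq k} = prob {vq k} / 5" by (subst (asm) divide_ennreal) auto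
  thus ?thesis by (simp add: emeasure_eq_measure)
qed

text \<open>A stream with another first letter can reach the cell only at a corner, and corners are
  null; so exactly one of the five terms of the self-similarity survives.\<close>

lemma vlaw_cell: "set w \<subseteq> {1..5} \<Longrightarrow> emeasure vlaw (vpsi_word w ` vicsek) = ennreal (1 / 5 ^ length w)"
proof (induction w)
  case Nil
  interpret prob_space vlaw by (rule prob_space_vlaw)
  have "space vlaw = UNIV" by (simp add: vlaw_def)
  thus ?case using vlaw_vicsek[of UNIV] emeasure_space_1 by simp
next
  case (Cons i w)
  let ?C = "vpsi_word w ` vicsek"
  have cl: "closed (vpsi i ` ?C)"
    using compact_cell[of "i # w"] by (simp add: image_image compact_imp_closed)
  hence [measurable]: "vpsi i ` ?C \<in> sets borel" by (rule borel_closed)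
  have CK: "?C \<subseteq> vicsek" using cell_subset_vicsek[of w "length w"] Cons.prems by (simp add: vwords_def)
  have "emeasure vlaw (vpsi j -` (vpsi i ` ?C)) = (if j = i then emeasure vlaw ?C else 0)" if j: "j \<in> {1..5}" for j
  proof (cases "j = i")
    case True
    thus ?thesis by (simp add: inj_vimage_image_eq inj_vpsi)
  next
    case False
    have "vpsi j -` (vpsi i ` ?C) \<inter> vicsek \<subseteq> vq ` {1..4}"
    proof clarify
      fix y x assume y: "y \<in> vicsek" "x \<in> vicsek" "vpsi j y = vpsi i (vpsi_word w x)"
      define x' where "x' = vpsi_word w x"
      have u: "[j] \<in> vwords 1" "[i] \<in> vwords 1" "[j] \<noteq> [i]" using Cons.prems j False by (auto simp: vwords_def)
      have sq: "y \<in> vsquare" "x' \<in> vsquare" using y CK vicsek_vsquare by (auto simp: x'_def)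
      have eq: "vpsi_word [j] y = vpsi_word [i] x'" using y by (simp add: x'_def)
      hence d: "dist (vpsi_word [j] y) (vpsi_word [i] x') < sqrt 2 / 3 ^ 1" by simp
      show "y \<in> vq ` {1..4}" using cells_close[OF u sq d] eq by (metis imageI)
    qed
    moreover have "emeasure vlaw (vq ` {1..4}) = 0"
    proof -
      have "(\<Union>k\<in>{1..4}. {vq k}) \<in> null_sets vlaw"
        using vlaw_corner by (intro null_sets_UN') auto
      moreover have "(\<Union>k\<in>{1..4}. {vq k}) = vq ` {1..4}" by auto
      ultimately show ?thesis by auto
    qed
    ultimately have "emeasure vlaw (vpsi j -` (vpsi i ` ?C) \<inter> vicsek) \<le> 0"
      by (metis emeasure_mono sets_vlaw finite_imageI finite_atLeastAtMost finite_imp_closed borel_closed)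
    moreover have "vpsi j -` (vpsi i ` ?C) \<in> sets borel"
      using measurable_sets[OF vpsi_measurable[of j], of "vpsi i ` ?C"] by simp
    ultimately show ?thesis using False by (simp add: vlaw_vicsek)
  qed
  hence "emeasure vlaw (vpsi i ` ?C) = (\<Sum>j\<in>{1..5}. if j = i then emeasure vlaw ?C else 0) / 5"
    by (subst vlaw_self_similar) auto
  also have "\<dots> = emeasure vlaw ?C / ennreal 5" using Cons.prems by simp
  also have "\<dots> = ennreal (1 / 5 ^ length (i # w))"
    using Cons by (subst Cons.IH) (simp_all add: divide_ennreal del: ennreal_numeral)
  finally show ?case by (simp add: image_image)
qed

section \<open>Existence and uniqueness of the measure on cells\<close>

definition is_vmeasure :: "(real ^ 2) measure \<Rightarrow> bool" where
  "is_vmeasure M \<longleftrightarrow> sets M = sets (restrict_space borel vicsek) \<and>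
     emeasure M (space M) = 1 \<and>
     (\<forall>w. set w \<subseteq> {1..5} \<longrightarrow>
        emeasure M (vpsi_word w ` vicsek) = ennreal (1 / 5 ^ length w))"

lemma vicsek_borel [measurable]: "vicsek \<in> sets borel"
  by (rule borel_closed[OF closed_vicsek])

lemma is_vmeasure_exists: "is_vmeasure (restrict_space vlaw vicsek)"
proof -
  interpret prob_space vlaw by (rule prob_space_vlaw)
  have *: "emeasure vlaw vicsek = 1" using vlaw_cell[of "[]"] by simp
  have "emeasure (restrict_space vlaw vicsek) (vpsi_word w ` vicsek) = ennreal (1 / 5 ^ length w)"
    if "set w \<subseteq> {1..5}" for w
    using vlaw_cell[OF that] cell_subset_vicsek[of w "length w"] that
    by (subst emeasure_restrict_space) (auto simp: vwords_def)
  moreover have "emeasure (restrict_space vlaw vicsek) (space (restrict_space vlaw vicsek)) = 1"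
    using * by (subst emeasure_restrict_space) (auto simp: space_restrict_space vlaw_def)
  moreover have "sets (restrict_space vlaw vicsek) = sets (restrict_space borel vicsek)"
    by (intro sets_restrict_space_cong) simp
  ultimately show ?thesis unfolding is_vmeasure_def by simp
qed

text \<open>The position of a common point is determined by the difference of the integer
  coordinates of the two cells.\<close>

lemma cells_meet_in_point:
  assumes "u \<in> vwords n" "v \<in> vwords n" "u \<noteq> v"
    and z: "z \<in> vpsi_word u ` vicsek \<inter> vpsi_word v ` vicsek"
  shows "vpsi_word u ` vicsek \<inter> vpsi_word v ` vicsek = {z}"
proof -
  have key: "\<exists>i\<in>{1..4}. wx v - wx u = vqx i \<and> wy v - wy u = vqy i \<and> a = vpsi_word u (vq i)"
    if a: "a \<in> vpsi_word u ` vicsek \<inter> vpsi_word v ` vicsek" for a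
  proof -
    obtain x y where xy: "x \<in> vicsek" "y \<in> vicsek" "a = vpsi_word u x" "a = vpsi_word v y" using a by blast
    have sq: "x \<in> vsquare" "y \<in> vsquare" using xy vicsek_vsquare by auto
    have eq: "vpsi_word u x = vpsi_word v y" using xy by simp
    hence d: "dist (vpsi_word u x) (vpsi_word v y) < sqrt 2 / 3 ^ n" by simp
    show ?thesis using cells_close[OF assms(1-3) sq d] eq xy(3) by metis
  qed
  obtain i where i: "i \<in> {1..4}" "wx v - wx u = vqx i" "wy v - wy u = vqy i" "z = vpsi_word u (vq i)"
    using key[OF z] by blast
  have "a = z" if "a \<in> vpsi_word u ` vicsek \<inter> vpsi_word v ` vicsek" for a
  proof -
    obtain j where j: "j \<in> {1..4}" "wx v - wx u = vqx j" "wy v - wy u = vqy j" "a = vpsi_word u (vq j)"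
      using key[OF \<open>a \<in> _\<close>] by blast
    have "i = j" using i j by (intro vq_index_inj) auto
    thus ?thesis using i j by simp
  qed
  thus ?thesis using z by blast
qed

text \<open>Cells alone are not closed under intersection, since neighbours meet in a corner;
  adjoining singletons and the empty set repairs this.\<close>

definition cell_gen :: "(real ^ 2) set set" where
  "cell_gen = {vpsi_word w ` vicsek | w. set w \<subseteq> {1..5}} \<union> (\<lambda>z. {z}) ` vicsek \<union> {{}}"

lemma cell_subset: "set w \<subseteq> {1..5} \<Longrightarrow> vpsi_word w ` vicsek \<subseteq> vicsek"
  using cell_subset_vicsek[of w "length w"] by (simp add: vwords_def)

lemma cell_append_subset:
  "set v \<subseteq> {1..5} \<Longrightarrow> vpsi_word (u @ v) ` vicsek \<subseteq> vpsi_word u ` vicsek"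
  using cell_subset[of v] by (auto simp: vpsi_word_append)

lemma cells_Int_gen:
  assumes u: "set u \<subseteq> {1..5}" and v: "set v \<subseteq> {1..5}" and "length u \<le> length v"
  shows "vpsi_word u ` vicsek \<inter> vpsi_word v ` vicsek \<in> cell_gen"
proof -
  \<comment> \<open>The longer word is cut to the length of the shorter one, so that cells of equal
    level are compared.\<close>
  define v1 v2 where "v1 = take (length u) v" and "v2 = drop (length u) v"
  have v12: "v = v1 @ v2" "set v1 \<subseteq> {1..5}" "set v2 \<subseteq> {1..5}" "length v1 = length u"
    using assms by (auto simp: v1_def v2_def dest: in_set_takeD in_set_dropD)
  have sub: "vpsi_word v ` vicsek \<subseteq> vpsi_word v1 ` vicsek"
    unfolding v12(1) by (rule cell_append_subset[OF v12(3)])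
  show ?thesis
  proof (cases "u = v1")
    case True
    hence "vpsi_word u ` vicsek \<inter> vpsi_word v ` vicsek = vpsi_word v ` vicsek" using sub by auto
    thus ?thesis using v by (auto simp: cell_gen_def)
  next
    case False
    show ?thesis
    proof (cases "vpsi_word u ` vicsek \<inter> vpsi_word v ` vicsek = {}")
      case ne: False
      then obtain z where z: "z \<in> vpsi_word u ` vicsek \<inter> vpsi_word v ` vicsek" by blast
      have "vpsi_word u ` vicsek \<inter> vpsi_word v1 ` vicsek = {z}"

      proof (rule cells_meet_in_point)
        show "u \<in> vwords (length u)" "v1 \<in> vwords (length u)" using u v12 by (auto simp: vwords_def)
      qed (use False z sub in auto)
      hence "vpsi_word u ` vicsek \<inter> vpsi_word v ` vicsek = {z}" using z sub by blast
      moreover have "z \<in> vicsek" using z cell_subset[OF u] by blast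
      ultimately show ?thesis by (auto simp: cell_gen_def)
    qed (simp add: cell_gen_def)
  qed
qed

lemma Int_stable_cell_gen: "Int_stable cell_gen"
proof (rule Int_stableI)
  fix a b assume a: "a \<in> cell_gen" and b: "b \<in> cell_gen"
  consider "\<exists>u v. set u \<subseteq> {1..5} \<and> set v \<subseteq> {1..5} \<and> a = vpsi_word u ` vicsek \<and> b = vpsi_word v ` vicsek"
    | "a = {}" | "b = {}" | "\<exists>z\<in>vicsek. a = {z}" | "\<exists>z\<in>vicsek. b = {z}"
    using a b unfolding cell_gen_def by blast
  thus "a \<inter> b \<in> cell_gen"
  proof cases
    case 1
    then obtain u v where uv: "set u \<subseteq> {1..5}" "set v \<subseteq> {1..5}" "a = vpsi_word u ` vicsek" "b = vpsi_word v ` vicsek"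
      by blast
    show ?thesis
    proof (cases "length u \<le> length v")
      case True
      thus ?thesis using cells_Int_gen[OF uv(1,2)] uv by simp
    next
      case False
      thus ?thesis using cells_Int_gen[OF uv(2,1)] uv by (simp add: Int_commute)
    qed
  next
    case 4
    then obtain z where "z \<in> vicsek" "a = {z}" by blast
    thus ?thesis by (cases "z \<in> b") (auto simp: cell_gen_def)
  next
    case 5
    then obtain z where "z \<in> vicsek" "b = {z}" by blast
    thus ?thesis by (cases "z \<in> a") (auto simp: cell_gen_def)
  qed (simp_all add: cell_gen_def)
qed

lemma cell_ex:
  assumes "z \<in> vicsek"
  obtains w where "w \<in> vwords n" "z \<in> vpsi_word w ` vicsek"
  using assms vicsek_words[of n] by blast

lemma small_power: "0 < e \<Longrightarrow> \<exists>n. c / 3 ^ n < (e :: real)"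
proof -
  assume e: "0 < e"
  obtain n where "(1/3) ^ n < e / (\<bar>c\<bar> + 1)" using real_arch_pow_inv[of "e / (\<bar>c\<bar> + 1)" "1/3"] e by auto
  hence "(\<bar>c\<bar> + 1) / 3 ^ n < e" by (simp add: field_simps power_one_over)
  moreover have "c / 3 ^ n \<le> (\<bar>c\<bar> + 1) / 3 ^ n" by (intro divide_right_mono) auto
  ultimately show ?thesis by (intro exI[of _ n]) linarith
qed

text \<open>Cells shrink uniformly, so a relatively open set is the union of the cells it contains,
  a union over countably many words.\<close>

lemma sets_cell_gen: "sets (restrict_space borel vicsek) = sigma_sets vicsek cell_gen"
proof (rule antisym)
  have gen: "cell_gen \<subseteq> Pow vicsek" using cell_subset by (auto simp: cell_gen_def)
  have "vicsek \<inter> S \<in> sigma_sets vicsek cell_gen" if "open S" for S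
  proof -
    define W where "W = {w. set w \<subseteq> {1..5} \<and> vpsi_word w ` vicsek \<subseteq> S}"
    have "vicsek \<inter> S \<subseteq> (\<Union>w\<in>W. vpsi_word w ` vicsek)"
    proof
      fix z assume z: "z \<in> vicsek \<inter> S"
      then obtain e where e: "0 < e" "ball z e \<subseteq> S" using \<open>open S\<close> open_contains_ball by blast
      obtain n where n: "2 / 3 ^ n < e" using small_power[OF e(1)] by blast
      obtain w where w: "w \<in> vwords n" "z \<in> vpsi_word w ` vicsek" using cell_ex z by blast
      have "vpsi_word w ` vicsek \<subseteq> ball z e" using dist_cell[OF w] n by (force simp: mem_ball)
      thus "z \<in> (\<Union>w\<in>W. vpsi_word w ` vicsek)" using w e by (auto simp: W_def vwords_def)
    qed
    moreover have "(\<Union>w\<in>W. vpsi_word w ` vicsek) \<subseteq> vicsek \<inter> S" using cell_subset by (auto simp: W_def)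
    moreover have "(\<Union>w\<in>W. vpsi_word w ` vicsek) \<in> sigma_sets vicsek cell_gen"
      by (rule sigma_sets_UNION) (auto simp: W_def cell_gen_def intro!: sigma_sets.Basic)
    ultimately show ?thesis by (metis subset_antisym)
  qed
  hence "(\<inter>) vicsek ` {S. open S} \<subseteq> sigma_sets vicsek cell_gen" by auto
  hence "sigma_sets vicsek ((\<inter>) vicsek ` {S. open S}) \<subseteq> sigma_sets vicsek cell_gen"
    by (rule sigma_sets_mono)
  moreover have "sets (restrict_space borel vicsek) = sigma_sets vicsek ((\<inter>) vicsek ` {S. open S})"
    using sigma_sets_Int[of vicsek UNIV "{S. open S}"] vicsek_borel
    by (simp add: sets_restrict_space borel_def)
  ultimately show "sets (restrict_space borel vicsek) \<subseteq> sigma_sets vicsek cell_gen" by simp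
  have "cell_gen \<subseteq> sets (restrict_space borel vicsek)"
    using cell_subset compact_cell
    by (auto simp: cell_gen_def sets_restrict_space_iff intro!: borel_closed compact_imp_closed)
  thus "sigma_sets vicsek cell_gen \<subseteq> sets (restrict_space borel vicsek)"
    using sets.sigma_sets_subset[of cell_gen "restrict_space borel vicsek"] by (simp add: space_restrict_space)
qed

text \<open>The mass of singletons is not prescribed, yet they belong to the generator; it is
  squeezed to zero by cells of mass \<open>1 / 5 ^ n\<close>.\<close>

lemma is_vmeasure_point:
  assumes M: "is_vmeasure M" and z: "z \<in> vicsek"
  shows "emeasure M {z} = 0"
proof -
  have "emeasure M {z} \<le> ennreal ((1 / 5) ^ n)" for n
  proof -
    obtain w where w: "w \<in> vwords n" "z \<in> vpsi_word w ` vicsek" using cell_ex z by blast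
    have s: "set w \<subseteq> {1..5}" "length w = n" using w(1) by (auto simp: vwords_def)
    have "vpsi_word w ` vicsek \<in> cell_gen" using s by (auto simp: cell_gen_def)
    hence "vpsi_word w ` vicsek \<in> sets M"
      using M sets_cell_gen by (auto simp: is_vmeasure_def)
    hence "emeasure M {z} \<le> emeasure M (vpsi_word w ` vicsek)" using w by (intro emeasure_mono) auto
    also have "\<dots> = ennreal ((1 / 5) ^ n)"
      using M s by (simp add: is_vmeasure_def power_one_over)
    finally show ?thesis .
  qed
  moreover have "(\<lambda>n. ennreal ((1 / 5) ^ n)) \<longlonglongrightarrow> ennreal 0"
    by (intro tendsto_ennrealI LIMSEQ_realpow_zero) auto
  ultimately have "emeasure M {z} \<le> ennreal 0" by (intro LIMSEQ_le_const) auto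
  thus ?thesis by simp
qed

lemma is_vmeasure_unique:
  assumes M: "is_vmeasure M" and N: "is_vmeasure N"
  shows "M = N"
proof (rule measure_eqI_generator_eq[OF Int_stable_cell_gen, where \<Omega> = vicsek and A = "\<lambda>_. vicsek"])
  show "cell_gen \<subseteq> Pow vicsek" using cell_subset by (auto simp: cell_gen_def)
  show "sets M = sigma_sets vicsek cell_gen" "sets N = sigma_sets vicsek cell_gen"
    using M N by (auto simp: is_vmeasure_def sets_cell_gen)
  fix X assume "X \<in> cell_gen"
  then consider "X = {}" | "\<exists>z\<in>vicsek. X = {z}" | "\<exists>w. set w \<subseteq> {1..5} \<and> X = vpsi_word w ` vicsek"
    by (auto simp: cell_gen_def)
  thus "emeasure M X = emeasure N X"
  proof cases
    case 2
    thus ?thesis using is_vmeasure_point[OF M] is_vmeasure_point[OF N] by auto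
  next
    case 3
    thus ?thesis using M N by (auto simp: is_vmeasure_def)
  qed simp
next
  have "vicsek = vpsi_word [] ` vicsek" by simp
  thus "range (\<lambda>_. vicsek) \<subseteq> cell_gen" unfolding cell_gen_def by (auto intro!: exI[of _ "[]"])
  show "emeasure M vicsek \<noteq> \<infinity>" using M unfolding is_vmeasure_def by (auto dest!: spec[of _ "[]"])
qed simp

lemma is_vmeasure_vmeasure: "is_vmeasure vmeasure"
proof -
  have "vmeasure = restrict_space vlaw vicsek"
    unfolding vmeasure_def is_vmeasure_def[symmetric]
    using is_vmeasure_exists is_vmeasure_unique by (intro the_equality) auto
  thus ?thesis using is_vmeasure_exists by simp
qed

lemma sets_vmeasure [measurable_cong]: "sets vmeasure = sets (restrict_space borel vicsek)"
  using is_vmeasure_vmeasure by (simp add: is_vmeasure_def)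

lemma space_vmeasure [simp]: "space vmeasure = vicsek"
  using sets_eq_imp_space_eq[OF sets_vmeasure] by (simp add: space_restrict_space)

lemma prob_space_vmeasure: "prob_space vmeasure"
  using is_vmeasure_vmeasure by (intro prob_spaceI) (simp add: is_vmeasure_def)

lemma emeasure_cell: "w \<in> vwords n \<Longrightarrow> emeasure vmeasure (vpsi_word w ` vicsek) = ennreal (1 / 5 ^ n)"
  using is_vmeasure_vmeasure by (auto simp: is_vmeasure_def vwords_def)

lemma closed_in_sets_vmeasure: "closed A \<Longrightarrow> A \<subseteq> vicsek \<Longrightarrow> A \<in> sets vmeasure"
  by (simp add: sets_vmeasure sets_restrict_space_iff borel_closed)

lemma cell_sets: "w \<in> vwords n \<Longrightarrow> vpsi_word w ` vicsek \<in> sets vmeasure"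
  using compact_cell cell_subset_vicsek by (intro closed_in_sets_vmeasure compact_imp_closed) auto


section \<open>Convexity\<close>

text \<open>The tangent at \<open>b\<close> supports the convex function from below. For nonnegative
  \<open>t\<close> this is Young's inequality for \<open>t\<close> and \<open>b powr (p - 1)\<close>
  with exponents \<open>p\<close> and \<open>p / (p - 1)\<close>.\<close>

lemma powr_abs_tangent_pos:
  fixes p b t :: real
  assumes p: "1 < p" and b: "0 < b"
  shows "b powr p + p * b powr (p - 1) * (t - b) \<le> \<bar>t\<bar> powr p"
proof -
  have bp: "b powr (p - 1) * b = b powr p" using b by (simp add: powr_mult_base mult.commute)
  have e: "b powr p + p * b powr (p - 1) * (t - b) = p * b powr (p - 1) * t - (p - 1) * b powr p"
    using bp by (simp add: algebra_simps)
  show ?thesis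
  proof (cases "0 \<le> t")
    case True
    define q where "q = p / (p - 1)"
    have q: "q > 1" "1 / p + 1 / q = 1" using p by (auto simp: q_def field_simps)
    have "t * b powr (p - 1) \<le> t powr p / p + (b powr (p - 1)) powr q / q"
      using True b p q by (intro Youngs_inequality) auto
    also have "(b powr (p - 1)) powr q = b powr p" using p by (simp add: powr_powr q_def)
    finally have "p * (t * b powr (p - 1)) \<le> p * (t powr p / p + b powr p / q)"
      using p by (intro mult_left_mono) auto
    also have "\<dots> = t powr p + (p - 1) * b powr p" using p by (simp add: q_def field_simps)
    finally have "p * b powr (p - 1) * t \<le> t powr p + (p - 1) * b powr p" by (simp add: mult_ac)
    thus ?thesis unfolding e using True by simp
  next
    case False
    have "p * b powr (p - 1) * t \<le> 0" using False p by (intro mult_nonneg_nonpos) auto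
    moreover have "0 \<le> (p - 1) * b powr p" using p by simp
    ultimately show ?thesis using e powr_ge_zero[of "\<bar>t\<bar>" p] by linarith
  qed
qed

lemma powr_abs_tangent:
  fixes p t0 :: real
  assumes p: "1 < p"
  obtains s where "\<And>t. \<bar>t0\<bar> powr p + s * (t - t0) \<le> \<bar>t\<bar> powr p"
proof -
  consider "t0 = 0" | "0 < t0" | "t0 < 0" by linarith
  thus ?thesis
  proof cases
    case 1
    thus ?thesis using that[of 0] p by simp
  next
    case 2
    thus ?thesis using that[of "p * t0 powr (p - 1)"] powr_abs_tangent_pos[OF p 2] by simp
  next
    case 3
    show ?thesis
    proof (rule that[of "- (p * (- t0) powr (p - 1))"])
      fix t
      show "\<bar>t0\<bar> powr p + - (p * (- t0) powr (p - 1)) * (t - t0) \<le> \<bar>t\<bar> powr p"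
        using powr_abs_tangent_pos[OF p, of "- t0" "- t"] 3 by (simp add: algebra_simps)
    qed
  qed
qed

text \<open>Summing the supporting line at the mean cancels its linear term: Jensen for the counting
  measure, which here plays the part of Hoelder's inequality.\<close>

lemma powr_sum_le:
  fixes a :: "nat \<Rightarrow> real"
  assumes p: "1 < p"
  shows "\<bar>\<Sum>i<L. a i\<bar> powr p \<le> real L powr (p - 1) * (\<Sum>i<L. \<bar>a i\<bar> powr p)"
proof (cases "L = 0")
  case False
  define t0 where "t0 = (\<Sum>i<L. a i) / L"
  obtain s where s: "\<And>t. \<bar>t0\<bar> powr p + s * (t - t0) \<le> \<bar>t\<bar> powr p" using powr_abs_tangent[OF p] by blast
  have "(\<Sum>i<L. \<bar>t0\<bar> powr p + s * (a i - t0)) \<le> (\<Sum>i<L. \<bar>a i\<bar> powr p)"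
    by (intro sum_mono s)
  moreover have "(\<Sum>i<L. \<bar>t0\<bar> powr p + s * (a i - t0)) = L * \<bar>t0\<bar> powr p + s * ((\<Sum>i<L. a i) - L * t0)"
    by (simp add: sum.distrib sum_subtractf flip: sum_distrib_left)
  moreover have "L * t0 = (\<Sum>i<L. a i)" using False by (simp add: t0_def)
  ultimately have 1: "L * \<bar>t0\<bar> powr p \<le> (\<Sum>i<L. \<bar>a i\<bar> powr p)" by simp
  have "\<bar>\<Sum>i<L. a i\<bar> powr p = (L * \<bar>t0\<bar>) powr p"
    using False by (simp add: t0_def)
  also have "\<dots> = real L powr p * \<bar>t0\<bar> powr p" by (simp add: powr_mult)
  also have "real L powr p = real L powr (p - 1) * L" using False by (simp add: powr_mult_base mult.commute)
  also have "real L powr (p - 1) * L * \<bar>t0\<bar> powr p \<le> real L powr (p - 1) * (\<Sum>i<L. \<bar>a i\<bar> powr p)"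
    using 1 by (simp add: mult.assoc mult_left_mono)
  finally show ?thesis .
qed simp

lemma powr_add_le:
  fixes a b :: real
  assumes "1 < p"
  shows "\<bar>a + b\<bar> powr p \<le> 2 powr (p - 1) * (\<bar>a\<bar> powr p + \<bar>b\<bar> powr p)"
  using powr_sum_le[OF assms, of "\<lambda>i. if i = 0 then a else b" 2] by (simp add: numeral_2_eq_2)

section \<open>Chains of cells\<close>

text \<open>Both cells are required to lie in \<open>W\<close>, so that a chain cannot leave the
  region where the energy is measured.\<close>

definition cell_adj :: "nat list set \<Rightarrow> (nat list \<times> nat list) set" where
  "cell_adj W = {(u, v). u \<in> W \<and> v \<in> W \<and> vpsi_word u ` vicsek \<inter> vpsi_word v ` vicsek \<noteq> {}}"

lemma cell_adj_relpow_sym: "(u, v) \<in> cell_adj W ^^ l \<Longrightarrow> (v, u) \<in> cell_adj W ^^ l"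
proof (induction l arbitrary: v)
  case (Suc l)
  then obtain r where r: "(u, r) \<in> cell_adj W ^^ l" "(r, v) \<in> cell_adj W" by auto
  have "(v, r) \<in> cell_adj W" using r(2) by (auto simp: cell_adj_def)
  thus ?case using Suc.IH[OF r(1)] by (rule relpow_Suc_I2)
qed simp

lemma cell_adj_prefix:
  assumes "(s, t) \<in> cell_adj (vwords k) ^^ l" and "\<And>s. s \<in> vwords k \<Longrightarrow> u @ s \<in> W"
  shows "(u @ s, u @ t) \<in> cell_adj W ^^ l"
  using assms(1)
proof (induction l arbitrary: t)
  case (Suc l)
  then obtain r where r: "(s, r) \<in> cell_adj (vwords k) ^^ l" "(r, t) \<in> cell_adj (vwords k)" by auto
  hence "(u @ r, u @ t) \<in> cell_adj W"
    using assms(2) by (fastforce simp: cell_adj_def vpsi_word_append image_iff)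
  thus ?case using Suc.IH[OF r(1)] by auto
qed simp

lemma vq_in_corner_cell: "vpsi_word (replicate k i) (vq i) = vq i"
  by (induction k) auto

lemma replicate_vwords: "i \<in> {1..5} \<Longrightarrow> replicate k i \<in> vwords k"
  by (auto simp: vwords_def)

lemma corner_cells_adj:
  assumes "u @ replicate k i \<in> W" "v @ replicate k j \<in> W" "vpsi_word u (vq i) = vpsi_word v (vq j)"
    "i \<in> {1..5}" "j \<in> {1..5}"
  shows "(u @ replicate k i, v @ replicate k j) \<in> cell_adj W"
proof -
  have "vpsi_word (u @ replicate k i) (vq i) = vpsi_word (v @ replicate k j) (vq j)"
    by (simp add: vpsi_word_append vq_in_corner_cell assms)
  moreover have "vq i \<in> vicsek" "vq j \<in> vicsek" using assms vq_in_vicsek by auto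
  ultimately show ?thesis using assms unfolding cell_adj_def by blast
qed

lemma relpow_trans_step:
  "(a, b) \<in> R ^^ l \<Longrightarrow> (b, c) \<in> R \<Longrightarrow> (c, d) \<in> R ^^ l' \<Longrightarrow> (a, d) \<in> R ^^ (l + 1 + l')"
  unfolding relpow_add by auto

text \<open>Three chains inside first-level cells and two crossings make at most
  \<open>3 * (3 ^ k - 1) + 2 = 3 ^ Suc k - 1\<close> steps; the strict inequality is what closes the
  induction.\<close>

lemma chain_to_corner:
  assumes "w \<in> vwords k" "j \<in> {1..4}"
  shows "\<exists>l<3 ^ k. (w, replicate k j) \<in> cell_adj (vwords k) ^^ l"
  using assms
proof (induction k arbitrary: w j)
  case (Suc k)
  let ?R = "cell_adj (vwords (Suc k))"
  have pre: "\<exists>l<3 ^ k. (i # w', i # replicate k j) \<in> ?R ^^ l"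
    if ij: "i \<in> {1..5}" "j \<in> {1..4}" "w' \<in> vwords k" for i j w'
  proof -
    obtain l where l: "l < 3 ^ k" "(w', replicate k j) \<in> cell_adj (vwords k) ^^ l" using Suc.IH ij by blast
    have "([i] @ w', [i] @ replicate k j) \<in> ?R ^^ l"
      by (rule cell_adj_prefix[OF l(2)]) (use ij in \<open>auto simp: vwords_Cons\<close>)
    thus ?thesis using l by auto
  qed
  have adj: "(5 # replicate k i, i # replicate k (vopp i)) \<in> ?R" "(i # replicate k (vopp i), 5 # replicate k i) \<in> ?R"
    if i: "i \<in> {1..4}" for i
  proof -
    have m: "i \<in> {1..5}" "vopp i \<in> {1..5}" using i vopp_mem[OF i] by auto
    have w: "5 # replicate k i \<in> vwords (Suc k)" "i # replicate k (vopp i) \<in> vwords (Suc k)"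
      using m replicate_vwords by (auto simp: vwords_Cons)
    show "(5 # replicate k i, i # replicate k (vopp i)) \<in> ?R"
      using corner_cells_adj[of "[5]" k i "vwords (Suc k)" "[i]" "vopp i"] w m by (simp add: vpsi_vopp)
    show "(i # replicate k (vopp i), 5 # replicate k i) \<in> ?R"
      using corner_cells_adj[of "[i]" k "vopp i" "vwords (Suc k)" "[5]" i] w m by (simp add: vpsi_vopp)
  qed
  obtain i w' where w: "w = i # w'" "i \<in> {1..5}" "w' \<in> vwords k" using Suc.prems by (auto simp: vwords_Suc)
  have j: "j \<in> {1..4}" "j \<in> {1..5}" "vopp j \<in> {1..5}" using Suc.prems vopp_mem[of j] by auto
  obtain l3 where l3: "l3 < 3 ^ k" "(j # replicate k (vopp j), j # replicate k j) \<in> ?R ^^ l3"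
    using pre[OF j(2,1) replicate_vwords[OF j(3)]] by blast
  \<comment> \<open>First reach the central cell at the point facing arm \<open>j\<close>. This
    detour is made even if \<open>w\<close> already lies in arm \<open>j\<close>; repetitions are
    removed later by taking a shortest chain.\<close>
  have "\<exists>l<2 * 3 ^ k. (w, 5 # replicate k j) \<in> ?R ^^ l"
  proof (cases "i = 5")
    case True
    obtain l where "l < 3 ^ k" "(w, 5 # replicate k j) \<in> ?R ^^ l" using pre[OF w(2) j(1) w(3)] w True by blast
    thus ?thesis by (intro exI[of _ l]) auto
  next
    case False
    hence i: "i \<in> {1..4}" "vopp i \<in> {1..4}" using w vopp_mem[of i] by auto
    obtain l1 where l1: "l1 < 3 ^ k" "(w, i # replicate k (vopp i)) \<in> ?R ^^ l1"
      using pre[OF w(2) i(2) w(3)] w by blast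
    obtain l2 where l2: "l2 < 3 ^ k" "(5 # replicate k i, 5 # replicate k j) \<in> ?R ^^ l2"
      using pre[of 5 j, OF _ j(1) replicate_vwords[of i]] i by auto
    show ?thesis using relpow_trans_step[OF l1(2) adj(2)[OF i(1)] l2(2)] l1(1) l2(1)
      by (intro exI[of _ "l1 + 1 + l2"]) auto
  qed
  then obtain l where l: "l < 2 * 3 ^ k" "(w, 5 # replicate k j) \<in> ?R ^^ l" by blast
  show ?case using relpow_trans_step[OF l(2) adj(1)[OF j(1)] l3(2)] l(1) l3(1)
    by (intro exI[of _ "l + 1 + l3"]) auto
qed simp

lemma cell_chain:
  assumes u: "u \<in> vwords m" and v: "v \<in> vwords m" and st: "s \<in> vwords k" "t \<in> vwords k"
    and uv: "u = v \<or> (\<exists>i\<in>{1..4}. \<exists>j\<in>{1..4}. vpsi_word u (vq i) = vpsi_word v (vq j))"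
    and W: "\<And>s. s \<in> vwords k \<Longrightarrow> u @ s \<in> W" "\<And>s. s \<in> vwords k \<Longrightarrow> v @ s \<in> W"
  shows "\<exists>l<2 * 3 ^ k. (u @ s, v @ t) \<in> cell_adj W ^^ l"
proof -
  obtain i j where ij: "i \<in> {1..4}" "j \<in> {1..4}" "vpsi_word u (vq i) = vpsi_word v (vq j)"
  proof (cases "u = v")
    case True
    \<comment> \<open>Inside one cell any corner serves as the meeting point.\<close>
    thus ?thesis using that[of 1 1] by simp
  qed (use uv that in blast)
  obtain l1 where l1: "l1 < 3 ^ k" "(s, replicate k i) \<in> cell_adj (vwords k) ^^ l1"
    using chain_to_corner[OF st(1) ij(1)] by blast
  obtain l2 where l2: "l2 < 3 ^ k" "(t, replicate k j) \<in> cell_adj (vwords k) ^^ l2"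
    using chain_to_corner[OF st(2) ij(2)] by blast
  have "(u @ replicate k i, v @ replicate k j) \<in> cell_adj W"
    using ij W replicate_vwords[of i k] replicate_vwords[of j k] by (intro corner_cells_adj) auto
  from relpow_trans_step[OF cell_adj_prefix[OF l1(2) W(1)] this cell_adj_prefix[OF cell_adj_relpow_sym[OF l2(2)] W(2)]]
  show ?thesis using l1(1) l2(1) by (intro exI[of _ "l1 + 1 + l2"]) auto
qed

text \<open>A chain of minimal length visits nothing twice, since a repeated element would allow a
  shortcut.\<close>

lemma relpow_inj_chain:
  assumes "(a, b) \<in> R ^^ l"
  obtains L f where "L \<le> l" "f 0 = a" "f L = b" "\<And>i. i < L \<Longrightarrow> (f i, f (Suc i)) \<in> R" "inj_on f {..L}"
proof -
  define L where "L = (LEAST l. (a, b) \<in> R ^^ l)"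
  have L: "(a, b) \<in> R ^^ L" "L \<le> l" unfolding L_def using assms by (auto intro: LeastI Least_le)
  obtain f where f: "f 0 = a" "f L = b" "\<And>i. i < L \<Longrightarrow> (f i, f (Suc i)) \<in> R"
    using L(1) unfolding relpow_fun_conv by blast
  have sub: "(f i, f j) \<in> R ^^ (j - i)" if "i \<le> j" "j \<le> L" for i j
    unfolding relpow_fun_conv using f(3) that by (intro exI[of _ "\<lambda>k. f (i + k)"]) auto
  have ne: "f i \<noteq> f j" if ij: "i < j" "j \<le> L" for i j
  proof
    assume "f i = f j"
    hence "(a, b) \<in> R ^^ (i + (L - j))"
      using sub[of 0 i] sub[of j L] ij f(1,2) unfolding relpow_add by auto
    hence "L \<le> i + (L - j)" unfolding L_def by (rule Least_le)
    thus False using ij by linarith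
  qed
  have "inj_on f {..L}"
    by (rule inj_onI) (metis atMost_iff ne linorder_neqE_nat)
  thus ?thesis using that L f by blast
qed

section \<open>Counting cells and measuring balls\<close>

text \<open>An interval of length \<open>2 * c + 2\<close> contains at most \<open>2 * c + 3\<close>
  integers; squared for the two coordinates.\<close>

definition ncount :: "nat \<Rightarrow> nat" where
  "ncount c = (2 * c + 3) ^ 2"

lemma ncount_pos: "0 < ncount c"
  by (simp add: ncount_def)

lemma card_int_interval: "card {a :: int. \<bar>of_int a - s\<bar> \<le> real c + 1} \<le> 2 * c + 3"
  and finite_int_interval: "finite {a :: int. \<bar>of_int a - s\<bar> \<le> real c + 1}"
proof -
  have eq: "{a :: int. \<bar>of_int a - s\<bar> \<le> real c + 1} = {\<lceil>s - (real c + 1)\<rceil>..\<lfloor>s + (real c + 1)\<rfloor>}"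
    unfolding atLeastAtMost_iff set_eq_iff mem_Collect_eq ceiling_le_iff le_floor_iff by (auto simp: abs_le_iff algebra_simps)
  show "finite {a :: int. \<bar>of_int a - s\<bar> \<le> real c + 1}" unfolding eq by simp
  have "\<lfloor>s + (real c + 1)\<rfloor> - \<lceil>s - (real c + 1)\<rceil> + 1 \<le> 2 * int c + 3" by linarith
  thus "card {a :: int. \<bar>of_int a - s\<bar> \<le> real c + 1} \<le> 2 * c + 3" unfolding eq by simp
qed

text \<open>In units of \<open>sqrt 2 / 3 ^ n\<close>, the centre of such a cell is within
  \<open>c / sqrt 2 + 1 / 2\<close>, hence within \<open>c + 1\<close>, of \<open>z\<close> in each
  coordinate. As coordinates determine the cell, counting integer pairs suffices.\<close>

lemma card_cells_near:
  "card {w \<in> vwords n. \<exists>y\<in>vpsi_word w ` vicsek. dist z y \<le> real c / 3 ^ n} \<le> ncount c"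
proof -
  let ?W = "{w \<in> vwords n. \<exists>y\<in>vpsi_word w ` vicsek. dist z y \<le> real c / 3 ^ n}"
  define s where "s = (\<lambda>k. 3 ^ n * z $ k / sqrt 2)"
  let ?I = "\<lambda>k. {a :: int. \<bar>of_int a - s k\<bar> \<le> real c + 1}"
  have one: "\<bar>of_int a - 3 ^ n * zk / sqrt 2\<bar> \<le> real c + 1"
    if "\<bar>zk - (xk + sqrt 2 * of_int a) / 3 ^ n\<bar> \<le> real c / 3 ^ n" "\<bar>xk\<bar> \<le> sqrt 2 / 2"
    for a :: int and zk xk :: real
  proof -
    have "zk - (xk + sqrt 2 * of_int a) / 3 ^ n = (3 ^ n * zk - (xk + sqrt 2 * of_int a)) / 3 ^ n"
      by (simp add: field_simps)
    hence "\<bar>3 ^ n * zk - (xk + sqrt 2 * of_int a)\<bar> \<le> real c"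
      using that(1) by (simp add: abs_divide divide_le_cancel)
    hence "\<bar>sqrt 2 * of_int a - 3 ^ n * zk\<bar> \<le> real c + sqrt 2 / 2" using that(2) by linarith
    moreover have "sqrt 2 * of_int a - 3 ^ n * zk = sqrt 2 * (of_int a - 3 ^ n * zk / sqrt 2)"
      by (simp add: field_simps)
    ultimately have *: "sqrt 2 * \<bar>of_int a - 3 ^ n * zk / sqrt 2\<bar> \<le> real c + sqrt 2 / 2"
      by (simp add: abs_mult)
    have s2: "1 \<le> sqrt 2" "sqrt 2 \<le> 2" by (auto intro: real_le_lsqrt)
    define X where "X = \<bar>of_int a - 3 ^ n * zk / sqrt 2\<bar>"
    have "1 * X \<le> sqrt 2 * X"
      using s2 by (intro mult_right_mono) (auto simp: X_def)
    thus ?thesis using * s2 unfolding X_def[symmetric] by linarith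
  qed
  have sub: "(\<lambda>w. (wx w, wy w)) ` ?W \<subseteq> ?I 1 \<times> ?I 2"
  proof clarsimp
    fix w x assume w: "w \<in> vwords n" and x: "x \<in> vicsek" and d: "dist z (vpsi_word w x) \<le> real c / 3 ^ n"
    have c: "\<bar>z $ k - vpsi_word w x $ k\<bar> \<le> real c / 3 ^ n" for k
      using component_le_norm_cart[of "z - vpsi_word w x" k] d by (simp add: dist_norm)
    have "x \<in> vsquare" using x vicsek_vsquare by blast
    thus "\<bar>of_int (wx w) - s 1\<bar> \<le> real c + 1 \<and> \<bar>of_int (wy w) - s 2\<bar> \<le> real c + 1"
      using one[of "z $ 1" "x $ 1" "wx w"] one[of "z $ 2" "x $ 2" "wy w"] c[of 1] c[of 2] length_vwords[OF w]
      by (simp add: vpsi_word_nth vsquare_def s_def)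
  qed
  have "card ?W = card ((\<lambda>w. (wx w, wy w)) ` ?W)"
    by (rule card_image[symmetric]) (auto intro!: inj_onI wx_wy_inj)
  also have "\<dots> \<le> card (?I 1 \<times> ?I 2)"
    using sub finite_int_interval by (intro card_mono) auto
  also have "\<dots> = card (?I 1) * card (?I 2)" by (rule card_cartesian_product)
  also have "\<dots> \<le> (2 * c + 3) * (2 * c + 3)" by (intro mult_mono card_int_interval) auto
  finally show ?thesis by (simp add: ncount_def power2_eq_square)
qed

lemma card_cells_at: "card {w \<in> vwords n. z \<in> vpsi_word w ` vicsek} \<le> ncount 0"
proof -
  have "{w \<in> vwords n. z \<in> vpsi_word w ` vicsek} = {w \<in> vwords n. \<exists>y\<in>vpsi_word w ` vicsek. dist z y \<le> real 0 / 3 ^ n}"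
    by auto
  thus ?thesis using card_cells_near[of n z 0] by simp
qed

section \<open>Measurability and mass of geodesic balls\<close>

lemma closed_vball:
  assumes "x \<in> vicsek"
  shows "closed (vball x r)"
proof -
  have eq: "vball x r = (\<lambda>y. (x, y)) -` {z \<in> vicsek \<times> vicsek. vdist (fst z) (snd z) \<le> r}"
    using assms by (auto simp: vball_def)
  show ?thesis unfolding eq by (intro closed_vimage closed_vdist_le continuous_intros)
qed

lemma vball_subset: "vball x r \<subseteq> vicsek"
  by (auto simp: vball_def)

lemma vball_sets: "x \<in> vicsek \<Longrightarrow> vball x r \<in> sets vmeasure"
  by (intro closed_in_sets_vmeasure closed_vball vball_subset)

lemma vball_dist: "x \<in> vicsek \<Longrightarrow> y \<in> vball x r \<Longrightarrow> dist x y \<le> r"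
  using vdist_bounds(1)[of x y] by (auto simp: vball_def)

lemma in_vball: "x \<in> vicsek \<Longrightarrow> y \<in> vicsek \<Longrightarrow> 12 * dist x y \<le> r \<Longrightarrow> y \<in> vball x r"
  using vdist_bounds(2)[of x y] by (auto simp: vball_def)

lemma measure_cell: "w \<in> vwords n \<Longrightarrow> measure vmeasure (vpsi_word w ` vicsek) = 1 / 5 ^ n"
  using emeasure_cell[of w n] by (simp add: measure_def)

lemma measure_vball_le:
  assumes x: "x \<in> vicsek"
  shows "measure vmeasure (vball x (real c / 3 ^ n)) \<le> ncount c / 5 ^ n"
proof -
  interpret prob_space vmeasure by (rule prob_space_vmeasure)
  let ?W = "{w \<in> vwords n. \<exists>y\<in>vpsi_word w ` vicsek. dist x y \<le> real c / 3 ^ n}"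
  have sub: "vball x (real c / 3 ^ n) \<subseteq> (\<Union>w\<in>?W. vpsi_word w ` vicsek)"
  proof
    fix y assume y: "y \<in> vball x (real c / 3 ^ n)"
    hence "y \<in> vicsek" using vball_subset by blast
    then obtain w where w: "w \<in> vwords n" "y \<in> vpsi_word w ` vicsek" using cell_ex by blast
    thus "y \<in> (\<Union>w\<in>?W. vpsi_word w ` vicsek)" using vball_dist[OF x y] by blast
  qed
  have "measure vmeasure (vball x (real c / 3 ^ n)) \<le> measure vmeasure (\<Union>w\<in>?W. vpsi_word w ` vicsek)"
    by (intro finite_measure_mono sub) (auto intro!: sets.finite_UN cell_sets)
  also have "\<dots> \<le> (\<Sum>w\<in>?W. measure vmeasure (vpsi_word w ` vicsek))"
    by (intro finite_measure_subadditive_finite) (auto intro!: cell_sets)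
  also have "\<dots> = (\<Sum>w\<in>?W. 1 / 5 ^ n)" by (intro sum.cong) (auto simp: measure_cell)
  also have "\<dots> = card ?W * (1 / 5 ^ n)" by simp
  also have "\<dots> \<le> ncount c * (1 / 5 ^ n)" using card_cells_near by (intro mult_right_mono) auto
  finally show ?thesis by simp
qed

lemma cell_subset_vball:
  assumes "w \<in> vwords n" "x \<in> vpsi_word w ` vicsek" "24 / 3 ^ n \<le> r"
  shows "vpsi_word w ` vicsek \<subseteq> vball x r"
proof
  fix y assume y: "y \<in> vpsi_word w ` vicsek"
  have "x \<in> vicsek" "y \<in> vicsek" using assms y cell_subset_vicsek by blast+
  thus "y \<in> vball x r" using dist_cell[OF assms(1,2) y] assms(3) by (intro in_vball) auto
qed

lemma measure_vball_pos:
  assumes "x \<in> vicsek" "0 < r"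
  shows "0 < measure vmeasure (vball x r)"
proof -
  interpret prob_space vmeasure by (rule prob_space_vmeasure)
  obtain n where n: "24 / 3 ^ n < r" using small_power[OF assms(2)] by blast
  obtain w where w: "w \<in> vwords n" "x \<in> vpsi_word w ` vicsek" using cell_ex assms by blast
  have "0 < measure vmeasure (vpsi_word w ` vicsek)" using measure_cell[OF w(1)] by simp
  also have "\<dots> \<le> measure vmeasure (vball x r)"
    using n assms w by (intro finite_measure_mono vball_sets cell_subset_vball) auto
  finally show ?thesis .
qed


section \<open>Cell averages\<close>

locale vicsek_lp =
  fixes p :: real and f :: "real ^ 2 \<Rightarrow> real"
  assumes p: "1 < p" and f_meas [measurable]: "f \<in> borel_measurable vmeasure"
    and f_int: "integrable vmeasure (\<lambda>x. \<bar>f x\<bar> powr p)"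
begin

sublocale V: prob_space vmeasure
  by (rule prob_space_vmeasure)

lemma integrable_diff: "integrable vmeasure (\<lambda>x. \<bar>f x - a\<bar> powr p)"
proof (rule Bochner_Integration.integrable_bound)
  show "integrable vmeasure (\<lambda>x. 2 powr (p - 1) * (\<bar>f x\<bar> powr p + \<bar>a\<bar> powr p))"
    using f_int by (intro integrable_mult_right Bochner_Integration.integrable_add) auto
  show "AE x in vmeasure. norm (\<bar>f x - a\<bar> powr p) \<le> norm (2 powr (p - 1) * (\<bar>f x\<bar> powr p + \<bar>a\<bar> powr p))"
    using powr_add_le[OF p, of "f _" "- a"] by (intro AE_I2) simp
qed simp

lemma integrable_f: "integrable vmeasure f"
proof (rule Bochner_Integration.integrable_bound)
  show "integrable vmeasure (\<lambda>x. 1 + \<bar>f x\<bar> powr p)"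
    using f_int by (intro Bochner_Integration.integrable_add) auto
  have "t \<le> 1 + t powr p" if "0 \<le> t" for t :: real
  proof (cases "t \<le> 1")
    case True
    thus ?thesis by (simp add: add_increasing2)
  next
    case False
    hence "t powr 1 \<le> t powr p" using p by (intro powr_mono) auto
    thus ?thesis using False by simp
  qed
  thus "AE x in vmeasure. norm (f x) \<le> norm (1 + \<bar>f x\<bar> powr p)"
    by (intro AE_I2) (simp add: abs_of_nonneg)
qed simp

text \<open>The supporting line at the deviation of the mean is integrated over \<open>T\<close>,
  where its linear term vanishes. The mass stands as a factor on the left to avoid division of
  extended reals.\<close>

lemma mean_jensen:
  assumes T [measurable]: "T \<in> sets vmeasure" and pos: "0 < measure vmeasure T"
  shows "ennreal (\<bar>vmean f T - a\<bar> powr p) * ennreal (measure vmeasure T)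
    \<le> (\<integral>\<^sup>+y\<in>T. ennreal (\<bar>f y - a\<bar> powr p) \<partial>vmeasure)"
proof -
  define m where "m = vmean f T"
  obtain s where s: "\<And>t. \<bar>m - a\<bar> powr p + s * (t - (m - a)) \<le> \<bar>t\<bar> powr p" using powr_abs_tangent[OF p] by blast
  let ?g = "\<lambda>y. indicator T y * \<bar>f y - a\<bar> powr p"
  let ?h = "\<lambda>y. indicator T y * (\<bar>m - a\<bar> powr p - s * m) + s * (indicator T y * f y)"
  have ig: "integrable vmeasure ?g"
    using integrable_real_mult_indicator[OF T integrable_diff[of a]] by (simp add: mult.commute)
  have i1: "integrable vmeasure (\<lambda>y. indicator T y * f y)"
    using integrable_real_mult_indicator[OF T integrable_f] by (simp add: mult.commute)
  have i2: "integrable vmeasure (\<lambda>y. indicator T y * (\<bar>m - a\<bar> powr p - s * m))"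
    by (intro integrable_mult_left) (simp add: V.emeasure_eq_measure)
  have "(LINT y|vmeasure. ?h y) \<le> (LINT y|vmeasure. ?g y)"
  proof (rule integral_mono)
    show "integrable vmeasure ?h" using i1 i2 by auto
    fix y
    show "?h y \<le> ?g y" using s[of "f y - a"] by (auto simp: indicator_def algebra_simps)
  qed (rule ig)
  also have "(LINT y|vmeasure. ?h y) = measure vmeasure T * (\<bar>m - a\<bar> powr p - s * m) + s * (LINT y|vmeasure. indicator T y * f y)"
    using i1 i2 by (simp add: Int_absorb1[OF sets.sets_into_space[OF T]] del: space_vmeasure)
  also have "(LINT y|vmeasure. indicator T y * f y) = m * measure vmeasure T"
    using pos by (simp add: m_def vmean_def set_lebesgue_integral_def)
  finally have "\<bar>m - a\<bar> powr p * measure vmeasure T \<le> (LINT y|vmeasure. ?g y)"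
    by (simp add: algebra_simps)
  hence "ennreal (\<bar>m - a\<bar> powr p * measure vmeasure T) \<le> ennreal (LINT y|vmeasure. ?g y)"
    by (rule ennreal_leI)
  also have "\<dots> = (\<integral>\<^sup>+y. ennreal (?g y) \<partial>vmeasure)"
    by (rule nn_integral_eq_integral[OF ig, symmetric]) auto
  also have "\<dots> = (\<integral>\<^sup>+y\<in>T. ennreal (\<bar>f y - a\<bar> powr p) \<partial>vmeasure)"
    by (intro nn_integral_cong) (auto simp: indicator_def)
  finally show ?thesis by (simp add: m_def ennreal_mult)
qed

definition dbl :: "(real ^ 2) set \<Rightarrow> (real ^ 2) set \<Rightarrow> ennreal" where
  "dbl S T = (\<integral>\<^sup>+x\<in>S. (\<integral>\<^sup>+y\<in>T. ennreal (\<bar>f y - f x\<bar> powr p) \<partial>vmeasure) \<partial>vmeasure)"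

lemma mean_jensen_dbl:
  assumes S [measurable]: "S \<in> sets vmeasure" and T: "T \<in> sets vmeasure" "0 < measure vmeasure T"
  shows "(\<integral>\<^sup>+x\<in>S. ennreal (\<bar>f x - vmean f T\<bar> powr p) \<partial>vmeasure) * ennreal (measure vmeasure T) \<le> dbl S T"
proof -
  have "(\<integral>\<^sup>+x\<in>S. ennreal (\<bar>f x - vmean f T\<bar> powr p) \<partial>vmeasure) * ennreal (measure vmeasure T)
    = (\<integral>\<^sup>+x. (ennreal (\<bar>f x - vmean f T\<bar> powr p) * indicator S x) * ennreal (measure vmeasure T) \<partial>vmeasure)"
    by (rule nn_integral_multc[symmetric]) measurable
  also have "\<dots> \<le> dbl S T"
    unfolding dbl_def
  proof (intro nn_integral_mono)
    fix x
    show "(ennreal (\<bar>f x - vmean f T\<bar> powr p) * indicator S x) * ennreal (measure vmeasure T)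
      \<le> (\<integral>\<^sup>+y\<in>T. ennreal (\<bar>f y - f x\<bar> powr p) \<partial>vmeasure) * indicator S x"
      using mean_jensen[OF T, of "f x"] by (auto simp: indicator_def abs_minus_commute)
  qed
  finally show ?thesis .
qed

text \<open>Jensen twice: over \<open>S\<close> with the mean over \<open>T\<close> as constant,
  then over \<open>T\<close> for each fixed point of \<open>S\<close>.\<close>

lemma mean_diff_dbl:
  assumes S: "S \<in> sets vmeasure" "0 < measure vmeasure S" and T: "T \<in> sets vmeasure" "0 < measure vmeasure T"
  shows "ennreal (\<bar>vmean f S - vmean f T\<bar> powr p) * ennreal (measure vmeasure S) * ennreal (measure vmeasure T) \<le> dbl S T"
  using mult_right_mono[OF mean_jensen[OF S, of "vmean f T"], of "ennreal (measure vmeasure T)"]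
    mean_jensen_dbl[OF S(1) T] by (meson order_trans zero_le)

definition cavg :: "nat list \<Rightarrow> real" where
  "cavg w = vmean f (vpsi_word w ` vicsek)"

lemma cell_pos: "w \<in> vwords n \<Longrightarrow> 0 < measure vmeasure (vpsi_word w ` vicsek)"
  by (simp add: measure_cell)

lemma ennreal_div_le_imp:
  assumes "0 < c" "X * ennreal (1 / c) \<le> Y"
  shows "X \<le> ennreal c * Y"
proof -
  have "X = ennreal c * (X * ennreal (1 / c))"
    using assms(1) by (metis ennreal_mult' ennreal_1 less_imp_le mult.commute mult.left_commute mult.right_neutral nonzero_eq_divide_eq order_less_irrefl)
  also have "\<dots> \<le> ennreal c * Y" using assms(2) by (rule mult_left_mono) simp
  finally show ?thesis .
qed

text \<open>\<open>25 ^ n\<close> is the reciprocal of the product of two cell masses.\<close>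

lemma cavg_diff:
  assumes "u \<in> vwords n" "v \<in> vwords n"
  shows "ennreal (\<bar>cavg u - cavg v\<bar> powr p) \<le> ennreal (25 ^ n) * dbl (vpsi_word u ` vicsek) (vpsi_word v ` vicsek)"
proof (rule ennreal_div_le_imp)
  have "ennreal (1 / 25 ^ n) = ennreal (1 / 5 ^ n) * ennreal (1 / 5 ^ n)"
    by (simp add: power_mult_distrib[symmetric] flip: ennreal_mult)
  thus "ennreal (\<bar>cavg u - cavg v\<bar> powr p) * ennreal (1 / 25 ^ n) \<le> dbl (vpsi_word u ` vicsek) (vpsi_word v ` vicsek)"
    using mean_diff_dbl[OF cell_sets[OF assms(1)] cell_pos[OF assms(1)] cell_sets[OF assms(2)] cell_pos[OF assms(2)]]
    by (simp add: cavg_def measure_cell[OF assms(1)] measure_cell[OF assms(2)] mult.assoc)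
qed simp

lemma cavg_self:
  assumes "w \<in> vwords n"
  shows "(\<integral>\<^sup>+x\<in>vpsi_word w ` vicsek. ennreal (\<bar>f x - cavg w\<bar> powr p) \<partial>vmeasure)
    \<le> ennreal (5 ^ n) * dbl (vpsi_word w ` vicsek) (vpsi_word w ` vicsek)"
proof (rule ennreal_div_le_imp)
  show "(\<integral>\<^sup>+x\<in>vpsi_word w ` vicsek. ennreal (\<bar>f x - cavg w\<bar> powr p) \<partial>vmeasure) * ennreal (1 / 5 ^ n)
    \<le> dbl (vpsi_word w ` vicsek) (vpsi_word w ` vicsek)"
    using mean_jensen_dbl[OF cell_sets[OF assms] cell_sets[OF assms] cell_pos[OF assms]]
    by (simp add: cavg_def measure_cell[OF assms])
qed simp

section \<open>Comparison with the energy at a fixed scale\<close>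

text \<open>The double integral in \<open>ks_pow\<close> at a single radius, without the normalising
  power.\<close>

definition energy :: "(real ^ 2) set \<Rightarrow> real \<Rightarrow> ennreal" where
  "energy A \<rho> = (\<integral>\<^sup>+x\<in>A. (\<integral>\<^sup>+y\<in>vball x \<rho> \<inter> A.
     ennreal (\<bar>f y - f x\<bar> powr p / measure vmeasure (vball x \<rho>)) \<partial>vmeasure) \<partial>vmeasure)"

lemma adjacent_cells_in_ball:
  assumes "u \<in> vwords n" "v \<in> vwords n" "vpsi_word u ` vicsek \<inter> vpsi_word v ` vicsek \<noteq> {}"
    and "x \<in> vpsi_word u ` vicsek" "y \<in> vpsi_word v ` vicsek"
  shows "y \<in> vball x (48 / 3 ^ n)"
proof -
  obtain z where z: "z \<in> vpsi_word u ` vicsek" "z \<in> vpsi_word v ` vicsek" using assms(3) by blast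
  have "dist x z \<le> 2 / 3 ^ n" "dist z y \<le> 2 / 3 ^ n" using dist_cell assms z by blast+
  hence "dist x y \<le> 4 / 3 ^ n" using dist_triangle[of x y z] by simp
  moreover have "x \<in> vicsek" "y \<in> vicsek" using assms cell_subset_vicsek by blast+
  ultimately show ?thesis by (intro in_vball) auto
qed

text \<open>\<open>ncount 0\<close> bounds the number of level-n cells through a point,
  \<open>ncount 48\<close> the mass of a ball of radius \<open>48 / 3 ^ n\<close> in units of
  \<open>1 / 5 ^ n\<close>.\<close>

definition Nc :: real where
  "Nc = real (ncount 0) * real (ncount 48)"

lemma Nc_pos: "0 < Nc"
  unfolding Nc_def using ncount_pos by (intro mult_pos_pos) auto

text \<open>Touching cells lie in the ball of radius \<open>48 / 3 ^ n\<close> around each point of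
  the first cell, so each double integral is part of the energy up to the mass of a ball.
  Injectivity of \<open>u\<close> keeps the overlap of the first cells bounded, whatever the number
  of pairs.\<close>

lemma sum_dbl_le_energy:
  assumes I: "finite I" "inj_on u I" and uv: "\<And>i. i \<in> I \<Longrightarrow> u i \<in> vwords n" "\<And>i. i \<in> I \<Longrightarrow> v i \<in> vwords n"
      "\<And>i. i \<in> I \<Longrightarrow> vpsi_word (u i) ` vicsek \<inter> vpsi_word (v i) ` vicsek \<noteq> {}"
    and A: "A \<in> sets vmeasure"
      "\<And>i. i \<in> I \<Longrightarrow> vpsi_word (u i) ` vicsek \<subseteq> A" "\<And>i. i \<in> I \<Longrightarrow> vpsi_word (v i) ` vicsek \<subseteq> A"
  shows "(\<Sum>i\<in>I. dbl (vpsi_word (u i) ` vicsek) (vpsi_word (v i) ` vicsek))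
    \<le> ennreal (Nc / 5 ^ n) * energy A (48 / 3 ^ n)"
proof -
  let ?\<rho> = "48 / 3 ^ n :: real"
  let ?U = "\<lambda>i. vpsi_word (u i) ` vicsek" and ?V = "\<lambda>i. vpsi_word (v i) ` vicsek"
  define K where "K = real (ncount 48) / 5 ^ n"
  define c where "c = Nc / 5 ^ n"
  have Kpos: "0 < K" using ncount_pos by (simp add: K_def)
  have cK: "c = ncount 0 * K" by (simp add: c_def K_def Nc_def)
  have cpos: "0 < c" using Nc_pos by (simp add: c_def)
  define G where "G = (\<lambda>x. \<integral>\<^sup>+y\<in>vball x ?\<rho> \<inter> A. ennreal (\<bar>f y - f x\<bar> powr p / measure vmeasure (vball x ?\<rho>)) \<partial>vmeasure)"
  define H where "H = (\<lambda>i x. \<integral>\<^sup>+y\<in>?V i. ennreal (\<bar>f y - f x\<bar> powr p) \<partial>vmeasure)"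
  have HG: "H i x \<le> ennreal K * G x" if i: "i \<in> I" and x: "x \<in> ?U i" for i x
  proof -
    have xv: "x \<in> vicsek" using x cell_subset_vicsek[OF uv(1)[OF i]] by blast
    let ?b = "measure vmeasure (vball x ?\<rho>)"
    have b: "0 < ?b" "?b \<le> K"
      using measure_vball_pos[OF xv] measure_vball_le[OF xv, of 48 n] by (simp_all add: K_def)
    have [measurable]: "vball x ?\<rho> \<inter> A \<in> sets vmeasure" using vball_sets[OF xv] A(1) by auto
    have "ennreal K * G x = (\<integral>\<^sup>+y. ennreal K * (ennreal (\<bar>f y - f x\<bar> powr p / ?b) * indicator (vball x ?\<rho> \<inter> A) y) \<partial>vmeasure)"
      unfolding G_def by (rule nn_integral_cmult[symmetric]) measurable
    moreover have "H i x \<le> \<dots>"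
      unfolding H_def
    proof (intro nn_integral_mono)
      fix y
      have "ennreal (\<bar>f y - f x\<bar> powr p) \<le> ennreal K * ennreal (\<bar>f y - f x\<bar> powr p / ?b)"
      proof -
        have "\<bar>f y - f x\<bar> powr p * ?b \<le> \<bar>f y - f x\<bar> powr p * K" using b by (intro mult_left_mono) auto
        hence "\<bar>f y - f x\<bar> powr p \<le> K * (\<bar>f y - f x\<bar> powr p / ?b)" using b by (simp add: field_simps)
        thus ?thesis using Kpos by (simp flip: ennreal_mult')
      qed
      moreover have "y \<in> vball x ?\<rho> \<inter> A" if "y \<in> ?V i"
        using adjacent_cells_in_ball[OF uv(1,2)[OF i] uv(3)[OF i] x that] A(3)[OF i] that by blast
      ultimately show "ennreal (\<bar>f y - f x\<bar> powr p) * indicator (?V i) y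
        \<le> ennreal K * (ennreal (\<bar>f y - f x\<bar> powr p / ?b) * indicator (vball x ?\<rho> \<inter> A) y)"
        by (auto simp: indicator_def)
    qed
    ultimately show ?thesis by simp
  qed
  \<comment> \<open>At \<open>x\<close> only the indices in \<open>J\<close> contribute, and
    distinct indices give distinct cells through \<open>x\<close>.\<close>
  have pt: "(\<Sum>i\<in>I. H i x * indicator (?U i) x) \<le> ennreal c * (G x * indicator A x)" for x
  proof -
    define J where "J = {i\<in>I. x \<in> ?U i}"
    have "finite J" using I by (simp add: J_def)
    have "(\<Sum>i\<in>I. H i x * indicator (?U i) x) = (\<Sum>i\<in>J. H i x)"
      unfolding J_def sum.inter_filter[OF I(1)] by (intro sum.cong) (auto simp: indicator_def)
    also have "\<dots> \<le> (\<Sum>i\<in>J. ennreal K * G x)" by (intro sum_mono HG) (auto simp: J_def)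
    also have "\<dots> = of_nat (card J) * (ennreal K * G x)" by simp
    also have "\<dots> \<le> of_nat (ncount 0) * (ennreal K * (G x * indicator A x))"
    proof (cases "J = {}")
      case False
      hence xA: "x \<in> A" using A(2) by (auto simp: J_def)
      have "card J = card (u ` J)" using I(2) by (intro card_image[symmetric]) (auto simp: J_def inj_on_def)
      also have "\<dots> \<le> card {w \<in> vwords n. x \<in> vpsi_word w ` vicsek}"
        using uv(1) by (intro card_mono) (auto simp: J_def)
      also have "\<dots> \<le> ncount 0" by (rule card_cells_at)
      finally show ?thesis using xA by (intro mult_mono) (auto simp: of_nat_mono)
    qed simp
    also have "\<dots> = ennreal c * (G x * indicator A x)"
      using Kpos by (simp add: cK ennreal_mult ennreal_of_nat_eq_real_of_nat mult.assoc)
    finally show ?thesis .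
  qed
  have [measurable]: "?U i \<in> sets vmeasure" "?V i \<in> sets vmeasure" if "i \<in> I" for i
    using cell_sets uv that by blast+
  have Hm: "(\<lambda>x. H i x * indicator (?U i) x) \<in> borel_measurable vmeasure" if "i \<in> I" for i
    unfolding H_def using that by measurable
  have "(\<Sum>i\<in>I. dbl (?U i) (?V i)) = (\<integral>\<^sup>+x. (\<Sum>i\<in>I. H i x * indicator (?U i) x) \<partial>vmeasure)"
  proof -
    have "dbl (?U i) (?V i) = (\<integral>\<^sup>+x. H i x * indicator (?U i) x \<partial>vmeasure)" for i
      by (simp add: dbl_def H_def)
    thus ?thesis using Hm by (simp add: nn_integral_sum)
  qed
  also have "\<dots> \<le> ennreal c * energy A ?\<rho>"
  \<comment> \<open>The constant is moved to the left, where \<open>Hm\<close> supplies the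
    measurability needed to take it under the integral; \<open>G\<close> is then only compared
    pointwise.\<close>
  proof (rule ennreal_div_le_imp[OF cpos])
    have "(\<integral>\<^sup>+x. (\<Sum>i\<in>I. H i x * indicator (?U i) x) \<partial>vmeasure) * ennreal (1 / c)
      = (\<integral>\<^sup>+x. (\<Sum>i\<in>I. H i x * indicator (?U i) x) * ennreal (1 / c) \<partial>vmeasure)"
      by (rule nn_integral_multc[symmetric]) (intro borel_measurable_sum Hm)
    also have "\<dots> \<le> (\<integral>\<^sup>+x. G x * indicator A x \<partial>vmeasure)"
    proof (intro nn_integral_mono)
      fix x
      have "(\<Sum>i\<in>I. H i x * indicator (?U i) x) * ennreal (1 / c) \<le> ennreal c * (G x * indicator A x) * ennreal (1 / c)"
        using pt by (intro mult_right_mono) auto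
      also have "\<dots> = (ennreal c * ennreal (1 / c)) * (G x * indicator A x)" by (simp add: mult_ac)
      also have "ennreal c * ennreal (1 / c) = 1" using cpos by (simp flip: ennreal_mult')
      finally show "(\<Sum>i\<in>I. H i x * indicator (?U i) x) * ennreal (1 / c) \<le> G x * indicator A x" by simp
    qed
    also have "\<dots> = energy A ?\<rho>" unfolding energy_def G_def ..
    finally show "(\<integral>\<^sup>+x. (\<Sum>i\<in>I. H i x * indicator (?U i) x) \<partial>vmeasure) * ennreal (1 / c) \<le> energy A ?\<rho>" .
  qed
  finally show ?thesis by (simp add: c_def)
qed

text \<open>A shortest chain has at most \<open>2 * 3 ^ k\<close> links with distinct first cells,
  so the sum over all links is paid by one energy. The factor \<open>5 ^ n * Nc\<close> is
  \<open>25 ^ n\<close> from the averages times \<open>Nc / 5 ^ n\<close> from the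
  comparison.\<close>

lemma cavg_chain:
  assumes W: "W \<subseteq> vwords n" "\<And>w. w \<in> W \<Longrightarrow> vpsi_word w ` vicsek \<subseteq> A" and A: "A \<in> sets vmeasure"
    and ab: "(a, b) \<in> cell_adj W ^^ l" "l < 2 * 3 ^ k"
  shows "ennreal (\<bar>cavg a - cavg b\<bar> powr p)
    \<le> ennreal ((2 * 3 ^ k) powr (p - 1) * (5 ^ n * Nc)) * energy A (48 / 3 ^ n)"
proof -
  obtain L g where L: "L \<le> l" "g 0 = a" "g L = b" "\<And>i. i < L \<Longrightarrow> (g i, g (Suc i)) \<in> cell_adj W" "inj_on g {..L}"
    using relpow_inj_chain[OF ab(1)] by blast
  have g: "g i \<in> W" "g (Suc i) \<in> W" "vpsi_word (g i) ` vicsek \<inter> vpsi_word (g (Suc i)) ` vicsek \<noteq> {}" if "i < L" for i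
    using L(4)[OF that] by (auto simp: cell_adj_def)
  have "cavg a - cavg b = - (\<Sum>i<L. cavg (g (Suc i)) - cavg (g i))"
    using sum_lessThan_telescope[of "\<lambda>i. cavg (g i)" L] L(2,3) by simp
  hence "\<bar>cavg a - cavg b\<bar> powr p \<le> real L powr (p - 1) * (\<Sum>i<L. \<bar>cavg (g (Suc i)) - cavg (g i)\<bar> powr p)"
    using powr_sum_le[OF p, of "\<lambda>i. cavg (g (Suc i)) - cavg (g i)" L] by simp
  also have "\<dots> \<le> (2 * 3 ^ k) powr (p - 1) * (\<Sum>i<L. \<bar>cavg (g i) - cavg (g (Suc i))\<bar> powr p)"
  proof (intro mult_mono powr_mono2 sum_nonneg sum_mono)
    have "real L \<le> real (2 * 3 ^ k)" using L(1) ab(2) by (intro of_nat_mono) simp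
    thus "real L \<le> 2 * 3 ^ k" by simp
  qed (use p in \<open>auto simp: abs_minus_commute\<close>)
  finally have "ennreal (\<bar>cavg a - cavg b\<bar> powr p)
      \<le> ennreal ((2 * 3 ^ k) powr (p - 1) * (\<Sum>i<L. \<bar>cavg (g i) - cavg (g (Suc i))\<bar> powr p))"
    by (rule ennreal_leI)
  also have "\<dots> = ennreal ((2 * 3 ^ k) powr (p - 1)) * (\<Sum>i<L. ennreal (\<bar>cavg (g i) - cavg (g (Suc i))\<bar> powr p))"
    by (subst sum_ennreal) (auto simp: ennreal_mult sum_nonneg)
  also have "(\<Sum>i<L. ennreal (\<bar>cavg (g i) - cavg (g (Suc i))\<bar> powr p))
      \<le> (\<Sum>i<L. ennreal (25 ^ n) * dbl (vpsi_word (g i) ` vicsek) (vpsi_word (g (Suc i)) ` vicsek))"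
    using g W(1) by (intro sum_mono cavg_diff) auto
  also have "\<dots> = ennreal (25 ^ n) * (\<Sum>i<L. dbl (vpsi_word (g i) ` vicsek) (vpsi_word (g (Suc i)) ` vicsek))"
    by (simp add: sum_distrib_left)
  also have "(\<Sum>i<L. dbl (vpsi_word (g i) ` vicsek) (vpsi_word (g (Suc i)) ` vicsek)) \<le> ennreal (Nc / 5 ^ n) * energy A (48 / 3 ^ n)"
  proof (rule sum_dbl_le_energy)
    show "inj_on g {..<L}" using L(5) by (rule inj_on_subset) auto
  qed (use g W A in auto)
  also have "ennreal ((2 * 3 ^ k) powr (p - 1)) * (ennreal (25 ^ n) * (ennreal (Nc / 5 ^ n) * energy A (48 / 3 ^ n)))
    = ennreal ((2 * 3 ^ k) powr (p - 1) * (25 ^ n * (Nc / 5 ^ n))) * energy A (48 / 3 ^ n)"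
  proof -
    have "ennreal ((2 * 3 ^ k) powr (p - 1) * (25 ^ n * (Nc / 5 ^ n)))
      = ennreal ((2 * 3 ^ k) powr (p - 1)) * (ennreal (25 ^ n) * ennreal (Nc / 5 ^ n))"
      using Nc_pos ennreal_mult[of "(2 * 3 ^ k) powr (p - 1)" "25 ^ n * (Nc / 5 ^ n)"] ennreal_mult[of "25 ^ n" "Nc / 5 ^ n"]
      by simp
    thus ?thesis by (simp only: mult.assoc)
  qed
  also have "(25 :: real) ^ n * (Nc / 5 ^ n) = 5 ^ n * Nc"
  proof -
    have "(25 :: real) ^ n = 5 ^ n * 5 ^ n" by (simp flip: power_mult_distrib)
    thus ?thesis by simp
  qed
  finally show ?thesis by (simp add: mult_left_mono)
qed

text \<open>The distance of the mean from \<open>a\<close> is itself controlled by Jensen, so any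
  constant may replace the mean at the price of \<open>2 powr (p - 1) * 2\<close>. This lets one
  cell average serve as reference for the whole ball.\<close>

lemma mean_minimizes:
  assumes B [measurable]: "B \<in> sets vmeasure" and pos: "0 < measure vmeasure B"
  shows "(\<integral>\<^sup>+x\<in>B. ennreal (\<bar>f x - vmean f B\<bar> powr p) \<partial>vmeasure)
    \<le> ennreal (2 powr p) * (\<integral>\<^sup>+x\<in>B. ennreal (\<bar>f x - a\<bar> powr p) \<partial>vmeasure)"
    (is "_ \<le> _ * ?I")
proof -
  have "(\<integral>\<^sup>+x\<in>B. ennreal (\<bar>f x - vmean f B\<bar> powr p) \<partial>vmeasure)
    \<le> (\<integral>\<^sup>+x. ennreal (2 powr (p - 1)) * (ennreal (\<bar>f x - a\<bar> powr p) * indicator B x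
         + ennreal (\<bar>vmean f B - a\<bar> powr p) * indicator B x) \<partial>vmeasure)"
  proof (intro nn_integral_mono)
    fix x
    have "\<bar>f x - vmean f B\<bar> powr p \<le> 2 powr (p - 1) * (\<bar>f x - a\<bar> powr p + \<bar>vmean f B - a\<bar> powr p)"
      using powr_add_le[OF p, of "f x - a" "a - vmean f B"] by (simp add: abs_minus_commute)
    hence "ennreal (\<bar>f x - vmean f B\<bar> powr p) \<le> ennreal (2 powr (p - 1) * (\<bar>f x - a\<bar> powr p + \<bar>vmean f B - a\<bar> powr p))"
      by (rule ennreal_leI)
    thus "ennreal (\<bar>f x - vmean f B\<bar> powr p) * indicator B x
      \<le> ennreal (2 powr (p - 1)) * (ennreal (\<bar>f x - a\<bar> powr p) * indicator B x + ennreal (\<bar>vmean f B - a\<bar> powr p) * indicator B x)"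
      by (auto simp: indicator_def ennreal_mult)
  qed
  also have "\<dots> = ennreal (2 powr (p - 1)) * (?I + ennreal (\<bar>vmean f B - a\<bar> powr p) * emeasure vmeasure B)"
    by (simp add: nn_integral_cmult nn_integral_add nn_integral_cmult_indicator)
  also have "\<dots> \<le> ennreal (2 powr (p - 1)) * (?I + ?I)"
    using mean_jensen[OF B pos, of a] by (intro mult_left_mono add_left_mono) (simp_all add: V.emeasure_eq_measure)
  also have "\<dots> = ennreal (2 powr (p - 1) * 2) * ?I"
    by (simp add: ennreal_mult mult.assoc mult_2)
  also have "2 powr (p - 1) * 2 = 2 powr p" by (simp add: powr_diff)
  finally show ?thesis .
qed

lemma cell_integral_le:
  assumes w: "w \<in> vwords n"
  shows "(\<integral>\<^sup>+x\<in>vpsi_word w ` vicsek. ennreal (\<bar>f x - a\<bar> powr p) \<partial>vmeasure)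
    \<le> ennreal (2 powr (p - 1)) * (ennreal (5 ^ n) * dbl (vpsi_word w ` vicsek) (vpsi_word w ` vicsek)
        + ennreal (\<bar>cavg w - a\<bar> powr p) * ennreal (1 / 5 ^ n))"
proof -
  let ?C = "vpsi_word w ` vicsek"
  have [measurable]: "?C \<in> sets vmeasure" using w by (rule cell_sets)
  have "(\<integral>\<^sup>+x\<in>?C. ennreal (\<bar>f x - a\<bar> powr p) \<partial>vmeasure)
    \<le> (\<integral>\<^sup>+x. ennreal (2 powr (p - 1)) * (ennreal (\<bar>f x - cavg w\<bar> powr p) * indicator ?C x
         + ennreal (\<bar>cavg w - a\<bar> powr p) * indicator ?C x) \<partial>vmeasure)"
  proof (intro nn_integral_mono)
    fix x
    have "\<bar>f x - a\<bar> powr p \<le> 2 powr (p - 1) * (\<bar>f x - cavg w\<bar> powr p + \<bar>cavg w - a\<bar> powr p)"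
      using powr_add_le[OF p, of "f x - cavg w" "cavg w - a"] by simp
    hence "ennreal (\<bar>f x - a\<bar> powr p) \<le> ennreal (2 powr (p - 1) * (\<bar>f x - cavg w\<bar> powr p + \<bar>cavg w - a\<bar> powr p))"
      by (rule ennreal_leI)
    thus "ennreal (\<bar>f x - a\<bar> powr p) * indicator ?C x
      \<le> ennreal (2 powr (p - 1)) * (ennreal (\<bar>f x - cavg w\<bar> powr p) * indicator ?C x + ennreal (\<bar>cavg w - a\<bar> powr p) * indicator ?C x)"
      by (auto simp: indicator_def ennreal_mult)
  qed
  also have "\<dots> = ennreal (2 powr (p - 1)) * ((\<integral>\<^sup>+x\<in>?C. ennreal (\<bar>f x - cavg w\<bar> powr p) \<partial>vmeasure)
      + ennreal (\<bar>cavg w - a\<bar> powr p) * emeasure vmeasure ?C)"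
    by (simp add: nn_integral_cmult nn_integral_add nn_integral_cmult_indicator)
  also have "\<dots> \<le> ennreal (2 powr (p - 1)) * (ennreal (5 ^ n) * dbl ?C ?C + ennreal (\<bar>cavg w - a\<bar> powr p) * ennreal (1 / 5 ^ n))"
    using cavg_self[OF w] emeasure_cell[OF w] by (intro mult_left_mono add_mono) auto
  finally show ?thesis .
qed

text \<open>The level \<open>m\<close> matches the radius and \<open>k\<close> is the free
  refinement. Every level-n cell meeting the ball is compared with the one at the centre by a chain.
  The alternative \<open>m = 0\<close> admits large radii, where the whole set is a single
  cell.\<close>

lemma level_estimate:
  assumes x0: "x0 \<in> vicsek" and r: "0 < r" and m: "1 / 3 ^ m \<le> 3 * r" "m = 0 \<or> r \<le> 1 / 3 ^ m"
  shows "(\<integral>\<^sup>+x\<in>vball x0 r. ennreal (\<bar>f x - vmean f (vball x0 r)\<bar> powr p) \<partial>vmeasure)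
    \<le> ennreal (2 powr p * (2 powr (p - 1) * (Nc + real (ncount 1) * (5 ^ k * ((2 * 3 ^ k) powr (p - 1) * Nc)))))
       * energy (vball x0 (84 * r)) (48 / 3 ^ (m + k))"
proof -
  define n where "n = m + k"
  define B where "B = vball x0 r"
  define A where "A = vball x0 (84 * r)"
  define J where "J = energy A (48 / 3 ^ n)"
  define Q where "Q = (2 * 3 ^ k) powr (p - 1) * (5 ^ n * Nc)"
  have Qnn: "0 \<le> Q" using Nc_pos by (simp add: Q_def)
  have B: "B \<in> sets vmeasure" and A: "A \<in> sets vmeasure" using x0 by (auto simp: A_def B_def intro: vball_sets)
  obtain v0 where v0: "v0 \<in> vwords n" "x0 \<in> vpsi_word v0 ` vicsek" using cell_ex[OF x0] by blast
  define v t where "v = take m v0" and "t = drop m v0"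
  have vt: "v \<in> vwords m" "t \<in> vwords k" "v0 = v @ t"
    using vwords_split[of v0 m k] v0(1) by (auto simp: n_def v_def t_def)
  have prefix_sub: "vpsi_word (u @ s) ` vicsek \<subseteq> vpsi_word u ` vicsek" if "s \<in> vwords k" for u s
    using that by (intro cell_append_subset) (auto simp: vwords_def)
  have x0v: "x0 \<in> vpsi_word v ` vicsek" using v0(2) prefix_sub[OF vt(2)] vt(3) by blast
  have x0B: "x0 \<in> B" using in_vball[OF x0 x0, of r] r by (simp add: B_def)
  \<comment> \<open>\<open>W'\<close> covers the ball; the larger \<open>W\<close> contains every
    subcell of a level-m cell that meets the ball, so that chains have room to run.\<close>
  define W where "W = {w \<in> vwords n. vpsi_word (take m w) ` vicsek \<inter> B \<noteq> {}}"
  define W' where "W' = {w \<in> vwords n. vpsi_word w ` vicsek \<inter> B \<noteq> {}}"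
  have W'W: "W' \<subseteq> W"
  proof
    fix w assume w: "w \<in> W'"
    hence "drop m w \<in> vwords k" using vwords_split[of w m k] by (simp add: W'_def n_def)
    hence "vpsi_word w ` vicsek \<subseteq> vpsi_word (take m w) ` vicsek" using prefix_sub[of "drop m w" "take m w"] by simp
    thus "w \<in> W" using w unfolding W_def W'_def by blast
  qed
  have finW': "finite W'" by (simp add: W'_def)
  have WA: "vpsi_word w ` vicsek \<subseteq> A" if w: "w \<in> W" for w
  proof
    fix y assume y: "y \<in> vpsi_word w ` vicsek"
    have split: "take m w \<in> vwords m" "drop m w \<in> vwords k" using w vwords_split[of w m k] by (auto simp: W_def n_def)
    have y': "y \<in> vpsi_word (take m w) ` vicsek" using y prefix_sub[OF split(2), of "take m w"] by auto
    obtain x where x: "x \<in> vpsi_word (take m w) ` vicsek" "x \<in> B" using w by (auto simp: W_def)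
    have "dist x0 x \<le> r" using vball_dist[OF x0] x(2) by (simp add: B_def)
    moreover have "dist x y \<le> 2 / 3 ^ m" by (rule dist_cell[OF split(1) x(1) y'])
    \<comment> \<open>The distance from \<open>x0\<close> to \<open>y\<close> is at most
      \<open>r + 2 / 3 ^ m \<le> 7 * r\<close>, and 84 = 12 * 7.\<close>
    ultimately have "12 * dist x0 y \<le> 84 * r" using m(1) dist_triangle[of x0 y x] by simp
    moreover have "y \<in> vicsek" using y' split(1) cell_subset_vicsek by blast
    ultimately show "y \<in> A" unfolding A_def by (intro in_vball x0)
  qed
  have chain: "ennreal (\<bar>cavg w - cavg v0\<bar> powr p) \<le> ennreal Q * J" if w: "w \<in> W'" for w
  proof -
    define u s where "u = take m w" and "s = drop m w"
    have us: "u \<in> vwords m" "s \<in> vwords k" "w = u @ s"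
      using vwords_split[of w m k] w by (auto simp: n_def u_def s_def W'_def)
    obtain x where x: "x \<in> vpsi_word w ` vicsek" "x \<in> B" using w by (auto simp: W'_def)
    have xu: "x \<in> vpsi_word u ` vicsek" using x(1) prefix_sub[OF us(2), of u] us(3) by blast
    have uv: "u = v \<or> (\<exists>i\<in>{1..4}. \<exists>j\<in>{1..4}. vpsi_word u (vq i) = vpsi_word v (vq j))"
    \<comment> \<open>At level 0 there is only the empty word. Otherwise
      \<open>r \<le> 1 / 3 ^ m\<close> is below the threshold of \<open>cells_close\<close>, so
      distinct cells share a corner.\<close>
    proof (cases "u = v \<or> m = 0")
      case True
      thus ?thesis using us(1) vt(1) by auto
    next
      case False
      obtain a b where ab: "x = vpsi_word u a" "a \<in> vicsek" "x0 = vpsi_word v b" "b \<in> vicsek" using xu x0v by blast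
      have sq: "a \<in> vsquare" "b \<in> vsquare" using ab vicsek_vsquare by auto
      have "dist x x0 \<le> 1 / 3 ^ m" using vball_dist[OF x0, of x r] x(2) m(2) False by (simp add: B_def dist_commute)
      also have "1 / 3 ^ m < sqrt 2 / 3 ^ m" by (simp add: divide_strict_right_mono)
      finally have d: "dist (vpsi_word u a) (vpsi_word v b) < sqrt 2 / 3 ^ m" using ab by simp
      show ?thesis using cells_close[OF us(1) vt(1) _ sq d] False vopp_mem by metis
    qed
    have in_W: "u @ s' \<in> W" "v @ s' \<in> W" if "s' \<in> vwords k" for s'
      using us(1) vt(1) that vwords_append xu x0v x(2) x0B length_vwords[OF us(1)] length_vwords[OF vt(1)]
      by (auto simp: W_def n_def)
    obtain l where l: "l < 2 * 3 ^ k" "(w, v0) \<in> cell_adj W ^^ l"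
      using cell_chain[OF us(1) vt(1) us(2) vt(2) uv in_W] us(3) vt(3) by auto
    show ?thesis unfolding Q_def J_def
      by (rule cavg_chain[OF _ WA A l(2,1)]) (auto simp: W_def)
  qed
  \<comment> \<open>Boundedly many level-m cells meet the ball, and each has \<open>5 ^ k\<close>
    descendants of level \<open>n\<close>.\<close>
  have cardW': "card W' \<le> ncount 1 * 5 ^ k"
  proof -
    define U where "U = {u \<in> vwords m. vpsi_word u ` vicsek \<inter> B \<noteq> {}}"
    have "card U \<le> ncount 1"
    proof (cases "m = 0")
      case True
      have "card U \<le> card (vwords m)" by (intro card_mono) (auto simp: U_def)
      thus ?thesis using True by (simp add: ncount_def)
    next
      case False
      have "card U \<le> card {u \<in> vwords m. \<exists>y\<in>vpsi_word u ` vicsek. dist x0 y \<le> real 1 / 3 ^ m}"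
      proof (intro card_mono subsetI)
        fix u assume "u \<in> U"
        then obtain y where y: "u \<in> vwords m" "y \<in> vpsi_word u ` vicsek" "y \<in> B" by (auto simp: U_def)
        have "dist x0 y \<le> real 1 / 3 ^ m" using vball_dist[OF x0, of y r] y(3) m(2) False by (simp add: B_def)
        thus "u \<in> {u \<in> vwords m. \<exists>y\<in>vpsi_word u ` vicsek. dist x0 y \<le> real 1 / 3 ^ m}" using y by blast
      qed simp
      also have "\<dots> \<le> ncount 1" by (rule card_cells_near)
      finally show ?thesis .
    qed
    have "W' \<subseteq> (\<lambda>(u, s). u @ s) ` (U \<times> vwords k)"
    proof
      fix w assume w: "w \<in> W'"
      hence "w \<in> W" using W'W by blast
      hence "take m w \<in> U" "drop m w \<in> vwords k" using vwords_split[of w m k] by (auto simp: W_def U_def n_def)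
      thus "w \<in> (\<lambda>(u, s). u @ s) ` (U \<times> vwords k)" by (intro image_eqI[of _ _ "(take m w, drop m w)"]) auto
    qed
    hence "card W' \<le> card ((\<lambda>(u, s). u @ s) ` (U \<times> vwords k))" by (intro card_mono) (auto simp: U_def)
    also have "\<dots> \<le> card (U \<times> vwords k)" by (intro card_image_le) (simp add: U_def)
    also have "\<dots> \<le> ncount 1 * 5 ^ k" using \<open>card U \<le> ncount 1\<close> by (simp add: card_cartesian_product card_vwords)
    finally show ?thesis .
  qed
  let ?C = "\<lambda>w. vpsi_word w ` vicsek"
  have "(\<integral>\<^sup>+x\<in>B. ennreal (\<bar>f x - cavg v0\<bar> powr p) \<partial>vmeasure)
    \<le> (\<integral>\<^sup>+x. (\<Sum>w\<in>W'. ennreal (\<bar>f x - cavg v0\<bar> powr p) * indicator (?C w) x) \<partial>vmeasure)"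
  proof (intro nn_integral_mono)
    fix x
    show "ennreal (\<bar>f x - cavg v0\<bar> powr p) * indicator B x
      \<le> (\<Sum>w\<in>W'. ennreal (\<bar>f x - cavg v0\<bar> powr p) * indicator (?C w) x)"
    proof (cases "x \<in> B")
      case True
      hence "x \<in> vicsek" using vball_subset by (auto simp: B_def)
      then obtain w where w: "w \<in> vwords n" "x \<in> ?C w" using cell_ex by blast
      have "w \<in> W'" using w True by (auto simp: W'_def)
      hence "ennreal (\<bar>f x - cavg v0\<bar> powr p) * indicator (?C w) x
        \<le> (\<Sum>w\<in>W'. ennreal (\<bar>f x - cavg v0\<bar> powr p) * indicator (?C w) x)"
        using finW' by (intro member_le_sum) auto
      thus ?thesis using True w by simp
    qed simp
  qed
  also have "\<dots> = (\<Sum>w\<in>W'. \<integral>\<^sup>+x\<in>?C w. ennreal (\<bar>f x - cavg v0\<bar> powr p) \<partial>vmeasure)"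
  proof (rule nn_integral_sum)
    fix w assume "w \<in> W'"
    hence [measurable]: "?C w \<in> sets vmeasure" by (intro cell_sets) (auto simp: W'_def)
    show "(\<lambda>x. ennreal (\<bar>f x - cavg v0\<bar> powr p) * indicator (?C w) x) \<in> borel_measurable vmeasure"
      by measurable
  qed
  also have "\<dots> \<le> (\<Sum>w\<in>W'. ennreal (2 powr (p - 1)) * (ennreal (5 ^ n) * dbl (?C w) (?C w)
        + ennreal (\<bar>cavg w - cavg v0\<bar> powr p) * ennreal (1 / 5 ^ n)))"
    by (intro sum_mono cell_integral_le) (auto simp: W'_def)
  also have "\<dots> = ennreal (2 powr (p - 1)) * (ennreal (5 ^ n) * (\<Sum>w\<in>W'. dbl (?C w) (?C w))
        + (\<Sum>w\<in>W'. ennreal (\<bar>cavg w - cavg v0\<bar> powr p) * ennreal (1 / 5 ^ n)))"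
    by (simp only: sum_distrib_left[symmetric] sum.distrib)
  also have "\<dots> \<le> ennreal (2 powr (p - 1)) * (ennreal (5 ^ n) * (ennreal (Nc / 5 ^ n) * J)
        + ennreal (real (ncount 1) * 5 ^ k) * (ennreal Q * J * ennreal (1 / 5 ^ n)))"
  \<comment> \<open>The oscillations inside the cells add up to one energy, each cell being paired
    with itself; the deviations of the averages are bounded one by one through chains.\<close>
  proof (intro mult_left_mono add_mono)
    show "(\<Sum>w\<in>W'. dbl (?C w) (?C w)) \<le> ennreal (Nc / 5 ^ n) * J"
      unfolding J_def
    proof (rule sum_dbl_le_energy[where u = "\<lambda>w. w" and v = "\<lambda>w. w"])
      fix w assume w: "w \<in> W'"
      show "w \<in> vwords n" "w \<in> vwords n" "?C w \<inter> ?C w \<noteq> {}" using w zero_in_vicsek by (auto simp: W'_def)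
      show "?C w \<subseteq> A" "?C w \<subseteq> A" using WA W'W w by blast+
    qed (use finW' A in auto)
    have "(\<Sum>w\<in>W'. ennreal (\<bar>cavg w - cavg v0\<bar> powr p) * ennreal (1 / 5 ^ n))
      \<le> (\<Sum>w\<in>W'. ennreal Q * J * ennreal (1 / 5 ^ n))"
      by (intro sum_mono mult_right_mono chain) auto
    also have "\<dots> = of_nat (card W') * (ennreal Q * J * ennreal (1 / 5 ^ n))" by simp
    also have "\<dots> \<le> ennreal (real (ncount 1) * 5 ^ k) * (ennreal Q * J * ennreal (1 / 5 ^ n))"
    proof (rule mult_right_mono)
      have "real (card W') \<le> real (ncount 1 * 5 ^ k)" using cardW' by (rule of_nat_mono)
      thus "of_nat (card W') \<le> ennreal (real (ncount 1) * 5 ^ k)"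
        by (simp add: ennreal_of_nat_eq_real_of_nat ennreal_leI)
    qed simp
    finally show "(\<Sum>w\<in>W'. ennreal (\<bar>cavg w - cavg v0\<bar> powr p) * ennreal (1 / 5 ^ n))
      \<le> ennreal (real (ncount 1) * 5 ^ k) * (ennreal Q * J * ennreal (1 / 5 ^ n))" .
  qed auto
  also have "ennreal (5 ^ n) * (ennreal (Nc / 5 ^ n) * J) = ennreal Nc * J"
    using Nc_pos by (simp add: mult.assoc[symmetric] flip: ennreal_mult')
  also have "ennreal (real (ncount 1) * 5 ^ k) * (ennreal Q * J * ennreal (1 / 5 ^ n))
    = ennreal (real (ncount 1) * (5 ^ k * ((2 * 3 ^ k) powr (p - 1) * Nc))) * J"
  proof -
    have "real (ncount 1) * (5 ^ k * ((2 * 3 ^ k) powr (p - 1) * Nc)) = (real (ncount 1) * 5 ^ k) * (Q * (1 / 5 ^ n))"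
      by (simp add: Q_def)
    also have "ennreal \<dots> = ennreal (real (ncount 1) * 5 ^ k) * (ennreal Q * ennreal (1 / 5 ^ n))"
      using Qnn ennreal_mult[of "real (ncount 1) * 5 ^ k" "Q * (1 / 5 ^ n)"] ennreal_mult[of Q "1 / 5 ^ n"] by simp
    finally show ?thesis by (simp only: mult_ac)
  qed
  also have "ennreal Nc * J + ennreal (real (ncount 1) * (5 ^ k * ((2 * 3 ^ k) powr (p - 1) * Nc))) * J
    = ennreal (Nc + real (ncount 1) * (5 ^ k * ((2 * 3 ^ k) powr (p - 1) * Nc))) * J"
    using Nc_pos by (subst ennreal_plus) (auto simp: distrib_right)
  finally have main: "(\<integral>\<^sup>+x\<in>B. ennreal (\<bar>f x - cavg v0\<bar> powr p) \<partial>vmeasure)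
    \<le> ennreal (2 powr (p - 1)) * (ennreal (Nc + real (ncount 1) * (5 ^ k * ((2 * 3 ^ k) powr (p - 1) * Nc))) * J)" .
  have "(\<integral>\<^sup>+x\<in>B. ennreal (\<bar>f x - vmean f B\<bar> powr p) \<partial>vmeasure)
    \<le> ennreal (2 powr p) * (\<integral>\<^sup>+x\<in>B. ennreal (\<bar>f x - cavg v0\<bar> powr p) \<partial>vmeasure)"
    using measure_vball_pos[OF x0 r] by (intro mean_minimizes B) (simp add: B_def)
  also have "\<dots> \<le> ennreal (2 powr p) * (ennreal (2 powr (p - 1)) * (ennreal (Nc + real (ncount 1) * (5 ^ k * ((2 * 3 ^ k) powr (p - 1) * Nc))) * J))"
    by (intro mult_left_mono main) simp
  also have "\<dots> = ennreal (2 powr p * (2 powr (p - 1) * (Nc + real (ncount 1) * (5 ^ k * ((2 * 3 ^ k) powr (p - 1) * Nc))))) * J"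
  proof -
    have nn: "0 \<le> Nc + real (ncount 1) * (5 ^ k * ((2 * 3 ^ k) powr (p - 1) * Nc))" using Nc_pos by simp
    have "ennreal (2 powr p * (2 powr (p - 1) * (Nc + real (ncount 1) * (5 ^ k * ((2 * 3 ^ k) powr (p - 1) * Nc)))))
      = ennreal (2 powr p) * (ennreal (2 powr (p - 1)) * ennreal (Nc + real (ncount 1) * (5 ^ k * ((2 * 3 ^ k) powr (p - 1) * Nc))))"
      using nn by (simp only: ennreal_mult powr_ge_zero mult_nonneg_nonneg)
    thus ?thesis by (simp only: mult.assoc)
  qed
  finally show ?thesis unfolding B_def A_def J_def n_def .
qed

end

section \<open>Passing to the limit\<close>

lemma three_powr_dh: "3 powr dh = 5"
  by (simp add: dh_def powr_def)

lemma ks_exponent: "1 < p \<Longrightarrow> p * ks_alpha p = p - 1 + dh"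
  by (simp add: ks_alpha_def algebra_simps)

text \<open>Because \<open>3 powr dh = 5\<close>, the growth
  \<open>5 ^ k * (3 ^ k) powr (p - 1)\<close> is exactly \<open>(3 ^ k) powr (p - 1 + dh)\<close>
  and cancels against the radius. What remains does not depend on \<open>k\<close>; 144 = 48 * 3
  comes from \<open>1 / 3 ^ m \<le> 3 * r\<close>.\<close>

lemma scale_constant:
  fixes p r N M :: real
  assumes p: "1 < p" and r: "0 < r" "1 / 3 ^ m \<le> 3 * r" and N: "0 \<le> N" "0 \<le> M"
  shows "(N + M * (5 ^ k * ((2 * 3 ^ k) powr (p - 1) * N))) * (48 / 3 ^ (m + k)) powr (p - 1 + dh)
    \<le> N * (1 + M * 2 powr (p - 1)) * 144 powr (p - 1 + dh) * r powr (p - 1 + dh)"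
proof -
  define s where "s = p - 1 + dh"
  have dh: "0 < dh" by (simp add: dh_def)
  hence s: "0 < s" using p by (simp add: s_def)
  have k: "(1 / 3 ^ k) powr s * (5 ^ k * (3 ^ k) powr (p - 1)) = (1 :: real)"
  proof -
    have "(3 ^ k :: real) powr dh = 5 ^ k"
      by (simp add: three_powr_dh powr_powr[symmetric] powr_realpow[symmetric] mult.commute[of _ dh] powr_powr)
    hence "(5 :: real) ^ k * (3 ^ k) powr (p - 1) = (3 ^ k) powr s"
      by (simp add: s_def powr_add mult.commute)
    thus ?thesis by (simp add: powr_divide)
  qed
  have rho: "(48 / 3 ^ (m + k)) powr s = 48 powr s * (1 / 3 ^ m) powr s * (1 / 3 ^ k) powr s"
  proof -
    have "48 / 3 ^ (m + k) = 48 * (1 / 3 ^ m) * (1 / (3 ^ k :: real))" by (simp add: power_add)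
    thus ?thesis by (simp only: powr_mult)
  qed
  have le1: "(1 / 3 ^ k) powr s \<le> (1 :: real)"
    using s by (intro powr_le1) auto
  have "(N + M * (5 ^ k * ((2 * 3 ^ k) powr (p - 1) * N))) * (48 / 3 ^ (m + k)) powr s
    = N * 48 powr s * (1 / 3 ^ m) powr s * ((1 / 3 ^ k) powr s + M * 2 powr (p - 1) * ((1 / 3 ^ k) powr s * (5 ^ k * (3 ^ k) powr (p - 1))))"
    unfolding rho by (simp add: powr_mult algebra_simps)
  also have "\<dots> = N * 48 powr s * (1 / 3 ^ m) powr s * ((1 / 3 ^ k) powr s + M * 2 powr (p - 1))"
    unfolding k by simp
  also have "\<dots> \<le> N * 48 powr s * (3 * r) powr s * (1 + M * 2 powr (p - 1))"
    using p N r s le1 by (intro mult_mono add_mono powr_mono2) auto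
  also have "\<dots> = N * (1 + M * 2 powr (p - 1)) * (48 powr s * 3 powr s) * r powr s"
    using r by (simp add: powr_mult)
  also have "48 powr s * 3 powr s = (144 :: real) powr s" by (simp flip: powr_mult)
  finally show ?thesis by (simp add: s_def)
qed

text \<open>Any property holding eventually near 0 holds at some \<open>\<rho> k\<close>, so every
  supremum in the definition of the limit superior is at least \<open>X\<close>.\<close>

lemma Limsup_ge_along_sequence:
  fixes E :: "real \<Rightarrow> ennreal"
  assumes "\<And>k. X \<le> E (\<rho> k)" "\<rho> \<longlonglongrightarrow> 0" "\<And>k. 0 < \<rho> k"
  shows "X \<le> Limsup (at_right 0) E"
  unfolding Limsup_def
proof (rule INF_greatest, clarify)
  fix P :: "real \<Rightarrow> bool" assume P: "eventually P (at_right 0)"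
  have "filterlim \<rho> (at_right 0) sequentially"
    using assms by (intro filterlim_at_withinI) auto
  hence "eventually (\<lambda>k. P (\<rho> k)) sequentially" using P by (simp add: filterlim_iff)
  then obtain k where "P (\<rho> k)" using eventually_happens by (metis sequentially_bot)
  thus "X \<le> Sup (E ` Collect P)" using assms(1)[of k] by (intro SUP_upper2[of "\<rho> k"]) auto
qed

lemma scale_ex:
  fixes r :: real
  assumes "0 < r"
  obtains m where "1 / 3 ^ m \<le> 3 * r" "m = 0 \<or> r \<le> 1 / 3 ^ m"
proof (cases "r \<le> 1")
  case True
  then obtain m where "1 / 3 ^ Suc m < r" "r \<le> 1 / 3 ^ m" using triadic_scale[OF assms] by blast
  thus ?thesis using that[of m] by simp
next
  case False
  thus ?thesis using that[of 0] by simp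
qed

theorem corollary4p2:
  fixes p :: real
  assumes "1 < p"
  shows "\<exists>c C :: real. 0 < c \<and> 0 < C \<and>
    (\<forall>f \<in> ks_space p. \<forall>x\<^sub>0 \<in> vicsek. \<forall>r > 0.
      (\<integral>\<^sup>+x\<in>vball x\<^sub>0 r. ennreal (\<bar>f x - vmean f (vball x\<^sub>0 r)\<bar> powr p) \<partial>vmeasure)
        \<le> ennreal (C * r powr (p - 1 + dh)) * ks_pow p (vball x\<^sub>0 (c * r)) f)"
proof -
  define s where "s = p - 1 + dh"
  define N where "N = real (ncount 0) * real (ncount 48)"
  define M where "M = real (ncount 1)"
  define C where "C = 2 powr p * (2 powr (p - 1) * (N * (1 + M * 2 powr (p - 1)) * 144 powr s))"
  have NM: "0 < N" "0 < M" using ncount_pos by (simp_all add: N_def M_def)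
  have Cpos: "0 < C" unfolding C_def using NM by (intro mult_pos_pos add_pos_pos) auto
  show ?thesis
  proof (rule exI[of _ 84], rule exI[of _ C], intro conjI ballI allI impI)
    fix f x0 and r :: real assume f: "f \<in> ks_space p" and x0: "x0 \<in> vicsek" and r: "r > 0"
    interpret vicsek_lp p f
      using assms f by unfold_locales (auto simp: ks_space_def lp_space_def)
    let ?B = "vball x0 r" and ?A = "vball x0 (84 * r)"
    let ?L = "\<integral>\<^sup>+x\<in>?B. ennreal (\<bar>f x - vmean f ?B\<bar> powr p) \<partial>vmeasure"
    define E where "E = (\<lambda>\<rho>. ennreal (1 / \<rho> powr s) * energy ?A \<rho>)"
    have ks: "ks_pow p ?A f = Limsup (at_right 0) E"
      unfolding ks_pow_def E_def energy_def ks_exponent[OF assms] s_def ..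
    obtain m where m: "1 / 3 ^ m \<le> 3 * r" "m = 0 \<or> r \<le> 1 / 3 ^ m" using scale_ex[OF r] by blast
    \<comment> \<open>The radii of \<open>level_estimate\<close>: \<open>m\<close> stays fixed by
      \<open>r\<close> while the refinement \<open>k\<close> sends them to 0.\<close>
    define \<rho> where "\<rho> = (\<lambda>k. 48 / 3 ^ (m + k) :: real)"
    have \<rho>pos: "0 < \<rho> k" for k by (simp add: \<rho>_def)
    have "(\<lambda>k. 48 / 3 ^ m * (1 / 3) ^ k) \<longlonglongrightarrow> 48 / 3 ^ m * (0 :: real)"
      by (intro tendsto_mult tendsto_const LIMSEQ_realpow_zero) auto
    hence \<rho>lim: "\<rho> \<longlonglongrightarrow> 0" by (simp add: \<rho>_def power_add power_one_over)
    have level: "?L \<le> ennreal (C * r powr s) * E (\<rho> k)" for k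
    proof -
      let ?c = "2 powr p * (2 powr (p - 1) * (N + M * (5 ^ k * ((2 * 3 ^ k) powr (p - 1) * N))))"
      have "energy ?A (\<rho> k) = ennreal (\<rho> k powr s * (1 / \<rho> k powr s)) * energy ?A (\<rho> k)"
        using \<rho>pos[of k] by simp
      also have "\<dots> = ennreal (\<rho> k powr s) * E (\<rho> k)"
        unfolding E_def by (simp add: ennreal_mult mult.assoc del: times_divide_eq_right)
      finally have eq: "energy ?A (\<rho> k) = ennreal (\<rho> k powr s) * E (\<rho> k)" .
      have "?L \<le> ennreal ?c * energy ?A (\<rho> k)"
        using level_estimate[OF x0 r m, of k] by (simp add: \<rho>_def Nc_def N_def M_def)
      also have "\<dots> = ennreal (?c * \<rho> k powr s) * E (\<rho> k)"
        unfolding eq using NM by (simp add: ennreal_mult' mult.assoc)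
      also have "?c * \<rho> k powr s \<le> C * r powr s"
        using mult_left_mono[OF scale_constant[OF assms r m(1), of N M k], of "2 powr p * 2 powr (p - 1)"] NM
        by (simp add: C_def s_def \<rho>_def mult_ac)
      finally show ?thesis by (simp add: ennreal_leI mult_right_mono)
    qed
    \<comment> \<open>Dividing by the constant first leaves a left side independent of
      \<open>k\<close>, so the limit superior can be bounded below along the sequence of
      radii.\<close>
    have "?L * ennreal (1 / (C * r powr s)) \<le> Limsup (at_right 0) E"
    proof (rule Limsup_ge_along_sequence[OF _ \<rho>lim \<rho>pos])
      fix k
      have "?L * ennreal (1 / (C * r powr s)) \<le> ennreal (C * r powr s) * E (\<rho> k) * ennreal (1 / (C * r powr s))"
        by (intro mult_right_mono level) simp
      also have "\<dots> = ennreal (C * r powr s * (1 / (C * r powr s))) * E (\<rho> k)"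
        using Cpos r by (subst ennreal_mult) (auto simp: mult_ac)
      also have "\<dots> = E (\<rho> k)" using Cpos r by simp
      finally show "?L * ennreal (1 / (C * r powr s)) \<le> E (\<rho> k)" .
    qed
    hence "?L \<le> ennreal (C * r powr s) * Limsup (at_right 0) E"
      using Cpos r by (intro ennreal_div_le_imp) auto
    thus "?L \<le> ennreal (C * r powr (p - 1 + dh)) * ks_pow p ?A f"
      unfolding ks s_def .
  qed (use Cpos in auto)
qed

end
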